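(* JavaScript regex matching without lower-bounded quantifiers is in PSPACE: the decision problem $\mathrm{JSREGTEST}_{\mathcal R}$, where $\mathcal R$ is the set of all JavaScript regexes without lower-bounded quantifiers (lookarounds of all kinds and backreferences allowed), belongs to PSPACE.
   Context: **Regexes.** Fix a finite alphabet $\Sigma$ (of the JavaScript characters) with a designated subset of word characters. JavaScript regexes are generated by: empty regex $\varepsilon$; character descriptor $cd\subseteq\Sigma$ (a single character $c$ stands for $\{c\}$); disjunction $r_1|r_2$; sequence $r_1r_2$; capture group $({}_g\,r)$ with group identifier $g$ (each identifier is used by at most one capture group of a regex); backreference $\backslash g$; quantifier $r\{min,\Delta,\kappa\}$ with $min\in\mathbb N$ the minimum number of repetitions, $\Delta\in\mathbb N\cup\{\infty\}$ the difference between maximum and minimum, and $\kappa=\top$ (greedy) or $\bot$ (lazy), the star being $r*=r\{0,\infty,\top\}$; lookaheads $(?{=}\,r)$ (positive), $(?!\,r)$ (negative); lookbehinds $(?{<}{=}\,r)$ (positive), $(?{<}!\,r)$ (negative); anchors ^, $\$$, $\backslash b$, $\backslash B$. A quantifier is *lower-bounded* if $min\neq0$. **Semantics (ECMAScript backtracking semantics, no flags).** Fix a string $s=s_0\cdots s_{|s|-1}$ over $\Sigma$. A group map $\gamma$ assigns to each group identifier "undefined", "opened at $a$", or a closed range $(a,b)$, $a\le b$; $\emptyset$ is everywhere undefined. An action is a regex, $\mathrm{Aclose}\,g$, or $\mathrm{Acheck}\,k$ ($k$ a position). Directions are $\rightarrow$ and $\leftarrow$. For a list of actions $l$, position $0\le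 p\le|s|$, group map $\gamma$ and direction $d$, the ordered list of results (leaves of the backtracking tree, highest priority first) $L(l,p,\gamma,d)$ is given by the following rules, where $\mathbin{+\!+}$ is list concatenation and $\gamma\setminus r$ is $\gamma$ with all groups occurring in $r$ made undefined: - $L([],p,\gamma,d)=[(p,\gamma)]$. - $L(\mathrm{Acheck}\,k::l,p,\gamma,d)=L(l,p,\gamma,d)$ if $p$ is strictly further than $k$ in direction $d$ ($p>k$ if $d={\rightarrow}$, $p<k$ if $d={\leftarrow}$), else $[]$. - $L(\mathrm{Aclose}\,g::l,p,\gamma,d)=L(l,p,\gamma[g\mapsto(\min(a,p),\max(a,p))],d)$, where $g$ is opened at $a$ in $\gamma$. - $L(\varepsilon::l,p,\gamma,d)=L(l,p,\gamma,d)$. - $L(cd::l,p,\gamma,\rightarrow)=L(l,p+1,\gamma,\rightarrow)$ if $p<|s|$ and $s_p\in cd$, else $[]$; $L(cd::l,p,\gamma,\leftarrow)=L(l,p-1,\gamma,\leftarrow)$ if $p>0$ and $s_{p-1}\in cd$, else $[]$. - $L((r_1|r_2)::l,p,\gamma,d)=L(r_1::l,p,\gamma,d)\mathbin{+\!+}L(r_2::l,p,\gamma,d)$. - $L(r_1r_2::l,p,\gamma,d)$ is $L(r_1::r_2::l,p,\gamma,d)$ if $d={\rightarrow}$ and $L(r_2::r_1::l,p,\gamma,d)$ if $d={\leftarrow}$. - $L(r\{min+1,\Delta,\kappa\}::l,p,\gamma,d)=L(r::r\{min,\Delta,\kappa\}::l,p,\gamma\setminus r,d)$. - $L(r\{0,0,\kappa\}::l,p,\gamma,d)=L(l,p,\gamma,d)$.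 - For $\Delta>0$, with $I=L(r::\mathrm{Acheck}\,p::r\{0,\Delta-1,\kappa\}::l,p,\gamma\setminus r,d)$ (where $\infty-1=\infty$) and $S=L(l,p,\gamma,d)$: $L(r\{0,\Delta,\top\}::l,p,\gamma,d)=I\mathbin{+\!+}S$ and $L(r\{0,\Delta,\bot\}::l,p,\gamma,d)=S\mathbin{+\!+}I$. - $L(({}_g\,r)::l,p,\gamma,d)=L(r::\mathrm{Aclose}\,g::l,p,\gamma[g\mapsto\text{opened at }p],d)$. - Lookaround with body $r$: let $M=L([r],p,\gamma,d')$ with $d'={\rightarrow}$ for lookaheads and $d'={\leftarrow}$ for lookbehinds. Positive: the result is $[]$ if $M=[]$, and $L(l,p,\gamma',d)$ if the first element of $M$ is $(p',\gamma')$. Negative: the result is $L(l,p,\gamma,d)$ if $M=[]$, and $[]$ otherwise. - Anchors: $L(l,p,\gamma,d)$ if the anchor is satisfied at $p$, else $[]$; ^ is satisfied iff $p=0$, $\$$ iff $p=|s|$, $\backslash b$ iff exactly one of "$p>0$ and $s_{p-1}$ is a word character", "$p<|s|$ and $s_p$ is a word character" holds, $\backslash B$ iff $\backslash b$ is not. - $L(\backslash g::l,p,\gamma,d)$: if $\gamma(g)$ is not a closed range, $L(l,p,\gamma,d)$; if $\gamma(g)=(a,b)$ and $w=s_a\cdots s_{b-1}$, then $L(l,p\pm|w|,\gamma,d)$ ($+$ if $d={\rightarrow}$, $-$ if $d={\leftarrow}$) provided $w$ is the factor of $s$ of length $|w|$ starting (resp. ending) at position $p$, else $[]$. **Problem.**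 For a set $\mathcal R$ of regexes, $\mathrm{JSREGTEST}_{\mathcal R}$ is: given $r\in\mathcal R$ and a string $s$, does $r$ have a match in $s$, i.e. is $L([r],k,\emptyset,\rightarrow)\neq[]$ for some starting position $0\le k\le|s|$? **Instance size.** $r$ is given by its syntax tree (numbers $\Delta$ and group identifiers in binary; regex parsing is out of scope); complexity is measured in $|s|$ and the size of $r$ (and the bit lengths of those numbers), where $|\varepsilon|=|cd|=|\text{anchor}|=|\backslash g|=1$, $|r_1|r_2|=|r_1r_2|=1+|r_1|+|r_2|$, $|r\{0,\Delta,\kappa\}|=3+|r|$, a lookaround of body $r$ has size $1+|r|$, and $|({}_g\,r)|=2+|r|$. *)

theory Defs
  imports "HOL-Library.Extended_Nat" "HOL-Computational_Algebra.Polynomial"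
begin

section \<open>Regexes\<close>

datatype anchor = Input_Start | Input_End | Word_Boundary | Non_Word_Boundary

datatype lookaround = Lookahead | Neg_Lookahead | Lookbehind | Neg_Lookbehind

text \<open>The alphabet is the finite type \<open>'c\<close>. In \<open>Quant r min \<Delta> greedy\<close> the maximal number of
  repetitions is \<open>min + \<Delta>\<close>.\<close>

datatype 'c regex =
    Epsilon
  | Chars "'c set"
  | Disj "'c regex" "'c regex"
  | Sequence "'c regex" "'c regex"
  | Group nat "'c regex"
  | Backref nat
  | Quant "'c regex" nat enat bool
  | Look lookaround "'c regex"
  | Anchor anchor

primrec group_ids :: "'c regex \<Rightarrow> nat list" where
  "group_ids Epsilon = []"
| "group_ids (Chars cd) = []"
| "group_ids (Disj r1 r2) = group_ids r1 @ group_ids r2"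
| "group_ids (Sequence r1 r2) = group_ids r1 @ group_ids r2"
| "group_ids (Group g r) = g # group_ids r"
| "group_ids (Backref g) = []"
| "group_ids (Quant r m D greedy) = group_ids r"
| "group_ids (Look k r) = group_ids r"
| "group_ids (Anchor a) = []"

definition js_regex :: "'c regex \<Rightarrow> bool" where
  "js_regex r \<longleftrightarrow> distinct (group_ids r)"

primrec has_lower_bounded :: "'c regex \<Rightarrow> bool" where
  "has_lower_bounded Epsilon = False"
| "has_lower_bounded (Chars cd) = False"
| "has_lower_bounded (Disj r1 r2) = (has_lower_bounded r1 \<or> has_lower_bounded r2)"
| "has_lower_bounded (Sequence r1 r2) = (has_lower_bounded r1 \<or> has_lower_bounded r2)"
| "has_lower_bounded (Group g r) = has_lower_bounded r"
| "has_lower_bounded (Backref g) = False"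
| "has_lower_bounded (Quant r m D greedy) = (m \<noteq> 0 \<or> has_lower_bounded r)"
| "has_lower_bounded (Look k r) = has_lower_bounded r"
| "has_lower_bounded (Anchor a) = False"

section \<open>Backtracking semantics\<close>

datatype dir = Forward | Backward

datatype group_state = Undefined | Opened nat | Closed nat nat

type_synonym group_map = "nat \<Rightarrow> group_state"

datatype 'c action = Areg "'c regex" | Aclose nat | Acheck nat

definition reset_groups :: "'c regex \<Rightarrow> group_map \<Rightarrow> group_map" where
  "reset_groups r \<gamma> = (\<lambda>g. if g \<in> set (group_ids r) then Undefined else \<gamma> g)"

text \<open>The second case is a dummy: closing actions are only ever executed on opened groups
  when group identifiers are unique.\<close>

fun close_group :: "nat \<Rightarrow> nat \<Rightarrow> group_map \<Rightarrow> group_map" where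
  "close_group g p \<gamma> =
     (case \<gamma> g of
        Opened a \<Rightarrow> \<gamma>(g := Closed (min a p) (max a p))
      | _ \<Rightarrow> \<gamma>)"

fun further :: "dir \<Rightarrow> nat \<Rightarrow> nat \<Rightarrow> bool" where
  "further Forward p k = (p > k)"
| "further Backward p k = (p < k)"

definition word_boundary :: "'c set \<Rightarrow> 'c list \<Rightarrow> nat \<Rightarrow> bool" where
  "word_boundary W s p \<longleftrightarrow>
     ((p > 0 \<and> s ! (p - 1) \<in> W) \<noteq> (p < length s \<and> s ! p \<in> W))"

fun anchor_holds :: "'c set \<Rightarrow> 'c list \<Rightarrow> anchor \<Rightarrow> nat \<Rightarrow> bool" where
  "anchor_holds W s Input_Start p = (p = 0)"
| "anchor_holds W s Input_End p = (p = length s)"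
| "anchor_holds W s Word_Boundary p = word_boundary W s p"
| "anchor_holds W s Non_Word_Boundary p = (\<not> word_boundary W s p)"

fun look_dir :: "lookaround \<Rightarrow> dir" where
  "look_dir Lookahead = Forward"
| "look_dir Neg_Lookahead = Forward"
| "look_dir Lookbehind = Backward"
| "look_dir Neg_Lookbehind = Backward"

fun positive :: "lookaround \<Rightarrow> bool" where
  "positive Lookahead = True"
| "positive Neg_Lookahead = False"
| "positive Lookbehind = True"
| "positive Neg_Lookbehind = False"

fun read_char :: "'c list \<Rightarrow> 'c set \<Rightarrow> nat \<Rightarrow> dir \<Rightarrow> nat option" where
  "read_char s cd p Forward = (if p < length s \<and> s ! p \<in> cd then Some (p + 1) else None)"
| "read_char s cd p Backward = (if p > 0 \<and> s ! (p - 1) \<in> cd then Some (p - 1) else None)"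

fun read_word :: "'c list \<Rightarrow> 'c list \<Rightarrow> nat \<Rightarrow> dir \<Rightarrow> nat option" where
  "read_word s w p Forward =
     (if take (length w) (drop p s) = w then Some (p + length w) else None)"
| "read_word s w p Backward =
     (if length w \<le> p \<and> take (length w) (drop (p - length w) s) = w
      then Some (p - length w) else None)"

fun read_backref :: "'c list \<Rightarrow> group_state \<Rightarrow> nat \<Rightarrow> dir \<Rightarrow> nat option" where
  "read_backref s (Closed a b) p d = read_word s (take (b - a) (drop a s)) p d"
| "read_backref s _ p d = Some p"

subsection \<open>Termination measure\<close>

text \<open>\<open>rweight B r d f n\<close> bounds the number of recursive calls needed to process \<open>r\<close> in direction
  \<open>d\<close> when at most \<open>n\<close> positions remain ahead and the continuation costs at most \<open>f n'\<close> once \<open>n'\<close>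
  positions remain ahead. Every position is at most \<open>B\<close>.\<close>

primrec iter_weight ::
    "((nat \<Rightarrow> nat) \<Rightarrow> nat \<Rightarrow> nat) \<Rightarrow> (nat \<Rightarrow> nat) \<Rightarrow> nat \<Rightarrow> nat \<Rightarrow> nat" where
  "iter_weight w f 0 = (\<lambda>n. 1 + f n + w (\<lambda>_. 1) n)"
| "iter_weight w f (Suc k) = (\<lambda>n. 1 + f n + w (\<lambda>n'. 1 + iter_weight w f k (min n' k)) n)"

primrec min_weight ::
    "((nat \<Rightarrow> nat) \<Rightarrow> nat \<Rightarrow> nat) \<Rightarrow> (nat \<Rightarrow> nat) \<Rightarrow> nat \<Rightarrow> nat \<Rightarrow> nat" where
  "min_weight w h 0 = h"
| "min_weight w h (Suc m) = (\<lambda>n. 1 + w (min_weight w h m) n)"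

primrec rweight :: "nat \<Rightarrow> 'c regex \<Rightarrow> dir \<Rightarrow> (nat \<Rightarrow> nat) \<Rightarrow> nat \<Rightarrow> nat" where
  "rweight B Epsilon = (\<lambda>d f n. 1 + f n)"
| "rweight B (Chars cd) = (\<lambda>d f n. 1 + f n)"
| "rweight B (Disj r1 r2) = (\<lambda>d f n. 1 + rweight B r1 d f n + rweight B r2 d f n)"
| "rweight B (Sequence r1 r2) = (\<lambda>d f n. 1 +
     (case d of Forward \<Rightarrow> rweight B r1 d (rweight B r2 d f) n
              | Backward \<Rightarrow> rweight B r2 d (rweight B r1 d f) n))"
| "rweight B (Group g r) = (\<lambda>d f n. 1 + rweight B r d (\<lambda>n. 1 + f n) n)"
| "rweight B (Backref g) = (\<lambda>d f n. 1 + f n)"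
| "rweight B (Quant r m D greedy) = (\<lambda>d f n.
     min_weight (rweight B r d) (\<lambda>n. iter_weight (rweight B r d) f n n) m n)"
| "rweight B (Look k r) = (\<lambda>d f n. 1 + f n + rweight B r (look_dir k) (\<lambda>_. 0) B)"
| "rweight B (Anchor a) = (\<lambda>d f n. 1 + f n)"

fun ahead :: "dir \<Rightarrow> nat \<Rightarrow> nat \<Rightarrow> nat" where
  "ahead Forward B p = B - p"
| "ahead Backward B p = p"

fun aweight :: "nat \<Rightarrow> dir \<Rightarrow> 'c action \<Rightarrow> (nat \<Rightarrow> nat) \<Rightarrow> nat \<Rightarrow> nat" where
  "aweight B d (Areg r) f n = rweight B r d f n"
| "aweight B d (Aclose g) f n = 1 + f n"
| "aweight B d (Acheck k) f n =
     (if ahead d B k = 0 then 1 else 1 + f (min n (ahead d B k - 1)))"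

lemma aweight_eta:
  "aweight B d (Areg r) = rweight B r d"
  "aweight B d (Aclose g) = (\<lambda>f n. 1 + f n)"
  by (rule ext, rule ext, simp)+

primrec lweight :: "nat \<Rightarrow> dir \<Rightarrow> 'c action list \<Rightarrow> nat \<Rightarrow> nat" where
  "lweight B d [] = (\<lambda>n. 0)"
| "lweight B d (a # l) = aweight B d a (lweight B d l)"

definition le_fun :: "(nat \<Rightarrow> nat) \<Rightarrow> (nat \<Rightarrow> nat) \<Rightarrow> bool" where
  "le_fun f f' \<longleftrightarrow> (\<forall>n n'. n \<le> n' \<longrightarrow> f n \<le> f' n')"

definition le_op where
  "le_op w w' \<longleftrightarrow> (\<forall>f f'. le_fun f f' \<longrightarrow> le_fun (w f) (w' f'))"

lemma le_funI: "(\<And>n n'. n \<le> n' \<Longrightarrow> f n \<le> f' n') \<Longrightarrow> le_fun f f'"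
  by (simp add: le_fun_def)

lemma le_funD: "le_fun f f' \<Longrightarrow> n \<le> n' \<Longrightarrow> f n \<le> f' n'"
  by (simp add: le_fun_def)

lemma le_opD: "le_op w w' \<Longrightarrow> le_fun f f' \<Longrightarrow> le_fun (w f) (w' f')"
  by (simp add: le_op_def)

lemma le_opD2: "le_op w w' \<Longrightarrow> le_fun f f' \<Longrightarrow> n \<le> n' \<Longrightarrow> w f n \<le> w' f' n'"
  by (simp add: le_op_def le_fun_def)

lemma iter_weight_mono:
  assumes w: "le_op w w'" and f: "le_fun f f'"
  shows "k \<le> k' \<Longrightarrow> le_fun (iter_weight w f k) (iter_weight w' f' k')"
proof (induction k' arbitrary: k)
  case 0
  show ?case using 0
    by (auto intro!: le_funI add_mono le_opD2[OF w] le_funD[OF f])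
next
  case (Suc k')
  show ?case
  proof (cases k)
    case 0
    show ?thesis unfolding 0
      by (auto intro!: le_funI add_mono le_opD2[OF w] le_funD[OF f])
  next
    case k: (Suc j)
    with Suc have "le_fun (iter_weight w f j) (iter_weight w' f' k')" "j \<le> k'" by auto
    then have "le_fun (\<lambda>n'. 1 + iter_weight w f j (min n' j)) (\<lambda>n'. 1 + iter_weight w' f' k' (min n' k'))"
      by (auto intro!: le_funI elim!: le_funD)
    then show ?thesis unfolding k
      by (auto intro!: le_funI add_mono le_opD2[OF w] le_funD[OF f])
  qed
qed

lemma min_weight_mono:
  assumes w: "le_op w w'" and h: "le_fun h h'"
  shows "le_fun (min_weight w h m) (min_weight w' h' m)"
proof (induction m)
  case (Suc m)
  show ?case by (auto intro!: le_funI le_opD2[OF w] Suc)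
qed (simp add: h)

lemma rweight_mono: "B \<le> B' \<Longrightarrow> le_op (rweight B r d) (rweight B' r d)"
proof (induction r arbitrary: d)
  case (Disj r1 r2)
  then show ?case
    by (auto simp: le_op_def intro!: le_funI add_mono le_opD2[OF Disj.IH(1)] le_opD2[OF Disj.IH(2)])
next
  case (Sequence r1 r2)
  note IH = le_opD[OF Sequence.IH(1)[OF Sequence.prems]] le_opD[OF Sequence.IH(2)[OF Sequence.prems]]
  show ?case
    by (cases d) (auto simp: le_op_def intro!: le_funI intro: le_funD[OF IH(1)] le_funD[OF IH(2)] IH)
next
  case (Group g r)
  show ?case
    by (auto simp: le_op_def intro!: le_funI le_opD2[OF Group.IH[OF Group.prems]] dest: le_funD)
next
  case (Quant r m D greedy)
  note IH = Quant.IH[OF Quant.prems]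
  show ?case unfolding le_op_def
  proof (intro allI impI)
    fix f f' assume f: "le_fun f f'"
    have "le_fun (\<lambda>n. iter_weight (rweight B r d) f n n) (\<lambda>n. iter_weight (rweight B' r d) f' n n)"
      by (rule le_funI) (rule le_funD[OF iter_weight_mono[OF IH f]])
    from min_weight_mono[OF IH this]
    show "le_fun (rweight B (Quant r m D greedy) d f) (rweight B' (Quant r m D greedy) d f')"
      by simp
  qed
next
  case (Look k r)
  show ?case unfolding le_op_def
    by (auto intro!: le_funI add_mono le_opD2[OF Look.IH[OF Look.prems]] Look.prems dest: le_funD)
qed (auto simp: le_op_def le_fun_def)

lemma ahead_mono: "B \<le> B' \<Longrightarrow> ahead d B p \<le> ahead d B' p"
  by (cases d) auto

lemma aweight_mono: "B \<le> B' \<Longrightarrow> le_op (aweight B d a) (aweight B' d a)"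
proof (cases a)
  case (Areg r)
  assume "B \<le> B'"
  from rweight_mono[OF this, of r d] show ?thesis by (simp add: Areg le_op_def le_fun_def)
next
  case (Aclose g)
  then show ?thesis by (auto simp: le_op_def le_fun_def)
next
  case (Acheck k)
  assume "B \<le> B'"
  from ahead_mono[OF this, of d k] show ?thesis
    unfolding Acheck le_op_def
    by (auto intro!: le_funI elim!: le_funD simp: min_le_iff_disj diff_le_mono)
qed

lemma lweight_mono: "B \<le> B' \<Longrightarrow> le_fun (lweight B d l) (lweight B' d l)"
proof (induction l)
  case (Cons a l)
  then show ?case by (simp add: le_opD[OF aweight_mono])
qed (simp add: le_fun_def)

lemma lweight_mono': "B \<le> B' \<Longrightarrow> n \<le> n' \<Longrightarrow> lweight B d l n \<le> lweight B' d l n'"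
  using lweight_mono le_funD by blast

lemma iter_weight_step:
  assumes w: "le_op w w" and f: "le_fun f f"
  shows "f n + w (\<lambda>n'. if n = 0 then 1 else 1 + (\<lambda>n. iter_weight w f n n) (min n' (n - 1))) n
         < iter_weight w f n n"
proof (cases n)
  case (Suc k)
  have "w (\<lambda>n'. if n = 0 then 1 else 1 + (\<lambda>n. iter_weight w f n n) (min n' (n - 1))) n
        \<le> w (\<lambda>n'. 1 + iter_weight w f k (min n' k)) n"
    by (rule le_opD2[OF w])
      (auto simp: Suc intro!: le_funI le_funD[OF iter_weight_mono[OF w f]])
  then show ?thesis using Suc by simp
qed simp

definition call_weight :: "'c list \<Rightarrow> 'c action list \<Rightarrow> nat \<Rightarrow> dir \<Rightarrow> nat" where
  "call_weight s l p d = lweight (max (length s) p) d l (ahead d (max (length s) p) p)"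

lemma read_char_bound:
  "read_char s cd p d = Some p' \<Longrightarrow>
   max (length s) p' \<le> max (length s) p \<and>
   ahead d (max (length s) p') p' \<le> ahead d (max (length s) p) p"
  by (cases d) (auto split: if_splits)

lemma read_word_bound:
  assumes "read_word s w p d = Some p'"
  shows "max (length s) p' \<le> max (length s) p \<and>
    ahead d (max (length s) p') p' \<le> ahead d (max (length s) p) p"
proof (cases d)
  case Forward
  with assms have *: "take (length w) (drop p s) = w" "p' = p + length w"
    by (auto split: if_splits)
  have "length w \<le> length s - p" using arg_cong[OF *(1), of length] by auto
  then show ?thesis using Forward * by auto
qed (use assms in \<open>auto split: if_splits\<close>)

lemma read_backref_bound:
  "read_backref s \<sigma> p d = Some p' \<Longrightarrow>
   max (length s) p' \<le> max (length s) p \<and>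
   ahead d (max (length s) p') p' \<le> ahead d (max (length s) p) p"
  by (cases \<sigma>) (auto dest: read_word_bound)

lemma call_weight_check:
  "further d p k \<Longrightarrow> call_weight s l p d < call_weight s (Acheck k # l) p d"
  by (cases d) (auto simp: call_weight_def less_Suc_eq_le intro!: lweight_mono')

lemma call_weight_read:
  assumes "max (length s) p' \<le> max (length s) p"
    "ahead d (max (length s) p') p' \<le> ahead d (max (length s) p) p"
  shows "call_weight s l p' d \<le> call_weight s l p d"
  using assms by (auto simp: call_weight_def intro!: lweight_mono')

lemma call_weight_Suc:
  "call_weight s (Areg (Chars cd) # l) p d = Suc (call_weight s l p d)"
  "call_weight s (Areg (Backref g) # l) p d = Suc (call_weight s l p d)"
  "call_weight s (Areg Epsilon # l) p d = Suc (call_weight s l p d)"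
  "call_weight s (Areg (Anchor a) # l) p d = Suc (call_weight s l p d)"
  "call_weight s (Aclose g # l) p d = Suc (call_weight s l p d)"
  by (auto simp: call_weight_def)

lemma call_weight_quant:
  "call_weight s l p d + call_weight s (Areg r # Acheck p # Areg (Quant r 0 D' k) # l) p d
   < call_weight s (Areg (Quant r 0 D k) # l) p d"
proof -
  let ?B = "max (length s) p"
  let ?w = "rweight ?B r d" and ?f = "lweight ?B d l" and ?n = "ahead d ?B p"
  let ?g = "\<lambda>n. iter_weight ?w ?f n n"
  have eq: "aweight ?B d (Acheck p) ?g =
      (\<lambda>n'. if ?n = 0 then 1 else 1 + ?g (min n' (?n - 1)))"
    by (rule ext) simp
  have quant: "aweight ?B d (Areg (Quant r 0 D k)) ?f = ?g" for D k
    by (rule ext) simp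
  show ?thesis
    unfolding call_weight_def lweight.simps quant eq aweight.simps(1)
    by (rule iter_weight_step) (simp_all add: rweight_mono lweight_mono)
qed

lemma call_weight_look:
  "call_weight s l p d + call_weight s [Areg r] p (look_dir k)
   < call_weight s (Areg (Look k r) # l) p d"
proof -
  let ?B = "max (length s) p"
  have "rweight ?B r (look_dir k) (\<lambda>_. 0) (ahead (look_dir k) ?B p)
      \<le> rweight ?B r (look_dir k) (\<lambda>_. 0) ?B"
    by (rule le_opD2[OF rweight_mono[OF order_refl]])
      (cases "look_dir k"; auto simp: le_fun_def)+
  then show ?thesis by (simp add: call_weight_def)
qed


text \<open>The list of results: the leaves of the backtracking tree, highest priority first.\<close>

function results ::
    "'c set \<Rightarrow> 'c list \<Rightarrow> 'c action list \<Rightarrow> nat \<Rightarrow> group_map \<Rightarrow> dir \<Rightarrow> (nat \<times> group_map) list"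
where
  "results W s [] p \<gamma> d = [(p, \<gamma>)]"
| "results W s (Acheck k # l) p \<gamma> d = (if further d p k then results W s l p \<gamma> d else [])"
| "results W s (Aclose g # l) p \<gamma> d = results W s l p (close_group g p \<gamma>) d"
| "results W s (Areg Epsilon # l) p \<gamma> d = results W s l p \<gamma> d"
| "results W s (Areg (Chars cd) # l) p \<gamma> d =
     (case read_char s cd p d of None \<Rightarrow> [] | Some p' \<Rightarrow> results W s l p' \<gamma> d)"
| "results W s (Areg (Disj r1 r2) # l) p \<gamma> d =
     results W s (Areg r1 # l) p \<gamma> d @ results W s (Areg r2 # l) p \<gamma> d"
| "results W s (Areg (Sequence r1 r2) # l) p \<gamma> d =
     (case d of
        Forward \<Rightarrow> results W s (Areg r1 # Areg r2 # l) p \<gamma> d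
      | Backward \<Rightarrow> results W s (Areg r2 # Areg r1 # l) p \<gamma> d)"
| "results W s (Areg (Quant r (Suc m) D greedy) # l) p \<gamma> d =
     results W s (Areg r # Areg (Quant r m D greedy) # l) p (reset_groups r \<gamma>) d"
| "results W s (Areg (Quant r 0 D greedy) # l) p \<gamma> d =
     (if D = 0 then results W s l p \<gamma> d
      else
        let I = results W s (Areg r # Acheck p # Areg (Quant r 0 (D - 1) greedy) # l) p
                  (reset_groups r \<gamma>) d;
            S = results W s l p \<gamma> d
        in if greedy then I @ S else S @ I)"
| "results W s (Areg (Group g r) # l) p \<gamma> d =
     results W s (Areg r # Aclose g # l) p (\<gamma>(g := Opened p)) d"
| "results W s (Areg (Look k r) # l) p \<gamma> d =
     (let M = results W s [Areg r] p \<gamma> (look_dir k)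
      in if positive k
         then (case M of [] \<Rightarrow> [] | (p', \<gamma>') # _ \<Rightarrow> results W s l p \<gamma>' d)
         else (if M = [] then results W s l p \<gamma> d else []))"
| "results W s (Areg (Anchor a) # l) p \<gamma> d =
     (if anchor_holds W s a p then results W s l p \<gamma> d else [])"
| "results W s (Areg (Backref g) # l) p \<gamma> d =
     (case read_backref s (\<gamma> g) p d of None \<Rightarrow> [] | Some p' \<Rightarrow> results W s l p' \<gamma> d)"
  by pat_completeness auto

termination
proof (relation "measure (\<lambda>(W, s, l, p, \<gamma>, d). call_weight s l p d)", goal_cases)
  case (2 W s k l p \<gamma> d)
  then show ?case by (simp add: call_weight_check)
next
  case (5 W s cd l p \<gamma> d p')
  then show ?case
    using call_weight_read read_char_bound by (fastforce simp: call_weight_Suc less_Suc_eq_le)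
next
  case (11 W s r D greedy l p \<gamma> d)
  then show ?case
    using call_weight_quant[of s l p d r "D - 1" greedy D] by simp
next
  case (12 W s r D greedy l p \<gamma> d)
  then show ?case
    using call_weight_quant[of s l p d r "D - 1" greedy D] by simp
next
  case (13 W s r D greedy l p \<gamma> d)
  then show ?case
    using call_weight_quant[of s l p d r "D - 1" greedy D] by simp
next
  case (15 W s k r l p \<gamma> d)
  then show ?case
    using call_weight_look[of s l p d r k] by simp
next
  case (16 W s k r l p \<gamma> d)
  then show ?case
    using call_weight_look[of s l p d r k] by simp
next
  case (17 W s k r l p \<gamma> d)
  then show ?case
    using call_weight_look[of s l p d r k] by simp
next
  case (19 W s g l p \<gamma> d p')
  then show ?case
    using call_weight_read read_backref_bound by (fastforce simp: call_weight_Suc less_Suc_eq_le)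
qed (simp_all add: call_weight_Suc, simp_all add: call_weight_def aweight_eta)

definition has_match :: "'c set \<Rightarrow> 'c regex \<Rightarrow> 'c list \<Rightarrow> bool" where
  "has_match W r s \<longleftrightarrow>
     (\<exists>k\<le>length s. results W s [Areg r] k (\<lambda>_. Undefined) Forward \<noteq> [])"

section \<open>Encoding of instances\<close>

text \<open>Syntax trees are written in prefix order over a finite alphabet of tokens, numbers in binary,
  least significant bit first. Since regex codes are prefix-free, the string can simply be
  appended.\<close>

datatype 'c token =
    T_Epsilon | T_Chars "'c set" | T_Disj | T_Sequence | T_Group | T_Backref
  | T_Quant bool | T_Look lookaround | T_Anchor anchor
  | T_Bit bool | T_End | T_Infinity | T_Letter 'c

lemma UNIV_anchor: "UNIV = {Input_Start, Input_End, Word_Boundary, Non_Word_Boundary}"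
  using anchor.exhaust by blast

lemma UNIV_lookaround: "UNIV = {Lookahead, Neg_Lookahead, Lookbehind, Neg_Lookbehind}"
  using lookaround.exhaust by blast

lemma UNIV_token:
  "UNIV = {T_Epsilon, T_Disj, T_Sequence, T_Group, T_Backref, T_End, T_Infinity} \<union>
    range T_Chars \<union> range T_Quant \<union> range T_Look \<union> range T_Anchor \<union> range T_Bit \<union>
    range T_Letter" (is "UNIV = ?A")
proof -
  have "t \<in> ?A" for t by (cases t) simp_all
  then show ?thesis by blast
qed

instance token :: (finite) finite
proof
  have "finite (UNIV :: anchor set)" "finite (UNIV :: lookaround set)"
    by (simp_all add: UNIV_anchor UNIV_lookaround)
  then show "finite (UNIV :: 'a token set)"
    by (simp add: UNIV_token)
qed

fun enc_nat :: "nat \<Rightarrow> 'c token list" where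
  "enc_nat n = (if n = 0 then [T_End] else T_Bit (odd n) # enc_nat (n div 2))"

declare enc_nat.simps [simp del]

fun enc_enat :: "enat \<Rightarrow> 'c token list" where
  "enc_enat (enat n) = enc_nat n"
| "enc_enat \<infinity> = [T_Infinity]"

primrec enc_regex :: "'c regex \<Rightarrow> 'c token list" where
  "enc_regex Epsilon = [T_Epsilon]"
| "enc_regex (Chars cd) = [T_Chars cd]"
| "enc_regex (Disj r1 r2) = T_Disj # enc_regex r1 @ enc_regex r2"
| "enc_regex (Sequence r1 r2) = T_Sequence # enc_regex r1 @ enc_regex r2"
| "enc_regex (Group g r) = T_Group # enc_nat g @ enc_regex r"
| "enc_regex (Backref g) = T_Backref # enc_nat g"
| "enc_regex (Quant r m D greedy) = T_Quant greedy # enc_nat m @ enc_enat D @ enc_regex r"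
| "enc_regex (Look k r) = T_Look k # enc_regex r"
| "enc_regex (Anchor a) = [T_Anchor a]"

definition enc_instance :: "'c regex \<Rightarrow> 'c list \<Rightarrow> 'c token list" where
  "enc_instance r s = enc_regex r @ map T_Letter s"

lemma enc_nat_0: "enc_nat 0 = [T_End]"
  by (simp add: enc_nat.simps)

lemma enc_nat_pos: "n \<noteq> 0 \<Longrightarrow> enc_nat n = T_Bit (odd n) # enc_nat (n div 2)"
  by (subst enc_nat.simps) simp

lemma enc_nat_neq_Infinity: "enc_nat n @ u \<noteq> T_Infinity # v"
  by (cases "n = 0") (simp_all add: enc_nat_0 enc_nat_pos)

lemma enc_nat_prefix_free: "enc_nat m @ u = enc_nat n @ v \<Longrightarrow> m = n \<and> u = v"
proof (induction m arbitrary: n rule: less_induct)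
  case (less m)
  consider "m = 0" "n = 0" | "m = 0" "n \<noteq> 0" | "m \<noteq> 0" "n = 0" | "m \<noteq> 0" "n \<noteq> 0" by blast
  then show ?case
  proof cases
    case 4
    with less.prems have *: "odd m = odd n" "enc_nat (m div 2) @ u = enc_nat (n div 2) @ v"
      by (simp_all add: enc_nat_pos)
    from 4 have "m div 2 < m" by simp
    from less.IH[OF this *(2)] have eq: "m div 2 = n div 2" "u = v" by simp_all
    from *(1) have "m mod 2 = n mod 2" by (simp add: mod2_eq_if)
    with eq(1) have "m = n" by (metis div_mult_mod_eq)
    with eq show ?thesis by simp
  qed (use less.prems in \<open>simp_all add: enc_nat_0 enc_nat_pos\<close>)
qed

lemma enc_enat_prefix_free: "enc_enat m @ u = enc_enat n @ v \<Longrightarrow> m = n \<and> u = v"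
  by (cases m; cases n)
    (auto dest: enc_nat_prefix_free simp: enc_nat_neq_Infinity enc_nat_neq_Infinity[symmetric])

lemma enc_regex_prefix_free: "enc_regex r @ u = enc_regex r' @ v \<Longrightarrow> r = r' \<and> u = v"
proof (induction r arbitrary: r' u v)
  case (Disj r1 r2)
  from Disj.prems obtain q1 q2 where r': "r' = Disj q1 q2" by (cases r') simp_all
  with Disj.prems have "enc_regex r1 @ enc_regex r2 @ u = enc_regex q1 @ enc_regex q2 @ v" by simp
  from Disj.IH(1)[OF this] have "r1 = q1" "enc_regex r2 @ u = enc_regex q2 @ v" by simp_all
  with Disj.IH(2)[OF this(2)] show ?case by (simp add: r')
next
  case (Sequence r1 r2)
  from Sequence.prems obtain q1 q2 where r': "r' = Sequence q1 q2" by (cases r') simp_all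
  with Sequence.prems have "enc_regex r1 @ enc_regex r2 @ u = enc_regex q1 @ enc_regex q2 @ v"
    by simp
  from Sequence.IH(1)[OF this] have "r1 = q1" "enc_regex r2 @ u = enc_regex q2 @ v" by simp_all
  with Sequence.IH(2)[OF this(2)] show ?case by (simp add: r')
next
  case (Group g r)
  from Group.prems obtain h q where r': "r' = Group h q" by (cases r') simp_all
  with Group.prems have "enc_nat g @ enc_regex r @ u = enc_nat h @ enc_regex q @ v" by simp
  from enc_nat_prefix_free[OF this] have "g = h" "enc_regex r @ u = enc_regex q @ v" by simp_all
  with Group.IH[OF this(2)] show ?case by (simp add: r')
next
  case (Backref g)
  from Backref.prems obtain h where r': "r' = Backref h" by (cases r') simp_all
  with Backref.prems have "enc_nat g @ u = enc_nat h @ v" by simp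
  from enc_nat_prefix_free[OF this] show ?case by (simp add: r')
next
  case (Quant r m D greedy)
  from Quant.prems obtain q n E greedy' where r': "r' = Quant q n E greedy'"
    by (cases r') simp_all
  with Quant.prems have g: "greedy = greedy'"
    and "enc_nat m @ enc_enat D @ enc_regex r @ u = enc_nat n @ enc_enat E @ enc_regex q @ v"
    by simp_all
  from enc_nat_prefix_free[OF this(2)]
  have m: "m = n" and "enc_enat D @ enc_regex r @ u = enc_enat E @ enc_regex q @ v" by simp_all
  from enc_enat_prefix_free[OF this(2)]
  have "D = E" "enc_regex r @ u = enc_regex q @ v" by simp_all
  with Quant.IH[OF this(2)] g m show ?case by (simp add: r')
next
  case (Look k r)
  from Look.prems obtain k' q where r': "r' = Look k' q" by (cases r') simp_all
  with Look.prems have "k = k'" "enc_regex r @ u = enc_regex q @ v" by simp_all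
  with Look.IH[OF this(2)] show ?case by (simp add: r')
next
  case Epsilon
  then show ?case by (cases r') simp_all
next
  case (Chars cd)
  then show ?case by (cases r') simp_all
next
  case (Anchor a)
  then show ?case by (cases r') simp_all
qed

lemma enc_instance_inject: "enc_instance r s = enc_instance r' s' \<longleftrightarrow> r = r' \<and> s = s'"
  using enc_regex_prefix_free[of r "map T_Letter s" r' "map T_Letter s'"]
  by (auto simp: enc_instance_def inj_map_eq_map[of T_Letter] inj_def)

definition JSREGTEST :: "'c set \<Rightarrow> 'c regex set \<Rightarrow> 'c token list set" where
  "JSREGTEST W R = {enc_instance r s | r s. r \<in> R \<and> has_match W r s}"

section \<open>Turing machines and PSPACE\<close>

text \<open>Deterministic multi-tape machines. Each tape is infinite to the right and initially carries the
  marker \<open>Start\<close> in cell 0; the input is in the cells following the marker of tape 0. A head cannot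
  move left of cell 0. The tape alphabet and the state set are arbitrary finite sets.\<close>

datatype 'a symbol = Blank | Start | Input 'a | Work nat

datatype move = Move_Left | Stay | Move_Right

record 'a tm =
  tape_count :: nat
  states :: "nat set"
  alphabet :: "'a symbol set"
  initial :: nat
  accepting :: nat
  rejecting :: nat
  transition :: "nat \<Rightarrow> 'a symbol list \<Rightarrow> nat \<times> ('a symbol \<times> move) list"

definition halting :: "'a tm \<Rightarrow> nat \<Rightarrow> bool" where
  "halting M q \<longleftrightarrow> q = accepting M \<or> q = rejecting M"

definition wf_tm :: "'a tm \<Rightarrow> bool" where
  "wf_tm M \<longleftrightarrow>
     tape_count M \<ge> 1 \<and>
     finite (states M) \<and>
     {initial M, accepting M, rejecting M} \<subseteq> states M \<and>
     accepting M \<noteq> rejecting M \<and>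
     finite (alphabet M) \<and>
     {Blank, Start} \<union> range Input \<subseteq> alphabet M \<and>
     (\<forall>q\<in>states M. \<forall>as. \<not> halting M q \<and> length as = tape_count M \<and> set as \<subseteq> alphabet M \<longrightarrow>
        fst (transition M q as) \<in> states M \<and>
        length (snd (transition M q as)) = tape_count M \<and>
        fst ` set (snd (transition M q as)) \<subseteq> alphabet M)"

type_synonym 'a tape = "(nat \<Rightarrow> 'a symbol) \<times> nat"

type_synonym 'a config = "nat \<times> 'a tape list"

fun move_head :: "move \<Rightarrow> nat \<Rightarrow> nat" where
  "move_head Move_Left h = h - 1"
| "move_head Stay h = h"
| "move_head Move_Right h = h + 1"

fun act :: "'a symbol \<times> move \<Rightarrow> 'a tape \<Rightarrow> 'a tape" where
  "act (a, m) (c, h) = (c(h := a), move_head m h)"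

definition scanned :: "'a tape \<Rightarrow> 'a symbol" where
  "scanned t = fst t (snd t)"

fun step :: "'a tm \<Rightarrow> 'a config \<Rightarrow> 'a config" where
  "step M (q, ts) =
     (if halting M q then (q, ts)
      else let (q', as) = transition M q (map scanned ts) in (q', map2 act as ts))"

definition start_contents :: "'a list \<Rightarrow> nat \<Rightarrow> 'a symbol" where
  "start_contents x i =
     (if i = 0 then Start else if i \<le> length x then Input (x ! (i - 1)) else Blank)"

definition start_config :: "'a tm \<Rightarrow> 'a list \<Rightarrow> 'a config" where
  "start_config M x =
     (initial M, (start_contents x, 0) # replicate (tape_count M - 1) (start_contents [], 0))"

definition run :: "'a tm \<Rightarrow> 'a list \<Rightarrow> nat \<Rightarrow> 'a config" where
  "run M x t = (step M ^^ t) (start_config M x)"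

text \<open>Tape 0 may be written, so its cells count as space as well.\<close>

definition decides_in_space :: "'a tm \<Rightarrow> 'a list set \<Rightarrow> (nat \<Rightarrow> nat) \<Rightarrow> bool" where
  "decides_in_space M X f \<longleftrightarrow>
     (\<forall>x. (\<exists>t. fst (run M x t) = (if x \<in> X then accepting M else rejecting M)) \<and>
          (\<forall>t. \<forall>(c, h)\<in>set (snd (run M x t)). h < f (length x)))"

definition PSPACE :: "'a::finite list set set" where
  "PSPACE = {X. \<exists>(M :: 'a tm) (p :: nat poly). wf_tm M \<and> decides_in_space M X (poly p)}"

end

theory Submission
  imports Defs
begin

text \<open>The backtracking search is run depth first with an explicit stack. Without lower-bounded
  quantifiers, the pending actions always come from the path between the current node of the syntax
  tree and its root, so the list of actions stays polynomially small. A branch of the backtracking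
  tree is polynomially long as well: an iteration of a star that does not progress is cut off by its
  check, so between two moves of the position every pending action is executed at most once. Nested
  lookarounds only multiply the stack by their depth, because nothing but the group map survives a
  finished lookaround, and this map is stored with one entry per group.

  To reach Turing machines, values are binary trees written in prefix code on a stack tape. The functions
  on values that are computable in polynomial space are closed under composition, pairing, branching
  on root symbols and loops whose intermediate values stay polynomially small, and no running time
  has to be bounded.\<close>

section \<open>Structured Turing machine programs\<close>

text \<open>The delicate case is a star whose body can match the empty word, perhaps nested in other
  stars and with a binary counter of exponential value. The counters give no useful bound on the
  length of a branch. What does is the check \<open>Acheck p\<close> that every iteration leaves
  behind its body: while the position is still \<open>p\<close>, nothing behind the check can be
  reached. A measure that stops counting at such a check drops at every step, although unfolding
  makes the list of actions longer. Progress may restore it, but by no more than the size of the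
  list, and within one direction this happens at most once per position of the string. A mandatory
  iteration leaves no check behind, so unfolding a lower bound would repeat the body as often as its
  binary number says.

  On the machine side, halting and space are obtained together. The semantics of programs is a
  big-step relation whose derivations carry the bound on the heads, and such a derivation exists
  only for a terminating run. Loops on values follow the same pattern: the proof exhibits a finite
  run through small values, and its length is irrelevant.\<close>

datatype 'a prog =
    PAct "'a symbol list \<Rightarrow> ('a symbol \<times> move) list"
  | PSeq "'a prog" "'a prog"
  | PCond "'a symbol list \<Rightarrow> bool" "'a prog" "'a prog"
  | PLoop "'a symbol list \<Rightarrow> bool" "'a prog"

primrec wf_prog :: "nat \<Rightarrow> 'a symbol set \<Rightarrow> 'a prog \<Rightarrow> bool" where
  "wf_prog k \<Gamma> (PAct f) \<longleftrightarrow>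
     (\<forall>as. length as = k \<and> set as \<subseteq> \<Gamma> \<longrightarrow> length (f as) = k \<and> fst ` set (f as) \<subseteq> \<Gamma>)"
| "wf_prog k \<Gamma> (PSeq c1 c2) \<longleftrightarrow> wf_prog k \<Gamma> c1 \<and> wf_prog k \<Gamma> c2"
| "wf_prog k \<Gamma> (PCond P c1 c2) \<longleftrightarrow> wf_prog k \<Gamma> c1 \<and> wf_prog k \<Gamma> c2"
| "wf_prog k \<Gamma> (PLoop P c) \<longleftrightarrow> wf_prog k \<Gamma> c"

definition heads_below :: "nat \<Rightarrow> 'a tape list \<Rightarrow> bool" where
  "heads_below B ts \<longleftrightarrow> (\<forall>(c, h)\<in>set ts. h < B)"

text \<open>Derivations are finite, so \<open>exec B c ts ts'\<close> asserts termination together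
  with the space bound. The heads are inspected only at actions and loop exits, because tests leave
  the tapes unchanged.\<close>

inductive exec :: "nat \<Rightarrow> 'a prog \<Rightarrow> 'a tape list \<Rightarrow> 'a tape list \<Rightarrow> bool" for B where
  exec_act: "heads_below B ts \<Longrightarrow> ts' = map2 act (f (map scanned ts)) ts \<Longrightarrow> heads_below B ts' \<Longrightarrow>
     exec B (PAct f) ts ts'"
| exec_seq: "exec B c1 ts ts1 \<Longrightarrow> exec B c2 ts1 ts2 \<Longrightarrow> exec B (PSeq c1 c2) ts ts2"
| exec_cond: "exec B (if P (map scanned ts) then c1 else c2) ts ts' \<Longrightarrow>
     exec B (PCond P c1 c2) ts ts'"
| exec_loop: "P (map scanned ts) \<Longrightarrow> exec B c ts ts1 \<Longrightarrow> exec B (PLoop P c) ts1 ts2 \<Longrightarrow>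
     exec B (PLoop P c) ts ts2"
| exec_done: "\<not> P (map scanned ts) \<Longrightarrow> heads_below B ts \<Longrightarrow> exec B (PLoop P c) ts ts"

lemma exec_heads_below: "exec B c ts ts' \<Longrightarrow> heads_below B ts \<and> heads_below B ts'"
  by (induction rule: exec.induct) auto

section \<open>Compilation of programs to Turing machines\<close>

primrec conts :: "'a prog \<Rightarrow> 'a prog list \<Rightarrow> 'a prog list set" where
  "conts (PAct f) k = {PAct f # k, k}"
| "conts (PSeq c1 c2) k = {PSeq c1 c2 # k} \<union> conts c1 (c2 # k) \<union> conts c2 k"
| "conts (PCond P c1 c2) k = {PCond P c1 c2 # k} \<union> conts c1 k \<union> conts c2 k"
| "conts (PLoop P c) k = {PLoop P c # k, k} \<union> conts c (PLoop P c # k)"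

text \<open>The control states of the machine are the lists of programs still to be run. Programs
  have no recursion, so such a list reflects a place inside \<open>c\<close>, and only finitely many
  arise.\<close>

lemma finite_conts: "finite (conts c k)"
  by (induction c arbitrary: k) auto

lemma conts_start [simp]: "c # k \<in> conts c k" and conts_end [simp]: "k \<in> conts c k"
  by (induction c arbitrary: k) auto

fun cont_step :: "'a prog list \<Rightarrow> 'a symbol list \<Rightarrow> 'a prog list \<times> ('a symbol \<times> move) list" where
  "cont_step [] as = ([], map (\<lambda>a. (a, Stay)) as)"
| "cont_step (PAct f # k) as = (k, f as)"
| "cont_step (PSeq c1 c2 # k) as = (c1 # c2 # k, map (\<lambda>a. (a, Stay)) as)"
| "cont_step (PCond P c1 c2 # k) as = ((if P as then c1 else c2) # k, map (\<lambda>a. (a, Stay)) as)"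
| "cont_step (PLoop P c # k) as =
     ((if P as then c # PLoop P c # k else k), map (\<lambda>a. (a, Stay)) as)"

text \<open>The list \<open>k\<close> is excluded because its next step belongs to the context and
  not to \<open>c\<close>. The end of a loop body leads back to \<open>PLoop P c # k\<close>, which
  is itself in the set.\<close>

lemma conts_closed:
  "x \<in> conts c k \<Longrightarrow> x \<noteq> k \<Longrightarrow> fst (cont_step x as) \<in> conts c k"
proof (induction c arbitrary: k)
  case (PSeq c1 c2)
  then show ?case
    using conts_start[of c2 k] by (cases "x = c2 # k") auto
next
  case (PLoop P c)
  then show ?case
    by (cases "x = PLoop P c # k") auto
qed auto

lemma conts_wf:
  "wf_prog n \<Gamma> c \<Longrightarrow> (\<And>c'. c' \<in> set k \<Longrightarrow> wf_prog n \<Gamma> c') \<Longrightarrow> x \<in> conts c k \<Longrightarrow> c' \<in> set x \<Longrightarrow>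
   wf_prog n \<Gamma> c'"
proof (induction c arbitrary: k)
  case (PSeq c1 c2)
  from PSeq.prems(3) consider "x = PSeq c1 c2 # k" | "x \<in> conts c1 (c2 # k)" | "x \<in> conts c2 k"
    by auto
  then show ?case
  proof cases
    case 2
    then show ?thesis using PSeq.IH(1)[of "c2 # k"] PSeq.prems by auto
  next
    case 3
    then show ?thesis using PSeq.IH(2)[of k] PSeq.prems by auto
  qed (use PSeq.prems in auto)
next
  case (PCond P c1 c2)
  then show ?case by auto
next
  case (PLoop P c)
  have k: "wf_prog n \<Gamma> c''" if "c'' \<in> set (PLoop P c # k)" for c''
    using that PLoop.prems(1,2) by auto
  from PLoop.prems(3) consider "x = PLoop P c # k" | "x = k" | "x \<in> conts c (PLoop P c # k)"
    by auto
  then show ?case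
  proof cases
    case 3
    from PLoop.prems(1) have "wf_prog n \<Gamma> c" by simp
    with 3 show ?thesis using PLoop.IH[of "PLoop P c # k"] k PLoop.prems(4) by blast
  qed (use PLoop.prems in auto)
qed auto

lemma cont_step_wf:
  assumes "\<And>c'. c' \<in> set x \<Longrightarrow> wf_prog n \<Gamma> c'" "length as = n" "set as \<subseteq> \<Gamma>"
  shows "length (snd (cont_step x as)) = n \<and> fst ` set (snd (cont_step x as)) \<subseteq> \<Gamma>"
proof (cases "\<exists>f k. x = PAct f # k")
  case True
  then obtain f k where x: "x = PAct f # k" by blast
  from assms(1)[of "PAct f"] show ?thesis using assms(2,3) unfolding x by simp
next
  case False
  then have "snd (cont_step x as) = map (\<lambda>a. (a, Stay)) as"
    by (cases x; cases "hd x") auto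
  then show ?thesis using assms(2,3) by (simp add: image_image)
qed

lemma act_stay: "map2 act (map ((\<lambda>a. (a, Stay)) \<circ> scanned) ts) ts = ts"
proof (induction ts)
  case (Cons t ts)
  then show ?case by (cases t) (simp add: scanned_def)
qed simp

text \<open>Codes will be at least 2, which keeps 0 and 1 free for the halting states. The empty
  list, where the program has ended, is a proper state: there the scanned symbols are tested by
  \<open>A\<close> to choose between them.\<close>

definition compile :: "nat \<Rightarrow> 'a symbol set \<Rightarrow> ('a symbol list \<Rightarrow> bool) \<Rightarrow> 'a prog \<Rightarrow>
    ('a prog list \<Rightarrow> nat) \<Rightarrow> 'a tm" where
  "compile n \<Gamma> A c code =
     \<lparr>tape_count = n, states = insert 0 (insert 1 (code ` conts c [])), alphabet = \<Gamma>,
      initial = code [c], accepting = 0, rejecting = 1,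
      transition = (\<lambda>q as.
        if q = code [] then (if A as then 0 else 1, map (\<lambda>a. (a, Stay)) as)
        else (case cont_step (inv_into (conts c []) code q) as of (x, bs) \<Rightarrow> (code x, bs)))\<rparr>"

locale compiled =
  fixes n :: nat and \<Gamma> :: "'a symbol set" and A :: "'a symbol list \<Rightarrow> bool" and c code
  assumes code: "inj_on code (conts c [])" "\<And>x. code x \<ge> (2::nat)"
    and wf: "wf_prog n \<Gamma> c"
    and n: "n \<ge> 1"
    and \<Gamma>: "finite \<Gamma>" "{Blank, Start} \<union> range Input \<subseteq> \<Gamma>"
begin

abbreviation "M \<equiv> compile n \<Gamma> A c code"

lemma not_halting: "\<not> halting M (code x)"
  using code(2)[of x] by (auto simp: halting_def compile_def)

lemma transition_code:
  assumes "x \<in> conts c []" "x \<noteq> []"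
  shows "transition M (code x) as = (code (fst (cont_step x as)), snd (cont_step x as))"
proof -
  have "code x \<noteq> code []" using assms code(1) conts_end[of "[]" c] by (auto dest: inj_onD)
  then show ?thesis
    using assms code(1) by (simp add: compile_def split: prod.split)
qed

lemma wf_compile: "wf_tm M"
  unfolding wf_tm_def
proof (intro conjI ballI allI impI)
  show "tape_count M \<ge> 1" "accepting M \<noteq> rejecting M" "finite (alphabet M)"
    "{Blank, Start} \<union> range Input \<subseteq> alphabet M" "finite (states M)"
    "{initial M, accepting M, rejecting M} \<subseteq> states M"
    using n \<Gamma> by (simp_all add: compile_def finite_conts conts_start)
next
  fix q as
  assume q: "q \<in> states M" and as: "\<not> halting M q \<and> length as = tape_count M \<and> set as \<subseteq> alphabet M"
  then obtain x where x: "q = code x" "x \<in> conts c []"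
    by (auto simp: compile_def halting_def)
  have as': "length as = n" "set as \<subseteq> \<Gamma>" using as by (simp_all add: compile_def)
  have "fst (transition M q as) \<in> states M \<and> length (snd (transition M q as)) = n \<and>
     fst ` set (snd (transition M q as)) \<subseteq> \<Gamma>"
  proof (cases "x = []")
    case True
    with x as' show ?thesis by (auto simp: compile_def)
  next
    case False
    have "wf_prog n \<Gamma> c'" if "c' \<in> set x" for c'
      using conts_wf[OF wf _ x(2) that] by simp
    from cont_step_wf[OF this as'] conts_closed[OF x(2) False]
    show ?thesis unfolding x(1) transition_code[OF x(2) False] by (simp add: compile_def)
  qed
  then show "fst (transition M q as) \<in> states M" "length (snd (transition M q as)) = tape_count M"
    "fst ` set (snd (transition M q as)) \<subseteq> alphabet M" by (simp_all add: compile_def)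
qed

lemma step_code:
  assumes "x \<in> conts c []" "x \<noteq> []"
  shows "step M (code x, ts) =
    (code (fst (cont_step x (map scanned ts))), map2 act (snd (cont_step x (map scanned ts))) ts)"
  using not_halting[of x] by (simp add: transition_code[OF assms])

definition reaches :: "nat \<Rightarrow> 'a config \<Rightarrow> 'a config \<Rightarrow> bool" where
  "reaches B C C' \<longleftrightarrow>
     (\<exists>t. (step M ^^ t) C = C' \<and> (\<forall>i\<le>t. heads_below B (snd ((step M ^^ i) C))))"

lemma reaches_trans:
  assumes "reaches B C1 C2" "reaches B C2 C3"
  shows "reaches B C1 C3"
proof -
  from assms obtain t u where
    t: "(step M ^^ t) C1 = C2" "\<And>i. i \<le> t \<Longrightarrow> heads_below B (snd ((step M ^^ i) C1))" and
    u: "(step M ^^ u) C2 = C3" "\<And>i. i \<le> u \<Longrightarrow> heads_below B (snd ((step M ^^ i) C2))"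
    unfolding reaches_def by blast
  have shift: "(step M ^^ (j + t)) C1 = (step M ^^ j) C2" for j
    using t(1) by (simp add: funpow_add)
  have "heads_below B (snd ((step M ^^ i) C1))" if "i \<le> u + t" for i
  proof (cases "i \<le> t")
    case False
    then have "i = (i - t) + t" by simp
    with shift[of "i - t"] u(2)[of "i - t"] that False show ?thesis by simp
  qed (rule t(2))
  then show ?thesis unfolding reaches_def
    using shift[of u] u(1) by (intro exI[of _ "u + t"]) simp
qed

lemma reaches_step:
  assumes "x \<in> conts c []" "x \<noteq> []" "heads_below B ts"
    "ts' = map2 act (snd (cont_step x (map scanned ts))) ts" "heads_below B ts'"
  shows "reaches B (code x, ts) (code (fst (cont_step x (map scanned ts))), ts')"
  unfolding reaches_def
proof (intro exI[of _ 1] conjI allI impI)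
  fix i :: nat assume "i \<le> 1"
  then have "i = 0 \<or> i = 1" by auto
  then show "heads_below B (snd ((step M ^^ i) (code x, ts)))"
    using step_code[OF assms(1,2), of ts] assms(3-5) by (auto simp del: step.simps)
qed (use step_code[OF assms(1,2), of ts] assms(3-5) in \<open>simp del: step.simps\<close>)

text \<open>The context \<open>k\<close> is general because a subprogram runs in front of what
  follows it. The inclusion of \<open>conts c' k\<close> keeps all control states in the finite set
  on which \<open>code\<close> is injective.\<close>

lemma exec_reaches:
  "exec B c' ts ts' \<Longrightarrow> c' # k \<in> conts c [] \<Longrightarrow> conts c' k \<subseteq> conts c [] \<Longrightarrow>
   reaches B (code (c' # k), ts) (code k, ts')"
proof (induction arbitrary: k rule: exec.induct)
  case (exec_act ts ts' f)
  from reaches_step[OF exec_act.prems(1) _ exec_act.hyps(1), of ts'] exec_act.hyps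
  show ?case by simp
next
  case (exec_seq c1 ts ts1 c2 ts2)
  have sub: "conts c1 (c2 # k) \<subseteq> conts c []" "conts c2 k \<subseteq> conts c []"
    using exec_seq.prems(2) by simp_all
  have ok: "heads_below B ts" using exec_heads_below[OF exec_seq.hyps(1)] by simp
  from reaches_step[OF exec_seq.prems(1) _ ok, of ts] ok
  have "reaches B (code (PSeq c1 c2 # k), ts) (code (c1 # c2 # k), ts)"
    by (simp add: act_stay)
  note reaches_trans[OF this reaches_trans[OF exec_seq.IH(1)[of "c2 # k"] exec_seq.IH(2)[of k]]]
  then show ?case using sub conts_start[of c1 "c2 # k"] conts_start[of c2 k] by blast
next
  case (exec_cond P ts c1 c2 ts')
  let ?c = "if P (map scanned ts) then c1 else c2"
  have ok: "heads_below B ts" using exec_heads_below[OF exec_cond.hyps(1)] by simp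
  have sub: "conts ?c k \<subseteq> conts c []" using exec_cond.prems(2) by auto
  from reaches_step[OF exec_cond.prems(1) _ ok, of ts] ok
  have "reaches B (code (PCond P c1 c2 # k), ts) (code (?c # k), ts)"
    by (simp add: act_stay)
  from reaches_trans[OF this exec_cond.IH[of k]] sub conts_start[of ?c k] show ?case by blast
next
  case (exec_loop P ts c1 ts1 ts2)
  have sub: "conts c1 (PLoop P c1 # k) \<subseteq> conts c []" using exec_loop.prems(2) by simp
  have ok: "heads_below B ts" using exec_heads_below[OF exec_loop.hyps(2)] by simp
  from reaches_step[OF exec_loop.prems(1) _ ok, of ts] ok exec_loop.hyps(1)
  have "reaches B (code (PLoop P c1 # k), ts) (code (c1 # PLoop P c1 # k), ts)"
    by (simp add: act_stay)
  from reaches_trans[OF this reaches_trans[OF exec_loop.IH(1)[of "PLoop P c1 # k"] exec_loop.IH(2)[of k]]]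
  show ?case using sub exec_loop.prems conts_start[of c1 "PLoop P c1 # k"] by blast
next
  case (exec_done P ts c1)
  from reaches_step[OF exec_done.prems(1) _ exec_done.hyps(2), of ts] exec_done.hyps
  show ?case by (simp add: act_stay)
qed

lemma run_compile:
  assumes ex: "exec B c ((start_contents x, 0) # replicate (n - 1) (start_contents [], 0)) ts"
  shows "(\<exists>t. fst (run M x t) = (if A (map scanned ts) then accepting M else rejecting M)) \<and>
         (\<forall>t. \<forall>(c, h)\<in>set (snd (run M x t)). h < B)"
proof -
  let ?q = "if A (map scanned ts) then 0 else 1 :: nat"
  have start: "start_config M x = (code [c], (start_contents x, 0) # replicate (n - 1) (start_contents [], 0))"
    by (simp add: start_config_def compile_def)
  from exec_reaches[OF ex] conts_start[of c "[]"]
  obtain T where T: "run M x T = (code [], ts)"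
    and below: "\<And>i. i \<le> T \<Longrightarrow> heads_below B (snd (run M x i))"
    unfolding run_def start reaches_def by blast
  \<comment> \<open>The program has ended but the machine has not: one more step evaluates
    \<open>A\<close> and enters a halting state.\<close>
  have "step M (code [], ts) = (?q, ts)"
    using not_halting[of "[]"] by (simp add: compile_def act_stay)
  then have fin: "run M x (Suc T) = (?q, ts)" using T by (simp add: run_def)
  have stay: "run M x (j + Suc T) = (?q, ts)" for j
  proof (induction j)
    case (Suc j)
    have "run M x (Suc j + Suc T) = step M (run M x (j + Suc T))" by (simp add: run_def)
    also have "\<dots> = (?q, ts)" unfolding Suc by (simp add: halting_def compile_def)
    finally show ?case .
  qed (simp add: fin)
  have "heads_below B (snd (run M x t))" for t
  proof (cases "t \<le> T")
    case False
    then have "t = (t - Suc T) + Suc T" by simp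
    then have "snd (run M x t) = ts" using stay[of "t - Suc T"] by simp
    then show ?thesis using exec_heads_below[OF ex] by simp
  qed (rule below)
  moreover have "fst (run M x (Suc T)) = (if A (map scanned ts) then accepting M else rejecting M)"
    unfolding fin by (simp add: compile_def)
  ultimately show ?thesis unfolding heads_below_def by blast
qed

end

theorem PSPACE_exec:
  fixes X :: "'a::finite list set" and p :: "nat poly"
  assumes wf: "wf_prog n \<Gamma> c" and n: "n \<ge> 1"
    and \<Gamma>: "finite \<Gamma>" "{Blank, Start} \<union> range Input \<subseteq> \<Gamma>"
    and ex: "\<And>x. \<exists>ts. exec (poly p (length x)) c
        ((start_contents x, 0) # replicate (n - 1) (start_contents [], 0)) ts \<and>
        (A (map scanned ts) \<longleftrightarrow> x \<in> X)"
  shows "X \<in> PSPACE"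
proof -
  obtain e :: "'a prog list \<Rightarrow> nat" where e: "inj_on e (conts c [])"
    using finite_conts finite_imp_inj_to_nat_seg by metis
  define code where "code = (\<lambda>x. e x + 2)"
  interpret compiled n \<Gamma> A c code
    by unfold_locales (use e wf n \<Gamma> in \<open>auto simp: code_def inj_on_def\<close>)
  have "decides_in_space M X (poly p)"
    unfolding decides_in_space_def
  proof
    fix x
    from ex[of x] obtain ts where "exec (poly p (length x)) c
        ((start_contents x, 0) # replicate (n - 1) (start_contents [], 0)) ts"
      and "A (map scanned ts) \<longleftrightarrow> x \<in> X" by blast
    with run_compile[OF this(1)]
    show "(\<exists>t. fst (run M x t) = (if x \<in> X then accepting M else rejecting M)) \<and>
          (\<forall>t. \<forall>(c, h)\<in>set (snd (run M x t)). h < poly p (length x))" by simp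
  qed
  with wf_compile show ?thesis unfolding PSPACE_def by blast
qed

section \<open>Stacks\<close>

text \<open>The head is on the top symbol and every cell to its right is blank, so the list
  determines the tape completely. A pop must therefore erase the cell that it leaves. The empty
  stack is an untouched work tape.\<close>

definition stack :: "'a symbol list \<Rightarrow> 'a tape" where
  "stack w = ((\<lambda>i. if i = 0 then Start else if i \<le> length w then rev w ! (i - 1) else Blank), length w)"

fun peek :: "'a symbol list \<Rightarrow> 'a symbol" where
  "peek [] = Start"
| "peek (a # w) = a"

lemma scanned_stack: "scanned (stack w) = peek w"
  by (cases w) (simp_all add: scanned_def stack_def nth_append)

lemma stack_peek: "(fst (stack w))(length w := peek w) = fst (stack w)"
  using scanned_stack[of w] by (intro fun_upd_idem) (simp add: scanned_def stack_def)

lemma act_pop: "act (Blank, Move_Left) (stack (a # w)) = stack w"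
  by (auto simp: stack_def fun_eq_iff nth_append)

text \<open>A machine step writes before it moves, so a push takes two steps: rewrite the old top
  and move onto the blank cell, then write the new symbol there.\<close>

lemma act_push: "act (a, Stay) (act (peek w, Move_Right) (stack w)) = stack (a # w)"
proof -
  have "act (peek w, Move_Right) (stack w) = (fst (stack w), Suc (length w))"
    using stack_peek[of w] by (simp add: stack_def)
  then show ?thesis by (auto simp: stack_def fun_eq_iff nth_append)
qed

lemma act_right: "scanned (act (peek w, Move_Right) (stack w)) = Blank"
  by (cases w) (simp_all add: scanned_def stack_def nth_append)

lemma act_top: "act (peek w, Stay) (stack w) = stack w"
  using stack_peek[of w] by (simp add: stack_def)

lemma snd_stack: "snd (stack w) = length w"
  by (simp add: stack_def)

lemma snd_act_right: "snd (act (a, Move_Right) (stack w)) = Suc (length w)"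
  by (simp add: stack_def)

text \<open>Values live on tape 1; tape 2 saves values, tapes 0 and 3 are scratch.\<close>

definition tapes :: "'a symbol list \<Rightarrow> 'a symbol list \<Rightarrow> 'a symbol list \<Rightarrow> 'a symbol list \<Rightarrow> 'a tape list"
  where "tapes a s t m = [stack a, stack s, stack t, stack m]"

definition below :: "nat \<Rightarrow> 'a symbol list \<Rightarrow> 'a symbol list \<Rightarrow> 'a symbol list \<Rightarrow> 'a symbol list \<Rightarrow> bool"
  where "below B a s t m \<longleftrightarrow> length a < B \<and> length s < B \<and> length t < B \<and> length m < B"

lemma heads_below_iff: "heads_below B ts \<longleftrightarrow> (\<forall>t\<in>set ts. snd t < B)"
  by (auto simp: heads_below_def)

lemma heads_below_tapes: "heads_below B (tapes a s t m) \<longleftrightarrow> below B a s t m"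
  by (auto simp: heads_below_iff tapes_def below_def snd_stack)

lemma scanned_tapes: "map scanned (tapes a s t m) = [peek a, peek s, peek t, peek m]"
  by (simp add: tapes_def scanned_stack)

definition stays :: "'a symbol list \<Rightarrow> ('a symbol \<times> move) list" where
  "stays as = map (\<lambda>a. (a, Stay)) as"

definition skip :: "'a prog" where "skip = PAct stays"

definition pop :: "nat \<Rightarrow> 'a prog" where
  "pop i = PAct (\<lambda>as. (stays as)[i := (Blank, Move_Left)])"

text \<open>The function \<open>g\<close> sees a blank on tape \<open>i\<close>.\<close>

definition push :: "nat \<Rightarrow> ('a symbol list \<Rightarrow> 'a symbol) \<Rightarrow> 'a prog" where
  "push i g = PSeq (PAct (\<lambda>as. (stays as)[i := (as ! i, Move_Right)]))
     (PAct (\<lambda>as. (stays as)[i := (g as, Stay)]))"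

lemma exec_skip: "below B a s t m \<Longrightarrow> exec B skip (tapes a s t m) (tapes a s t m)"
  unfolding skip_def
  by (rule exec_act)
    (simp_all only: heads_below_tapes scanned_tapes, simp add: tapes_def stays_def act_top del: act.simps)

lemma exec_act_tapes:
  assumes "below B a s t m" "below B a' s' t' m'"
    "map2 act (f [peek a, peek s, peek t, peek m]) (tapes a s t m) = tapes a' s' t' m'"
  shows "exec B (PAct f) (tapes a s t m) (tapes a' s' t' m')"
  using assms by (intro exec_act) (simp_all add: heads_below_tapes scanned_tapes)

lemma exec_pop:
  "below B (x # a) s t m \<Longrightarrow> exec B (pop 0) (tapes (x # a) s t m) (tapes a s t m)"
  "below B a (x # s) t m \<Longrightarrow> exec B (pop 1) (tapes a (x # s) t m) (tapes a s t m)"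
  "below B a s (x # t) m \<Longrightarrow> exec B (pop 2) (tapes a s (x # t) m) (tapes a s t m)"
  "below B a s t (x # m) \<Longrightarrow> exec B (pop 3) (tapes a s t (x # m)) (tapes a s t m)"
  unfolding pop_def
  by (rule exec_act_tapes, assumption, simp add: below_def,
      simp add: stays_def tapes_def act_top act_pop del: act.simps peek.simps)+

lemma exec_push:
  assumes "below B a s t m"
  shows "Suc (length a) < B \<Longrightarrow>
      exec B (push 0 g) (tapes a s t m) (tapes (g [Blank, peek s, peek t, peek m] # a) s t m)"
    "Suc (length s) < B \<Longrightarrow>
      exec B (push 1 g) (tapes a s t m) (tapes a (g [peek a, Blank, peek t, peek m] # s) t m)"
    "Suc (length t) < B \<Longrightarrow>
      exec B (push 2 g) (tapes a s t m) (tapes a s (g [peek a, peek s, Blank, peek m] # t) m)"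
    "Suc (length m) < B \<Longrightarrow>
      exec B (push 3 g) (tapes a s t m) (tapes a s t (g [peek a, peek s, peek t, Blank] # m))"
  unfolding push_def
     by (rule exec_seq[OF exec_act[OF _ refl] exec_act],
      use assms in \<open>simp_all add: heads_below_iff scanned_stack
        tapes_def stays_def act_top act_right act_push below_def snd_stack snd_act_right
        del: act.simps peek.simps\<close>)+

definition tape_symbols :: "'a symbol set" where
  "tape_symbols = {Blank, Start, Work 0, Work 1} \<union> range Input"

lemma wf_act_update:
  assumes "length as = k" "set as \<subseteq> \<Gamma>" "fst x \<in> \<Gamma>"
  shows "length ((stays as)[i := x]) = k \<and> fst ` set ((stays as)[i := x]) \<subseteq> \<Gamma>"
proof -
  have "set ((stays as)[i := x]) \<subseteq> insert x (set (stays as))" by (rule set_update_subset_insert)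
  then show ?thesis using assms by (auto simp: stays_def)
qed

lemma wf_skip: "wf_prog 4 tape_symbols skip"
  by (auto simp: skip_def stays_def)

lemma wf_pop: "wf_prog 4 tape_symbols (pop i)"
  unfolding pop_def wf_prog.simps
  by (intro allI impI wf_act_update) (simp_all add: tape_symbols_def)

lemma wf_push:
  assumes "i < 4" "\<And>as. length as = 4 \<Longrightarrow> set as \<subseteq> tape_symbols \<Longrightarrow> g as \<in> tape_symbols"
  shows "wf_prog 4 tape_symbols (push i g)"
proof -
  have "length ((stays as)[i := (as ! i, Move_Right)]) = 4 \<and>
      fst ` set ((stays as)[i := (as ! i, Move_Right)]) \<subseteq> tape_symbols"
    if "length as = 4" "set as \<subseteq> tape_symbols" for as :: "'a symbol list"
    using that assms(1) nth_mem[of i as] by (intro wf_act_update) auto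
  moreover have "length ((stays as)[i := (g as, Stay)]) = 4 \<and>
      fst ` set ((stays as)[i := (g as, Stay)]) \<subseteq> tape_symbols"
    if "length as = 4" "set as \<subseteq> tape_symbols" for as :: "'a symbol list"
    using that assms(2) by (intro wf_act_update) auto
  ultimately show ?thesis by (simp add: push_def)
qed

section \<open>Values\<close>

datatype 'a val = Atom 'a | Pair "'a val" "'a val"

text \<open>Polish notation: \<open>Work 0\<close> announces two subtrees, so the end of a value on
  a stack can be found by counting.\<close>

primrec enc :: "'a val \<Rightarrow> 'a symbol list" where
  "enc (Atom a) = [Input a]"
| "enc (Pair x y) = Work 0 # enc x @ enc y"

definition vsize :: "'a val \<Rightarrow> nat" where "vsize v = length (enc v)"

lemma vsize_simps [simp]: "vsize (Atom a) = 1" "vsize (Pair x y) = Suc (vsize x + vsize y)"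
  by (simp_all add: vsize_def)

lemma vsize_pos [simp]: "vsize v > 0"
  by (cases v) simp_all

lemma enc_symbols: "set (enc v) \<subseteq> insert (Work 0) (range Input)"
  by (induction v) auto

text \<open>\<open>Work 1\<close> can thus separate the values saved on tape 2, where codes lie
  reversed and no longer delimit themselves. \<open>Start\<close> is the bottom mark at which
  \<open>pour\<close> stops.\<close>

lemma mark_notin_enc [simp]: "Work (Suc 0) \<notin> set (enc v)" "Start \<notin> set (enc v)"
  using enc_symbols[of v] by auto

text \<open>Tape 3 counts, in unary, the values that are still to be moved to tape 2.\<close>

definition scan_loop :: "'a prog" where
  "scan_loop = PLoop (\<lambda>as. as ! 3 \<noteq> Start)
     (PSeq (PCond (\<lambda>as. as ! 1 = Work 0) (push 3 (\<lambda>_. Work 1)) (pop 3))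
       (PSeq (push 2 (\<lambda>as. as ! 1)) (pop 1)))"

lemma length_concat_enc: "length vs \<le> length (concat (map enc vs))"
proof (induction vs)
  case (Cons v vs)
  have "length (enc v) > 0" using vsize_pos[of v] unfolding vsize_def .
  with Cons show ?case by (cases "length (enc v)") simp_all
qed simp



text \<open>An inner node replaces one pending value by two, so a statement about a single value
  would not be preserved. The invariant concerns a list of pending values whose number is the unary
  counter, and the induction is on their total length.\<close>

lemma exec_scan_loop:
  "length a < B \<Longrightarrow> length (concat (map enc vs)) + length R < B \<Longrightarrow>
   length (concat (map enc vs)) + length T < B \<Longrightarrow>
   exec B scan_loop (tapes a (concat (map enc vs) @ R) T (replicate (length vs) (Work 1)))
     (tapes a R (rev (concat (map enc vs)) @ T) [])"
proof (induction vs arbitrary: T rule: measure_induct_rule[of "\<lambda>vs. length (concat (map enc vs))"])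
  case (less vs)
  show ?case
  proof (cases vs)
    case Nil
    then show ?thesis using less.prems
      by (simp add: scan_loop_def) (rule exec_done, simp_all add: scanned_tapes heads_below_tapes below_def)
  next
    case vs: (Cons v vs')
    let ?E = "concat (map enc vs') @ R" and ?N = "replicate (length vs') (Work 1 :: 'a symbol)"
    show ?thesis
    proof (cases v)
      case (Atom b)
      have small: "length a < B" "Suc (length ?E) < B" "Suc (length T) < B" "Suc (length ?N) < B"
        using less.prems length_concat_enc[of vs'] by (simp_all add: vs Atom)
      then have "exec B (pop 3) (tapes a (Input b # ?E) T (Work 1 # ?N)) (tapes a (Input b # ?E) T ?N)"
        by (intro exec_pop) (simp add: below_def)
      moreover have "exec B (push 2 (\<lambda>as. as ! 1)) (tapes a (Input b # ?E) T ?N)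
          (tapes a (Input b # ?E) (Input b # T) ?N)"
        using exec_push(3)[of B a "Input b # ?E" T ?N "\<lambda>as. as ! 1"] small by (simp add: below_def)
      moreover have "exec B (pop 1) (tapes a (Input b # ?E) (Input b # T) ?N)
          (tapes a ?E (Input b # T) ?N)"
        using small by (intro exec_pop) (simp add: below_def)
      moreover have "exec B scan_loop (tapes a ?E (Input b # T) ?N)
          (tapes a R (rev (concat (map enc vs')) @ Input b # T) [])"
        using less.IH[of vs' "Input b # T"] less.prems by (simp add: vs Atom)
      ultimately show ?thesis unfolding vs Atom scan_loop_def
        by simp (rule exec_loop[OF _ exec_seq[OF exec_cond exec_seq]], auto simp: scanned_tapes)
    next
      case (Pair x y)
      let ?F = "enc x @ enc y @ ?E"
      have small: "length a < B" "Suc (length ?F) < B" "Suc (length T) < B" "Suc (Suc (length ?N)) < B"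
        using less.prems length_concat_enc[of "x # y # vs'"] by (simp_all add: vs Pair)
      then have "exec B (push 3 (\<lambda>_. Work 1)) (tapes a (Work 0 # ?F) T (Work 1 # ?N))
          (tapes a (Work 0 # ?F) T (Work 1 # Work 1 # ?N))"
        using exec_push(4)[of B a "Work 0 # ?F" T "Work 1 # ?N" "\<lambda>_. Work 1"] by (simp add: below_def)
      moreover have "exec B (push 2 (\<lambda>as. as ! 1)) (tapes a (Work 0 # ?F) T (Work 1 # Work 1 # ?N))
          (tapes a (Work 0 # ?F) (Work 0 # T) (Work 1 # Work 1 # ?N))"
        using exec_push(3)[of B a "Work 0 # ?F" T "Work 1 # Work 1 # ?N" "\<lambda>as. as ! 1"] small
        by (simp add: below_def)
      moreover have "exec B (pop 1) (tapes a (Work 0 # ?F) (Work 0 # T) (Work 1 # Work 1 # ?N))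
          (tapes a ?F (Work 0 # T) (Work 1 # Work 1 # ?N))"
        using small by (intro exec_pop) (simp add: below_def)
      moreover have "exec B scan_loop (tapes a ?F (Work 0 # T) (Work 1 # Work 1 # ?N))
          (tapes a R (rev (concat (map enc (x # y # vs'))) @ Work 0 # T) [])"
        using less.IH[of "x # y # vs'" "Work 0 # T"] less.prems by (simp add: vs Pair)
      ultimately show ?thesis unfolding vs Pair scan_loop_def
        by simp (rule exec_loop[OF _ exec_seq[OF exec_cond exec_seq]], auto simp: scanned_tapes)
    qed
  qed
qed

definition scan :: "'a prog" where
  "scan = PSeq (push 2 (\<lambda>_. Work 1)) (PSeq (push 3 (\<lambda>_. Work 1)) scan_loop)"

lemma exec_scan:
  assumes "length a < B" "vsize v + length R < B" "vsize v + length T + 1 < B"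
  shows "exec B scan (tapes a (enc v @ R) T []) (tapes a R (rev (enc v) @ Work 1 # T) [])"
proof -
  have small: "length a < B" "length (enc v @ R) < B" "length (enc v) + Suc (length T) < B"
    using assms by (simp_all add: vsize_def)
  have "length (enc v) > 0" using vsize_pos[of v] unfolding vsize_def .
  then have "exec B (push 2 (\<lambda>_. Work 1)) (tapes a (enc v @ R) T []) (tapes a (enc v @ R) (Work 1 # T) [])"
    "exec B (push 3 (\<lambda>_. Work 1)) (tapes a (enc v @ R) (Work 1 # T) [])
      (tapes a (enc v @ R) (Work 1 # T) [Work 1])"
    using small exec_push(3)[of B a "enc v @ R" T "[]" "\<lambda>_. Work 1"]
      exec_push(4)[of B a "enc v @ R" "Work 1 # T" "[]" "\<lambda>_. Work 1"] by (auto simp: below_def)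
  moreover have "exec B scan_loop (tapes a (enc v @ R) (Work 1 # T) [Work 1])
      (tapes a R (rev (enc v) @ Work 1 # T) [])"
    using exec_scan_loop[of a B "[v]" R "Work 1 # T"] small by simp
  ultimately show ?thesis unfolding scan_def by (blast intro: exec_seq)
qed

definition unscan :: "'a prog" where
  "unscan = PSeq (PLoop (\<lambda>as. as ! 2 \<noteq> Work 1) (PSeq (push 1 (\<lambda>as. as ! 2)) (pop 2))) (pop 2)"

lemma exec_unscan:
  assumes "Work 1 \<notin> set w" "length a < B" "length w + length s < B" "length w + length T + 1 < B"
  shows "exec B unscan (tapes a s (w @ Work 1 # T) []) (tapes a (rev w @ s) T [])"
  unfolding unscan_def
proof (rule exec_seq)
  show "exec B (PLoop (\<lambda>as. as ! 2 \<noteq> Work 1) (PSeq (push 1 (\<lambda>as. as ! 2)) (pop 2)))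
      (tapes a s (w @ Work 1 # T) []) (tapes a (rev w @ s) (Work 1 # T) [])"
    using assms
  proof (induction w arbitrary: s)
    case Nil
    then show ?case by (auto intro!: exec_done simp: scanned_tapes heads_below_tapes below_def)
  next
    case (Cons x w)
    from Cons.prems have "exec B (push 1 (\<lambda>as. as ! 2)) (tapes a s (x # w @ Work 1 # T) [])
        (tapes a (x # s) (x # w @ Work 1 # T) [])"
      using exec_push(2)[of B a s "x # w @ Work 1 # T" "[]" "\<lambda>as. as ! 2"] by (simp add: below_def)
    moreover have "exec B (pop 2) (tapes a (x # s) (x # w @ Work 1 # T) [])
        (tapes a (x # s) (w @ Work 1 # T) [])"
      using Cons.prems by (intro exec_pop) (simp add: below_def)
    moreover note Cons.IH[of "x # s"]
    ultimately show ?case using Cons.prems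
      by simp (rule exec_loop[OF _ exec_seq], auto simp: scanned_tapes)
  qed
  show "exec B (pop 2) (tapes a (rev w @ s) (Work 1 # T) []) (tapes a (rev w @ s) T [])"
    using assms by (intro exec_pop) (simp add: below_def)
qed

definition discard :: "'a prog" where
  "discard = PSeq (PLoop (\<lambda>as. as ! 2 \<noteq> Work 1) (pop 2)) (pop 2)"

lemma exec_discard:
  assumes "Work 1 \<notin> set w" "length a < B" "length s < B" "length w + length T + 1 < B"
  shows "exec B discard (tapes a s (w @ Work 1 # T) []) (tapes a s T [])"
  unfolding discard_def
proof (rule exec_seq)
  show "exec B (PLoop (\<lambda>as. as ! 2 \<noteq> Work 1) (pop 2))
      (tapes a s (w @ Work 1 # T) []) (tapes a s (Work 1 # T) [])"
    using assms
  proof (induction w)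
    case Nil
    then show ?case by (auto intro!: exec_done simp: scanned_tapes heads_below_tapes below_def)
  next
    case (Cons x w)
    from Cons.prems have "exec B (pop 2) (tapes a s (x # w @ Work 1 # T) []) (tapes a s (w @ Work 1 # T) [])"
      by (intro exec_pop) (simp add: below_def)
    moreover note Cons.IH
    ultimately show ?case using Cons.prems
      by simp (rule exec_loop, auto simp: scanned_tapes)
  qed
  show "exec B (pop 2) (tapes a s (Work 1 # T) []) (tapes a s T [])"
    using assms by (intro exec_pop) (simp add: below_def)
qed

definition unscan_copy :: "'a prog" where
  "unscan_copy = PSeq (PLoop (\<lambda>as. as ! 2 \<noteq> Work 1)
     (PSeq (push 1 (\<lambda>as. as ! 2)) (PSeq (push 0 (\<lambda>as. as ! 2)) (pop 2)))) (pop 2)"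

lemma exec_unscan_copy:
  assumes "Work 1 \<notin> set w" "length w + length a < B" "length w + length s < B" "length w + length T + 1 < B"
  shows "exec B unscan_copy (tapes a s (w @ Work 1 # T) []) (tapes (rev w @ a) (rev w @ s) T [])"
  unfolding unscan_copy_def
proof (rule exec_seq)
  show "exec B (PLoop (\<lambda>as. as ! 2 \<noteq> Work 1)
     (PSeq (push 1 (\<lambda>as. as ! 2)) (PSeq (push 0 (\<lambda>as. as ! 2)) (pop 2))))
      (tapes a s (w @ Work 1 # T) []) (tapes (rev w @ a) (rev w @ s) (Work 1 # T) [])"
    using assms
  proof (induction w arbitrary: a s)
    case Nil
    then show ?case by (auto intro!: exec_done simp: scanned_tapes heads_below_tapes below_def)
  next
    case (Cons x w)
    from Cons.prems have "exec B (push 1 (\<lambda>as. as ! 2)) (tapes a s (x # w @ Work 1 # T) [])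
        (tapes a (x # s) (x # w @ Work 1 # T) [])"
      using exec_push(2)[of B a s "x # w @ Work 1 # T" "[]" "\<lambda>as. as ! 2"] by (simp add: below_def)
    moreover have "exec B (push 0 (\<lambda>as. as ! 2)) (tapes a (x # s) (x # w @ Work 1 # T) [])
        (tapes (x # a) (x # s) (x # w @ Work 1 # T) [])"
      using Cons.prems exec_push(1)[of B a "x # s" "x # w @ Work 1 # T" "[]" "\<lambda>as. as ! 2"] by (simp add: below_def)
    moreover have "exec B (pop 2) (tapes (x # a) (x # s) (x # w @ Work 1 # T) [])
        (tapes (x # a) (x # s) (w @ Work 1 # T) [])"
      using Cons.prems by (intro exec_pop) (simp add: below_def)
    moreover note Cons.IH[of "x # a" "x # s"]
    ultimately show ?case using Cons.prems
      by simp (rule exec_loop[OF _ exec_seq[OF _ exec_seq]], auto simp: scanned_tapes)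
  qed
  show "exec B (pop 2) (tapes (rev w @ a) (rev w @ s) (Work 1 # T) []) (tapes (rev w @ a) (rev w @ s) T [])"
    using assms by (intro exec_pop) (simp add: below_def)
qed

definition pour :: "'a prog" where
  "pour = PLoop (\<lambda>as. as ! 0 \<noteq> Start) (PSeq (push 2 (\<lambda>as. as ! 0)) (pop 0))"

lemma exec_pour:
  "Start \<notin> set w \<Longrightarrow> length w < B \<Longrightarrow> length s < B \<Longrightarrow> length w + length T < B \<Longrightarrow>
   exec B pour (tapes w s T []) (tapes [] s (rev w @ T) [])"
  unfolding pour_def
proof (induction w arbitrary: T)
  case Nil
  then show ?case by (auto intro!: exec_done simp: scanned_tapes heads_below_tapes below_def)
next
  case (Cons x w)
  have "exec B (push 2 (\<lambda>as. as ! 0)) (tapes (x # w) s T []) (tapes (x # w) s (x # T) [])"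
    using Cons.prems exec_push(3)[of B "x # w" s T "[]" "\<lambda>as. as ! 0"] by (simp add: below_def)
  moreover have "exec B (pop 0) (tapes (x # w) s (x # T) []) (tapes w s (x # T) [])"
    using Cons.prems by (intro exec_pop) (simp add: below_def)
  moreover note Cons.IH[of "x # T"]
  ultimately show ?case using Cons.prems
    by simp (rule exec_loop[OF _ exec_seq], auto simp: scanned_tapes)
qed

text \<open>Moving a word between stacks reverses it. Hence the second copy, made on tape 0, returns
  to tape 1 by way of tape 2.\<close>

definition dup :: "'a prog" where
  "dup = PSeq scan (PSeq unscan_copy (PSeq (push 2 (\<lambda>_. Work 1)) (PSeq pour unscan)))"

lemma exec_dup:
  assumes "2 * vsize v + length R < B" "vsize v + length T + 1 < B"
  shows "exec B dup (tapes [] (enc v @ R) T []) (tapes [] (enc v @ enc v @ R) T [])"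
proof -
  have small: "2 * length (enc v) + length R < B" "length (enc v) + length T + 1 < B"
    using assms by (simp_all add: vsize_def)
  have "exec B scan (tapes [] (enc v @ R) T []) (tapes [] R (rev (enc v) @ Work 1 # T) [])"
    using assms by (intro exec_scan) simp_all
  moreover have "exec B unscan_copy (tapes [] R (rev (enc v) @ Work 1 # T) [])
      (tapes (enc v) (enc v @ R) T [])"
    using exec_unscan_copy[of "rev (enc v)" "[]" B R T] small by simp
  moreover have "exec B (push 2 (\<lambda>_. Work 1)) (tapes (enc v) (enc v @ R) T [])
      (tapes (enc v) (enc v @ R) (Work 1 # T) [])"
    using exec_push(3)[of B "enc v" "enc v @ R" T "[]" "\<lambda>_. Work 1"] small
      vsize_pos[of v, unfolded vsize_def] by (auto simp: below_def)
  moreover have "exec B pour (tapes (enc v) (enc v @ R) (Work 1 # T) [])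
      (tapes [] (enc v @ R) (rev (enc v) @ Work 1 # T) [])"
    using small by (intro exec_pour) simp_all
  moreover have "exec B unscan (tapes [] (enc v @ R) (rev (enc v) @ Work 1 # T) [])
      (tapes [] (enc v @ enc v @ R) T [])"
    using exec_unscan[of "rev (enc v)" "[]" B "enc v @ R" T] small by simp
  ultimately show ?thesis unfolding dup_def by (blast intro: exec_seq)
qed

definition drop_val :: "'a prog" where "drop_val = PSeq scan discard"

lemma exec_drop_val:
  assumes "length a < B" "vsize v + length R < B" "vsize v + length T + 1 < B"
  shows "exec B drop_val (tapes a (enc v @ R) T []) (tapes a R T [])"
  unfolding drop_val_def
  by (rule exec_seq[OF exec_scan[OF assms] exec_discard]) (use assms in \<open>simp_all add: vsize_def\<close>)

lemma Work_in_tape_symbols: "Work 0 \<in> tape_symbols" "Work (Suc 0) \<in> tape_symbols"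
  by (simp_all add: tape_symbols_def)

lemma wf_push_read: "i < 4 \<Longrightarrow> j < 4 \<Longrightarrow> wf_prog 4 tape_symbols (push i (\<lambda>as. as ! j))"
  by (intro wf_push) (auto simp: subset_iff)

lemma wf_push_const: "i < 4 \<Longrightarrow> x \<in> tape_symbols \<Longrightarrow> wf_prog 4 tape_symbols (push i (\<lambda>_. x))"
  by (intro wf_push)

lemma wf_progs:
  "wf_prog 4 tape_symbols scan" "wf_prog 4 tape_symbols unscan" "wf_prog 4 tape_symbols dup"
  "wf_prog 4 tape_symbols drop_val"
  by (simp_all add: scan_def scan_loop_def unscan_def dup_def unscan_copy_def pour_def drop_val_def
      discard_def wf_pop wf_push_read wf_push_const Work_in_tape_symbols)

section \<open>Functions computable in polynomial space\<close>

text \<open>\<open>R\<close> lies below the argument and \<open>T\<close> is saved on tape 2.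
  Quantifying over both is a frame rule: the program runs unchanged on top of any intermediate
  values, whose lengths are simply added to the space.\<close>

definition computes :: "'a prog \<Rightarrow> nat poly \<Rightarrow> 'a val set \<Rightarrow> ('a val \<Rightarrow> 'a val) \<Rightarrow> bool" where
  "computes c q D f \<longleftrightarrow> wf_prog 4 tape_symbols c \<and>
     (\<forall>v\<in>D. \<forall>R T B. length R + length T + poly q (vsize v) \<le> B \<longrightarrow>
        exec B c (tapes [] (enc v @ R) T []) (tapes [] (enc (f v) @ R) T []))"

definition computable_on :: "'a val set \<Rightarrow> ('a val \<Rightarrow> 'a val) \<Rightarrow> bool" where
  "computable_on D f \<longleftrightarrow> (\<exists>c q. computes c q D f)"

abbreviation "computable f \<equiv> computable_on UNIV f"

text \<open>The last part comes from the second: the result is written on a tape within the space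
  bound, so its size is bounded polynomially too. Composition and loops rest on this.\<close>

lemma computesD:
  assumes "computes c q D f"
  shows "wf_prog 4 tape_symbols c"
    "v \<in> D \<Longrightarrow> length R + length T + poly q (vsize v) \<le> B \<Longrightarrow>
      exec B c (tapes [] (enc v @ R) T []) (tapes [] (enc (f v) @ R) T [])"
    "v \<in> D \<Longrightarrow> vsize (f v) < poly q (vsize v)"
proof -
  show "wf_prog 4 tape_symbols c" using assms by (simp add: computes_def)
  show ex: "exec B c (tapes [] (enc v @ R) T []) (tapes [] (enc (f v) @ R) T [])"
    if "v \<in> D" "length R + length T + poly q (vsize v) \<le> B" for v R T B
    using assms that by (simp add: computes_def)
  show "vsize (f v) < poly q (vsize v)" if "v \<in> D"
    using exec_heads_below[OF ex[OF that, of "[]" "[]" "poly q (vsize v)"]]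
    by (simp add: heads_below_tapes below_def vsize_def)
qed

lemma computable_onI:
  assumes "wf_prog 4 tape_symbols c"
    "\<And>v R T B. v \<in> D \<Longrightarrow> length R + length T + poly q (vsize v) \<le> B \<Longrightarrow>
        exec B c (tapes [] (enc v @ R) T []) (tapes [] (enc (f v) @ R) T [])"
  shows "computable_on D f"
  using assms unfolding computable_on_def computes_def by blast

lemma poly_mono_nat: "x \<le> y \<Longrightarrow> poly (p :: nat poly) x \<le> poly p y"
proof (induction p)
  case (pCons a p)
  then show ?case using mult_le_mono[OF pCons.prems pCons.IH[OF pCons.prems]] by simp
qed simp

lemma computable_on_subset:
  assumes "computable_on E f" "D \<subseteq> E"
  shows "computable_on D f"
proof -
  from assms(1) obtain c q where "computes c q E f" by (auto simp: computable_on_def)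
  note c = computesD(1)[OF this] computesD(2,3)[OF this]
  show ?thesis by (rule computable_onI[OF c(1)]) (rule c(2)[OF subsetD[OF assms(2)]])
qed

section \<open>Closure properties of the computable functions\<close>

lemma computable_id: "computable (\<lambda>v. v)"
  by (rule computable_onI[OF wf_skip, of _ "[:1, 1:]"])
    (intro exec_skip, simp add: below_def vsize_def)

lemma computable_on_comp:
  fixes f g :: "'a val \<Rightarrow> 'a val"
  assumes "computable_on D f" "computable_on E g" "\<And>v. v \<in> D \<Longrightarrow> f v \<in> E"
  shows "computable_on D (\<lambda>v. g (f v))"
proof -
  from assms(1) obtain c p where "computes c p D f" by (auto simp: computable_on_def)
  note c = computesD(1)[OF this] computesD(2,3)[OF this]
  from assms(2) obtain d q where "computes d q E g" by (auto simp: computable_on_def)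
  note d = computesD(1)[OF this] computesD(2,3)[OF this]
  show ?thesis
  proof (rule computable_onI[of "PSeq c d" _ "p + q \<circ>\<^sub>p p"])
    fix v :: "'a val" and R T :: "'a symbol list" and B assume v: "v \<in> D" and B: "length R + length T + poly (p + q \<circ>\<^sub>p p) (vsize v) \<le> B"
    have "poly q (vsize (f v)) \<le> poly q (poly p (vsize v))"
      using c(3)[OF v] by (intro poly_mono_nat) simp
    with B show "exec B (PSeq c d) (tapes [] (enc v @ R) T []) (tapes [] (enc (g (f v)) @ R) T [])"
      using v assms(3) by (intro exec_seq[OF c(2) d(2)]) (auto simp: poly_pcompose)
  qed (simp add: c d)
qed

lemma computable_comp: "computable g \<Longrightarrow> computable f \<Longrightarrow> computable (\<lambda>v. g (f v))"
  by (rule computable_on_comp[where E = UNIV]) simp_all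

lemma Input_in_tape_symbols: "Input a \<in> tape_symbols"
  by (simp add: tape_symbols_def)

lemma computable_Atom: "computable (\<lambda>v. Atom a)"
proof (rule computable_onI[of "PSeq drop_val (push 1 (\<lambda>_. Input a))" _ "[:3, 1:]"])
  fix v :: "'a val" and R T :: "'a symbol list" and B
  assume B: "length R + length T + poly [:3, 1:] (vsize v) \<le> B"
  have "exec B drop_val (tapes [] (enc v @ R) T []) (tapes [] R T [])"
    using B by (intro exec_drop_val) simp_all
  moreover have "exec B (push 1 (\<lambda>_. Input a)) (tapes [] R T []) (tapes [] (Input a # R) T [])"
    using B exec_push(2)[of B "[]" R T "[]" "\<lambda>_. Input a"] by (simp add: below_def)
  ultimately show "exec B (PSeq drop_val (push 1 (\<lambda>_. Input a))) (tapes [] (enc v @ R) T [])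
      (tapes [] (enc (Atom a) @ R) T [])" by (auto intro: exec_seq)
qed (simp add: wf_progs wf_push_const Input_in_tape_symbols)

lemma computable_Pair:
  fixes f g :: "'a val \<Rightarrow> 'a val"
  assumes "computable f" "computable g"
  shows "computable (\<lambda>v. Pair (f v) (g v))"
proof -
  from assms(1) obtain c p where "computes c p UNIV f" by (auto simp: computable_on_def)
  note c = computesD(1)[OF this] computesD(2,3)[OF this UNIV_I]
  from assms(2) obtain d q where "computes d q UNIV g" by (auto simp: computable_on_def)
  note d = computesD(1)[OF this] computesD(2,3)[OF this UNIV_I]
  let ?push = "push 1 (\<lambda>_. Work 0)"
  show ?thesis
  proof (rule computable_onI[of "PSeq dup (PSeq c (PSeq scan (PSeq d (PSeq unscan ?push))))" _
        "[:3, 2:] + p + q"])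
    fix v :: "'a val" and R T :: "'a symbol list" and B assume B: "length R + length T + poly ([:3, 2:] + p + q) (vsize v) \<le> B"
    have B: "length R + length T + 2 * vsize v + poly p (vsize v) + poly q (vsize v) + 3 \<le> B"
      using B by simp
    note fg = c(3)[of v] d(3)[of v]
    let ?T = "rev (enc (f v)) @ Work 1 # T"
    have "exec B dup (tapes [] (enc v @ R) T []) (tapes [] (enc v @ enc v @ R) T [])"
      using B by (intro exec_dup) simp_all
    moreover have "exec B c (tapes [] (enc v @ enc v @ R) T []) (tapes [] (enc (f v) @ enc v @ R) T [])"
      using B by (intro c(2)) (simp add: vsize_def)
    moreover have "exec B scan (tapes [] (enc (f v) @ enc v @ R) T []) (tapes [] (enc v @ R) ?T [])"
      using B fg by (intro exec_scan) (simp_all add: vsize_def)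
    moreover have "exec B d (tapes [] (enc v @ R) ?T []) (tapes [] (enc (g v) @ R) ?T [])"
      using B fg by (intro d(2)) (simp_all add: vsize_def)
    moreover have "exec B unscan (tapes [] (enc (g v) @ R) ?T [])
        (tapes [] (enc (f v) @ enc (g v) @ R) T [])"
      using exec_unscan[of "rev (enc (f v))" "[]" B "enc (g v) @ R" T] B fg by (simp add: vsize_def)
    moreover have "exec B ?push (tapes [] (enc (f v) @ enc (g v) @ R) T [])
        (tapes [] (enc (Pair (f v) (g v)) @ R) T [])"
      using exec_push(2)[of B "[]" "enc (f v) @ enc (g v) @ R" T "[]" "\<lambda>_. Work 0"] B fg
      by (simp add: vsize_def below_def)
    ultimately show "exec B (PSeq dup (PSeq c (PSeq scan (PSeq d (PSeq unscan ?push)))))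
        (tapes [] (enc v @ R) T []) (tapes [] (enc (Pair (f v) (g v)) @ R) T [])"
      by (blast intro: exec_seq)
  qed (simp add: wf_progs c d wf_push_const Work_in_tape_symbols)
qed

fun vfst :: "'a val \<Rightarrow> 'a val" where
  "vfst (Atom a) = Atom a"
| "vfst (Pair x y) = x"

fun vsnd :: "'a val \<Rightarrow> 'a val" where
  "vsnd (Atom a) = Atom a"
| "vsnd (Pair x y) = y"

lemma computable_vfst_id: "computable vfst"
proof (rule computable_onI[of "PCond (\<lambda>as. as ! 1 = Work 0)
      (PSeq (pop 1) (PSeq scan (PSeq drop_val unscan))) skip" _ "[:3, 2:]"])
  fix v :: "'a val" and R T :: "'a symbol list" and B
  assume B: "length R + length T + poly [:3, 2:] (vsize v) \<le> B"
  show "exec B (PCond (\<lambda>as. as ! 1 = Work 0)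
      (PSeq (pop 1) (PSeq scan (PSeq drop_val unscan))) skip)
      (tapes [] (enc v @ R) T []) (tapes [] (enc (vfst v) @ R) T [])"
  proof (cases v)
    case (Atom a)
    then show ?thesis using B
      by (intro exec_cond) (auto simp: scanned_tapes intro!: exec_skip simp: below_def)
  next
    case (Pair x y)
    let ?T = "rev (enc x) @ Work 1 # T"
    have B: "length R + length T + 2 * vsize x + 2 * vsize y + 5 \<le> B" using B by (simp add: Pair)
    have "exec B (pop 1) (tapes [] (enc v @ R) T []) (tapes [] (enc x @ enc y @ R) T [])"
      using B unfolding Pair enc.simps append_Cons append_assoc
      by (intro exec_pop) (simp add: below_def vsize_def)
    moreover have "exec B scan (tapes [] (enc x @ enc y @ R) T []) (tapes [] (enc y @ R) ?T [])"
      using B by (intro exec_scan) (simp_all add: vsize_def)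
    moreover have "exec B drop_val (tapes [] (enc y @ R) ?T []) (tapes [] R ?T [])"
      using B by (intro exec_drop_val) (simp_all add: vsize_def)
    moreover have "exec B unscan (tapes [] R ?T []) (tapes [] (enc x @ R) T [])"
      using exec_unscan[of "rev (enc x)" "[]" B R T] B by (simp add: vsize_def)
    ultimately have "exec B (PSeq (pop 1) (PSeq scan (PSeq drop_val unscan)))
        (tapes [] (enc v @ R) T []) (tapes [] (enc x @ R) T [])" by (blast intro: exec_seq)
    then show ?thesis by (intro exec_cond) (simp add: Pair scanned_tapes)
  qed
qed (simp add: wf_progs wf_pop wf_skip)

lemma computable_vsnd_id: "computable vsnd"
proof (rule computable_onI[of "PCond (\<lambda>as. as ! 1 = Work 0) (PSeq (pop 1) drop_val) skip" _ "[:3, 2:]"])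
  fix v :: "'a val" and R T :: "'a symbol list" and B
  assume B: "length R + length T + poly [:3, 2:] (vsize v) \<le> B"
  show "exec B (PCond (\<lambda>as. as ! 1 = Work 0) (PSeq (pop 1) drop_val) skip)
      (tapes [] (enc v @ R) T []) (tapes [] (enc (vsnd v) @ R) T [])"
  proof (cases v)
    case (Atom a)
    then show ?thesis using B
      by (intro exec_cond) (auto simp: scanned_tapes intro!: exec_skip simp: below_def)
  next
    case (Pair x y)
    have B: "length R + length T + 2 * vsize x + 2 * vsize y + 5 \<le> B" using B by (simp add: Pair)
    have "exec B (pop 1) (tapes [] (enc v @ R) T []) (tapes [] (enc x @ enc y @ R) T [])"
      using B unfolding Pair enc.simps append_Cons append_assoc
      by (intro exec_pop) (simp add: below_def vsize_def)
    moreover have "exec B drop_val (tapes [] (enc x @ enc y @ R) T []) (tapes [] (enc y @ R) T [])"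
      using B by (intro exec_drop_val) (simp_all add: vsize_def)
    ultimately have "exec B (PSeq (pop 1) drop_val)
        (tapes [] (enc v @ R) T []) (tapes [] (enc y @ R) T [])" by (blast intro: exec_seq)
    then show ?thesis by (intro exec_cond) (simp add: Pair scanned_tapes)
  qed
qed (simp add: wf_progs wf_pop wf_skip)

lemmas computable_vfst = computable_comp[OF computable_vfst_id]
lemmas computable_vsnd = computable_comp[OF computable_vsnd_id]

fun vhead :: "'a val \<Rightarrow> 'a option" where
  "vhead (Atom a) = Some a"
| "vhead (Pair x y) = None"

definition vtest :: "('a option \<Rightarrow> bool) \<Rightarrow> 'a val \<Rightarrow> bool" where
  "vtest P v \<longleftrightarrow> P (vhead v)"

fun symbol_atom :: "'a symbol \<Rightarrow> 'a option" where
  "symbol_atom (Input a) = Some a"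
| "symbol_atom _ = None"

lemma symbol_atom_peek [simp]: "symbol_atom (peek (enc v @ R)) = vhead v"
  by (cases v) simp_all

lemma computable_test:
  fixes f g :: "'a val \<Rightarrow> 'a val"
  assumes "computable f" "computable g" "computable h"
  shows "computable (\<lambda>v. if vtest P (h v) then f v else g v)"
proof -
  from assms(1) obtain c p where "computes c p UNIV f" by (auto simp: computable_on_def)
  note c = computesD(1)[OF this] computesD(2,3)[OF this UNIV_I]
  from assms(2) obtain d q where "computes d q UNIV g" by (auto simp: computable_on_def)
  note d = computesD(1)[OF this] computesD(2,3)[OF this UNIV_I]
  from assms(3) obtain e r where "computes e r UNIV h" by (auto simp: computable_on_def)
  note e = computesD(1)[OF this] computesD(2,3)[OF this UNIV_I]
  let ?P = "\<lambda>as. P (symbol_atom (as ! 1))"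
  show ?thesis
  proof (rule computable_onI[of "PSeq dup (PSeq e (PCond ?P (PSeq drop_val c) (PSeq drop_val d)))" _
        "[:3, 2:] + p + q + r"])
    fix v :: "'a val" and R T :: "'a symbol list" and B assume B: "length R + length T + poly ([:3, 2:] + p + q + r) (vsize v) \<le> B"
    have B: "length R + length T + 2 * vsize v + poly p (vsize v) + poly q (vsize v)
        + poly r (vsize v) + 3 \<le> B"
      using B by simp
    note h = e(3)[of v]
    have "exec B dup (tapes [] (enc v @ R) T []) (tapes [] (enc v @ enc v @ R) T [])"
      using B by (intro exec_dup) simp_all
    moreover have "exec B e (tapes [] (enc v @ enc v @ R) T []) (tapes [] (enc (h v) @ enc v @ R) T [])"
      using B by (intro e(2)) (simp add: vsize_def)
    moreover have "exec B drop_val (tapes [] (enc (h v) @ enc v @ R) T []) (tapes [] (enc v @ R) T [])"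
      using B h by (intro exec_drop_val) (simp_all add: vsize_def)
    moreover have "exec B c (tapes [] (enc v @ R) T []) (tapes [] (enc (f v) @ R) T [])"
      "exec B d (tapes [] (enc v @ R) T []) (tapes [] (enc (g v) @ R) T [])"
      using B by (intro c(2) d(2); simp)+
    ultimately show "exec B (PSeq dup (PSeq e (PCond ?P (PSeq drop_val c) (PSeq drop_val d))))
        (tapes [] (enc v @ R) T []) (tapes [] (enc (if vtest P (h v) then f v else g v) @ R) T [])"
      by (intro exec_seq[OF _ exec_seq[OF _ exec_cond]])
        (auto simp: scanned_tapes vtest_def intro: exec_seq)
  qed (simp add: wf_progs c d e)
qed

text \<open>A predicate is identified with its ability to guard a branch. Boolean connectives become
  nested branches, and truth values are never encoded.\<close>

definition decidable :: "('a val \<Rightarrow> bool) \<Rightarrow> bool" where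
  "decidable b \<longleftrightarrow>
     (\<forall>f g. computable f \<longrightarrow> computable g \<longrightarrow> computable (\<lambda>v. if b v then f v else g v))"

lemma decidable_vtest: "computable h \<Longrightarrow> decidable (\<lambda>v. vtest P (h v))"
  by (simp add: decidable_def computable_test)

lemma computable_If:
  "decidable b \<Longrightarrow> computable f \<Longrightarrow> computable g \<Longrightarrow> computable (\<lambda>v. if b v then f v else g v)"
  by (simp add: decidable_def)

lemma decidable_not: "decidable b \<Longrightarrow> decidable (\<lambda>v. \<not> b v)"
proof -
  have eq: "(\<lambda>v. if \<not> b v then f v else g v) = (\<lambda>v. if b v then g v else f v)"
    for f g :: "'b val \<Rightarrow> 'b val" and b by auto
  show "decidable b \<Longrightarrow> decidable (\<lambda>v. \<not> b v)"
    unfolding decidable_def eq by blast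
qed

lemma decidable_conj: "decidable b \<Longrightarrow> decidable b' \<Longrightarrow> decidable (\<lambda>v. b v \<and> b' v)"
proof -
  have eq: "(\<lambda>v. if b v \<and> b' v then f v else g v) = (\<lambda>v. if b v then if b' v then f v else g v else g v)"
    for f g :: "'b val \<Rightarrow> 'b val" and b b' by auto
  show "decidable b \<Longrightarrow> decidable b' \<Longrightarrow> decidable (\<lambda>v. b v \<and> b' v)"
    unfolding decidable_def eq by blast
qed

lemma decidable_disj: "decidable b \<Longrightarrow> decidable b' \<Longrightarrow> decidable (\<lambda>v. b v \<or> b' v)"
  using decidable_not[OF decidable_conj[OF decidable_not[of b] decidable_not[of b']]] by simp

definition vrel :: "('a option \<Rightarrow> 'a option \<Rightarrow> bool) \<Rightarrow> 'a val \<Rightarrow> 'a val \<Rightarrow> bool" where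
  "vrel P v w \<longleftrightarrow> P (vhead v) (vhead w)"

lemma decidable_False: "decidable (\<lambda>v. False)"
  by (simp add: decidable_def)

text \<open>A relation between two roots is a finite disjunction of products of unary tests.\<close>

lemma decidable_vrel:
  fixes f g :: "'a::finite val \<Rightarrow> 'a val"
  assumes "computable f" "computable g"
  shows "decidable (\<lambda>v. vrel P (f v) (g v))"
proof -
  have "decidable (\<lambda>v. \<exists>a\<in>A. vtest (\<lambda>x. x = a) (f v) \<and> vtest (P a) (g v))" if "finite A" for A
    using that
  proof (induction A)
    case (insert a A)
    then show ?case
      by (simp add: assms decidable_conj decidable_disj decidable_vtest)
  qed (simp add: decidable_False)
  from this[of UNIV] show ?thesis by (simp add: vtest_def vrel_def)
qed

section \<open>Loops with bounded intermediate values\<close>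

inductive iterates :: "('a val \<Rightarrow> 'a val) \<Rightarrow> ('a val \<Rightarrow> bool) \<Rightarrow> nat \<Rightarrow> 'a val \<Rightarrow> 'a val \<Rightarrow> bool"
  for f P N where
  iterates_refl: "vsize v \<le> N \<Longrightarrow> iterates f P N v v"
| iterates_step: "P v \<Longrightarrow> vsize v \<le> N \<Longrightarrow> iterates f P N (f v) w \<Longrightarrow> iterates f P N v w"

lemma iterates_trans: "iterates f P N u v \<Longrightarrow> iterates f P N v w \<Longrightarrow> iterates f P N u w"
  by (induction rule: iterates.induct) (auto intro: iterates.intros)

lemma iterates_mono: "iterates f P N u v \<Longrightarrow> N \<le> N' \<Longrightarrow> iterates f P N' u v"
  by (induction rule: iterates.induct) (auto intro: iterates.intros)

lemma iterates_vsize: "iterates f P N u v \<Longrightarrow> vsize u \<le> N"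
  by (induction rule: iterates.induct) auto

text \<open>Only the existence of a finite run through values of size at most \<open>poly p\<close>
  is demanded, and only from arguments in \<open>D\<close>. Between two rounds the stack holds the
  test value \<open>g u\<close> on top of \<open>u\<close>, so the loop condition is a look at one
  symbol.\<close>

lemma computable_while:
  fixes f g :: "'a val \<Rightarrow> 'a val"
  assumes "computable f" "computable g"
    and iter: "\<And>v. v \<in> D \<Longrightarrow> iterates f (\<lambda>u. vtest P (g u)) (poly p (vsize v)) v (h v)"
    and stop: "\<And>v. v \<in> D \<Longrightarrow> \<not> vtest P (g (h v))"
  shows "computable_on D h"
proof -
  from assms(1) obtain c q where "computes c q UNIV f" by (auto simp: computable_on_def)
  note c = computesD(1)[OF this] computesD(2,3)[OF this UNIV_I]
  from assms(2) obtain e r where "computes e r UNIV g" by (auto simp: computable_on_def)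
  note e = computesD(1)[OF this] computesD(2,3)[OF this UNIV_I]
  let ?P = "\<lambda>as. P (symbol_atom (as ! 1))"
  let ?body = "PSeq drop_val (PSeq c (PSeq dup e))"
  show ?thesis
  proof (rule computable_onI[of "PSeq dup (PSeq e (PSeq (PLoop ?P ?body) drop_val))" _
        "[:2:] + smult 2 p + r \<circ>\<^sub>p p + q \<circ>\<^sub>p p"])
    fix v :: "'a val" and R T :: "'a symbol list" and B
    assume v: "v \<in> D" and B: "length R + length T +
      poly ([:2:] + smult 2 p + r \<circ>\<^sub>p p + q \<circ>\<^sub>p p) (vsize v) \<le> B"
    let ?N = "poly p (vsize v)"
    have B: "length R + length T + 2 + 2 * ?N + poly r ?N + poly q ?N \<le> B"
      using B by (simp add: poly_pcompose)
    have r: "vsize (g u) < poly r ?N" "poly r (vsize u) \<le> poly r ?N" "poly q (vsize u) \<le> poly q ?N"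
      if "vsize u \<le> ?N" for u
      using e(3)[of u] poly_mono_nat[OF that, of r] poly_mono_nat[OF that, of q] by simp_all
    have test: "exec B (PSeq dup e) (tapes [] (enc u @ R) T []) (tapes [] (enc (g u) @ enc u @ R) T [])"
      if "vsize u \<le> ?N" for u
    proof (rule exec_seq)
      show "exec B dup (tapes [] (enc u @ R) T []) (tapes [] (enc u @ enc u @ R) T [])"
        using B r[OF that] that by (intro exec_dup) simp_all
      show "exec B e (tapes [] (enc u @ enc u @ R) T []) (tapes [] (enc (g u) @ enc u @ R) T [])"
        using B r[OF that] that by (intro e(2)) (simp add: vsize_def)
    qed
    have drop: "exec B drop_val (tapes [] (enc (g u) @ enc u @ R) T []) (tapes [] (enc u @ R) T [])"
      if "vsize u \<le> ?N" for u
      using B r[OF that] that by (intro exec_drop_val) (simp_all add: vsize_def)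
    have loop: "\<not> vtest P (g w) \<Longrightarrow> exec B (PSeq (PLoop ?P ?body) drop_val)
        (tapes [] (enc (g u) @ enc u @ R) T []) (tapes [] (enc w @ R) T [])"
      if "iterates f (\<lambda>u. vtest P (g u)) ?N u w" for u w
      using that
    proof (induction rule: iterates.induct)
      case (iterates_refl u)
      have "exec B (PLoop ?P ?body) (tapes [] (enc (g u) @ enc u @ R) T [])
          (tapes [] (enc (g u) @ enc u @ R) T [])"
        using iterates_refl exec_heads_below[OF drop[of u]]
        by (intro exec_done) (simp_all add: scanned_tapes vtest_def)
      then show ?case using drop[of u] iterates_refl by (blast intro: exec_seq)
    next
      case (iterates_step u w)
      then have fu: "vsize (f u) \<le> ?N" using iterates_vsize by blast
      have "exec B c (tapes [] (enc u @ R) T []) (tapes [] (enc (f u) @ R) T [])"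
        using B r[OF iterates_step.hyps(2)] by (intro c(2)) simp
      with drop[OF iterates_step.hyps(2)] test[OF fu]
      have "exec B ?body (tapes [] (enc (g u) @ enc u @ R) T [])
          (tapes [] (enc (g (f u)) @ enc (f u) @ R) T [])"
        by (blast intro: exec_seq)
      moreover from iterates_step obtain ts where
        "exec B (PLoop ?P ?body) (tapes [] (enc (g (f u)) @ enc (f u) @ R) T []) ts"
        "exec B drop_val ts (tapes [] (enc w @ R) T [])"
        by (auto elim: exec.cases)
      moreover have "?P (map scanned (tapes [] (enc (g u) @ enc u @ R) T []))"
        using iterates_step.hyps(1) by (simp add: scanned_tapes vtest_def)
      ultimately show ?case by (blast intro: exec_seq exec_loop)
    qed
    from test[of v] iterates_vsize[OF iter[OF v]] obtain ts where
      "exec B dup (tapes [] (enc v @ R) T []) ts" "exec B e ts (tapes [] (enc (g v) @ enc v @ R) T [])"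
      by (auto elim: exec.cases)
    with loop[OF iter[OF v] stop[OF v]]
    show "exec B (PSeq dup (PSeq e (PSeq (PLoop ?P ?body) drop_val)))
        (tapes [] (enc v @ R) T []) (tapes [] (enc (h v) @ R) T [])"
      by (blast intro: exec_seq)
  qed (simp add: wf_progs c e)
qed

lemmas computable_basic =
  computable_id computable_Atom computable_Pair computable_vfst computable_vsnd computable_If
  decidable_vtest decidable_not decidable_conj decidable_disj

section \<open>Folds over lists\<close>

fun vfold :: "('a val \<Rightarrow> 'a val \<Rightarrow> 'a val \<Rightarrow> 'a val) \<Rightarrow> 'a val \<Rightarrow> 'a val \<Rightarrow> 'a val \<Rightarrow> 'a val" where
  "vfold g e (Atom a) acc = acc"
| "vfold g e (Pair x xs) acc = vfold g e xs (g e x acc)"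

fun vend :: "'a val \<Rightarrow> 'a val" where
  "vend (Atom a) = Atom a"
| "vend (Pair x xs) = vend xs"

text \<open>The growth condition is additive in the accumulator; a factor could accumulate to
  exponential size. Both the number of entries and their total size are at most
  \<open>vsize xs\<close>, so all increments together are at most
  \<open>k * (vsize xs * (vsize e + 1))\<close>.\<close>

lemma computable_vfold:
  fixes E X A :: "'a val \<Rightarrow> 'a val"
  assumes g: "computable (\<lambda>u. g (vfst u) (vfst (vsnd u)) (vsnd (vsnd u)))"
    and growth: "\<And>e x acc. vsize (g e x acc) \<le> vsize acc + k * (vsize e + vsize x)"
    and args: "computable E" "computable X" "computable A"
  shows "computable (\<lambda>v. vfold g (E v) (X v) (A v))"
proof -
  let ?step = "\<lambda>s. Pair (vfst s) (Pair (vsnd (vfst (vsnd s)))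
    (g (vfst s) (vfst (vfst (vsnd s))) (vsnd (vsnd s))))"
  let ?D = "{Pair e (Pair xs acc) | e xs acc. True}"
  let ?N = "\<lambda>e xs acc. 2 + vsize e + vsize xs + vsize acc + k * (vsize xs * (vsize e + 1))"
  have iter: "iterates ?step (\<lambda>s. vtest (\<lambda>x. x = None) (vfst (vsnd s))) (?N e xs acc)
      (Pair e (Pair xs acc)) (Pair e (Pair (vend xs) (vfold g e xs acc)))" for e xs acc
  proof (induction xs arbitrary: acc)
    case (Atom a)
    show ?case unfolding vend.simps vfold.simps by (rule iterates_refl) simp
  next
    case (Pair x xs)
    let ?a = "g e x acc"
    have "k * (vsize e + vsize x) + k * (vsize xs * (vsize e + 1))
        \<le> k * (vsize (Pair x xs) * (vsize e + 1))"
      unfolding distrib_left[symmetric] by (intro mult_le_mono2) (simp add: distrib_right)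
    with growth[of e x acc] have "?N e xs ?a \<le> ?N e (Pair x xs) acc" by simp
    from iterates_mono[OF Pair.IH(2)[of ?a] this] show ?case
      by - (rule iterates_step, simp_all add: vtest_def)
  qed
  have "computable_on ?D (\<lambda>s. Pair (vfst s) (Pair (vend (vfst (vsnd s)))
      (vfold g (vfst s) (vfst (vsnd s)) (vsnd (vsnd s)))))"
  proof (rule computable_while)
    have "computable (\<lambda>s. Pair (vfst s) (Pair (vfst (vfst (vsnd s))) (vsnd (vsnd s))))"
      by (intro computable_basic)
    from computable_comp[OF g this]
    have "computable (\<lambda>s. g (vfst s) (vfst (vfst (vsnd s))) (vsnd (vsnd s)))" by simp
    then show "computable ?step" by (intro computable_basic)
    show "computable (\<lambda>s. vfst (vsnd s))" by (intro computable_basic)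
  next
    fix s :: "'a val" assume "s \<in> ?D"
    then obtain e xs acc where s: "s = Pair e (Pair xs acc)" by blast
    have "k * (vsize xs * (vsize e + 1)) \<le> k * (vsize s * (vsize s + 1))"
      by (intro mult_le_mono2 mult_le_mono) (simp_all add: s)
    then have N: "?N e xs acc \<le> poly [:0, 1 + k, k:] (vsize s)" by (simp add: s algebra_simps)
    show "iterates ?step (\<lambda>s. vtest (\<lambda>x. x = None) (vfst (vsnd s))) (poly [:0, 1 + k, k:] (vsize s))
      s (Pair (vfst s) (Pair (vend (vfst (vsnd s))) (vfold g (vfst s) (vfst (vsnd s)) (vsnd (vsnd s)))))"
      using iterates_mono[OF iter N] by (simp only: s vfst.simps vsnd.simps)
  next
    fix s :: "'a val"
    have "vhead (vend xs) \<noteq> None" for xs :: "'a val" by (induction xs) simp_all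
    then show "\<not> vtest (\<lambda>x. x = None) (vfst (vsnd (Pair (vfst s) (Pair (vend (vfst (vsnd s)))
        (vfold g (vfst s) (vfst (vsnd s)) (vsnd (vsnd s)))))))"
      by (simp add: vtest_def)
  qed
  from computable_on_comp[OF this, of UNIV "\<lambda>v. vsnd (vsnd v)"]
  have fold: "computable_on ?D (\<lambda>s. vfold g (vfst s) (vfst (vsnd s)) (vsnd (vsnd s)))"
    by (simp add: computable_basic)
  have "computable (\<lambda>v. Pair (E v) (Pair (X v) (A v)))"
    by (intro computable_basic args)
  from computable_on_comp[OF this fold] show ?thesis by simp
qed

section \<open>Deciding languages\<close>

definition vlist :: "'a \<Rightarrow> 'a val list \<Rightarrow> 'a val" where
  "vlist z xs = foldr Pair xs (Atom z)"

lemma vlist_simps [simp]: "vlist z [] = Atom z" "vlist z (x # xs) = Pair x (vlist z xs)"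
  by (simp_all add: vlist_def)

lemma vsize_vlist_atoms: "vsize (vlist z (map Atom x)) = 2 * length x + 1"
  by (induction x) simp_all

theorem PSPACE_computable:
  fixes X :: "'a::finite list set"
  assumes h: "computable_on (range (\<lambda>x. vlist z (map Atom x))) h"
    and X: "\<And>x. x \<in> X \<longleftrightarrow> vtest P (h (vlist z (map Atom x)))"
  shows "X \<in> PSPACE"
proof -
  from h obtain c q where "computes c q (range (\<lambda>x. vlist z (map Atom x))) h"
    by (auto simp: computable_on_def)
  note c = computesD(1)[OF this] computesD(2)[OF this rangeI]
  define right where "right = PAct (\<lambda>as. (stays as)[0 := (as ! 0, Move_Right :: move)] :: ('a symbol \<times> move) list)"
  define left where "left = PAct (\<lambda>as. (stays as)[0 := (as ! 0, Move_Left :: move)] :: ('a symbol \<times> move) list)"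
  define find_end where "find_end = PSeq (PLoop (\<lambda>as. as ! 0 \<noteq> Blank) right) left"
  define load where "load = PLoop (\<lambda>as :: 'a symbol list. as ! 0 \<noteq> Start)
    (PSeq (push 1 (\<lambda>as. as ! 0)) (PSeq (push 1 (\<lambda>_. Work 0)) (pop 0)))"
  let ?c = "PSeq find_end (PSeq (push 1 (\<lambda>_. Input z)) (PSeq load c))"
  \<comment> \<open>A word of length n is loaded as a list of size 2n + 1, the argument of
    \<open>q\<close>; the summand 2n + 4 covers the loading itself.\<close>
  let ?p = "[:4, 2:] + q \<circ>\<^sub>p [:1, 2:]"
  show ?thesis
  proof (rule PSPACE_exec[of 4 tape_symbols ?c ?p "\<lambda>as. P (symbol_atom (as ! 1))"])
    have "wf_prog 4 tape_symbols right" "wf_prog 4 tape_symbols left"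
      unfolding right_def left_def wf_prog.simps
      by (intro allI impI wf_act_update; auto simp: subset_iff)+
    then show "wf_prog 4 tape_symbols ?c"
      by (simp add: find_end_def load_def c(1) wf_pop wf_push_read wf_push_const Work_in_tape_symbols
        Input_in_tape_symbols)
    show "finite (tape_symbols :: 'a symbol set)" "{Blank, Start} \<union> range Input \<subseteq> (tape_symbols :: 'a symbol set)"
      by (auto simp: tape_symbols_def)
  next
    fix x :: "'a list"
    let ?B = "poly ?p (length x)" and ?i = "(start_contents x, 0) # replicate (4 - 1) (start_contents [], 0 :: nat)"
    have size: "vsize (vlist z (map Atom x)) = poly [:1, 2:] (length x)"
      by (simp add: vsize_vlist_atoms)
    have B: "2 * length x + 3 < ?B" "poly q (vsize (vlist z (map Atom x))) \<le> ?B"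
      unfolding size by (simp_all add: poly_pcompose)
    let ?t = "\<lambda>i. (start_contents x, i) # map stack [[], [], []]"
    have i: "?i = ?t 0"
      by (simp add: eval_nat_numeral stack_def start_contents_def fun_eq_iff)
    \<comment> \<open>With the head on the last input cell, the input tape already is a stack with
      the last letter on top. Popping yields the letters from right to left, the order in which a
      list is built from its end.\<close>
    have end_stack: "(start_contents x, length x) = stack (map Input (rev x))"
      by (auto simp: stack_def start_contents_def fun_eq_iff rev_map)
    have nonblank: "start_contents x j \<noteq> Blank" if "j \<le> length x" for j
      using that by (simp add: start_contents_def)
    have ok: "heads_below ?B (?t j)" if "j \<le> length x + 1" for j
      using that B by (simp add: heads_below_iff snd_stack)
    have "exec ?B (PLoop (\<lambda>as. as ! 0 \<noteq> Blank) right) (?t (length x + 1 - j)) (?t (length x + 1))"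
      if "j \<le> length x + 1" for j
      using that
    proof (induction j)
      case 0
      show ?case using ok[of "length x + 1"]
        unfolding diff_zero
        by - (rule exec_done, simp add: scanned_def start_contents_def, simp)
    next
      case (Suc j)
      let ?j = "length x - j"
      have "exec ?B right (?t ?j) (?t (Suc ?j))"
        unfolding right_def using ok[of ?j] ok[of "Suc ?j"] Suc.prems
        by (intro exec_act) (simp_all add: stays_def scanned_stack scanned_def[of "(start_contents x, _)"] stack_peek
            act_top del: peek.simps)
      moreover have "Suc ?j = length x + 1 - j" using Suc.prems by simp
      ultimately show ?case using Suc nonblank[of ?j]
        by simp (rule exec_loop, auto simp: scanned_def)
    qed
    from this[of "length x + 1"]
    have 1: "exec ?B (PLoop (\<lambda>as. as ! 0 \<noteq> Blank) right) (?t 0) (?t (length x + 1))" by simp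
    have 2: "exec ?B left (?t (length x + 1)) (?t (length x))"
      unfolding left_def using ok[of "length x"] ok[of "length x + 1"]
      by (intro exec_act) (simp_all add: stays_def scanned_stack scanned_def[of "(start_contents x, _)"]
            act_top del: peek.simps)
    have t: "?t (length x) = tapes (map Input (rev x)) [] [] []"
      unfolding end_stack by (simp add: tapes_def)
    have 3: "exec ?B (push 1 (\<lambda>_. Input z)) (tapes (map Input (rev x)) [] [] [])
        (tapes (map Input (rev x)) (enc (vlist z (map Atom []))) [] [])"
      using exec_push(2)[of ?B "map Input (rev x)" "[]" "[]" "[]" "\<lambda>_. Input z"] B
      by (simp add: below_def)
    have "length x = length y + length w \<Longrightarrow> exec ?B load (tapes (map Input w) (enc (vlist z (map Atom y))) [] [])
        (tapes [] (enc (vlist z (map Atom (rev w @ y)))) [] [])" for w y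
    proof (induction w arbitrary: y)
      case Nil
      then show ?case using B vsize_vlist_atoms[of z y] unfolding load_def
        by (auto intro!: exec_done simp: scanned_tapes heads_below_tapes below_def vsize_def)
    next
      case (Cons a w)
      let ?v = "enc (vlist z (map Atom y))"
      have small: "length (map Input (a # w)) < ?B" "Suc (Suc (length ?v)) < ?B"
        using Cons.prems B(1) vsize_vlist_atoms[of z y] by (simp_all add: vsize_def)
      have "exec ?B (push 1 (\<lambda>as. as ! 0)) (tapes (map Input (a # w)) ?v [] [])
          (tapes (map Input (a # w)) (Input a # ?v) [] [])"
        using exec_push(2)[of ?B "map Input (a # w)" ?v "[]" "[]" "\<lambda>as. as ! 0"] small
        by (simp add: below_def)
      moreover have "exec ?B (push 1 (\<lambda>_. Work 0)) (tapes (map Input (a # w)) (Input a # ?v) [] [])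
          (tapes (map Input (a # w)) (enc (vlist z (map Atom (a # y)))) [] [])"
        using exec_push(2)[of ?B "map Input (a # w)" "Input a # ?v" "[]" "[]" "\<lambda>_. Work 0"] small
        by (simp add: below_def)
      moreover have "exec ?B (pop 0) (tapes (map Input (a # w)) (enc (vlist z (map Atom (a # y)))) [] [])
          (tapes (map Input w) (enc (vlist z (map Atom (a # y)))) [] [])"
        using small unfolding list.map by (intro exec_pop) (simp add: below_def)
      moreover note Cons.IH[of "a # y"]
      ultimately show ?case using Cons.prems unfolding load_def
        by simp (rule exec_loop[OF _ exec_seq[OF _ exec_seq]], auto simp: scanned_tapes)
    qed
    from this[of "[]" "rev x"]
    have 4: "exec ?B load (tapes (map Input (rev x)) (enc (vlist z (map Atom []))) [] [])
        (tapes [] (enc (vlist z (map Atom x))) [] [])" by simp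
    have 5: "exec ?B c (tapes [] (enc (vlist z (map Atom x))) [] [])
        (tapes [] (enc (h (vlist z (map Atom x)))) [] [])"
      using c(2)[where R = "[]" and T = "[]" and B = ?B and x1 = x] B(2) by simp
    from 1 2 have "exec ?B find_end ?i (?t (length x))"
      unfolding i find_end_def by (rule exec_seq)
    with 3 4 5 have "exec ?B ?c ?i (tapes [] (enc (h (vlist z (map Atom x)))) [] [])"
      unfolding t by (blast intro: exec_seq)
    moreover have "P (symbol_atom (map scanned (tapes [] (enc (h (vlist z (map Atom x)))) [] []) ! 1)) \<longleftrightarrow> x \<in> X"
      using symbol_atom_peek[of "h (vlist z (map Atom x))" "[]"] by (simp add: X scanned_tapes vtest_def)
    ultimately show "\<exists>ts. exec ?B ?c ?i ts \<and> (P (symbol_atom (map scanned ts ! 1)) \<longleftrightarrow> x \<in> X)" by blast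
  qed simp
qed

section \<open>List functions on values\<close>

lemma vsize_ge_1: "1 \<le> vsize v"
  using vsize_pos[of v] by linarith

lemma vsize_vfst: "vsize (vfst v) \<le> vsize v"
  and vsize_vsnd: "vsize (vsnd v) \<le> vsize v"
  and vsize_vfst_vsnd: "vsize (vfst v) + vsize (vsnd v) \<le> vsize v + 1"
  by (cases v; simp)+

type_synonym 'c tval = "'c token val"

text \<open>Tokens double as tags: \<open>T_End\<close> terminates lists, \<open>T_Infinity\<close> signals failure.\<close>

abbreviation vnil :: "'c tval" where "vnil \<equiv> Atom T_End"

abbreviation vfail :: "'c tval" where "vfail \<equiv> Atom T_Infinity"

abbreviation is_tok :: "'a \<Rightarrow> 'a val \<Rightarrow> bool" where "is_tok t \<equiv> vtest (\<lambda>h. h = Some t)"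

abbreviation is_pair :: "'a val \<Rightarrow> bool" where "is_pair \<equiv> vtest (\<lambda>h. h = None)"

abbreviation vl :: "'c tval list \<Rightarrow> 'c tval" where "vl \<equiv> vlist T_End"

lemma is_tok_simps [simp]:
  "is_tok t (Atom a) \<longleftrightarrow> a = t" "\<not> is_tok t (Pair x y)" "\<not> is_pair (Atom a)" "is_pair (Pair x y)"
  by (simp_all add: vtest_def)

lemma vtest_simps [simp]: "vtest P (Atom a) \<longleftrightarrow> P (Some a)" "vtest P (Pair x y) \<longleftrightarrow> P None"
  by (simp_all add: vtest_def)

lemma vrel_Atom [simp]: "vrel P (Atom a) (Atom b) \<longleftrightarrow> P (Some a) (Some b)"
  by (simp add: vrel_def)

lemma is_pair_vl [simp]: "is_pair (vl xs) \<longleftrightarrow> xs \<noteq> []"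
  by (cases xs) simp_all

lemma vfold_vl: "vfold g e (vl xs) acc = fold (g e) xs acc"
  by (induction xs arbitrary: acc) simp_all

definition vrev_onto :: "'c tval \<Rightarrow> 'c tval \<Rightarrow> 'c tval" where
  "vrev_onto x y = vfold (\<lambda>e x acc. Pair x acc) vnil x y"

lemma vrev_onto_vl [simp]: "vrev_onto (vl xs) (vl ys) = vl (rev xs @ ys)"
  unfolding vrev_onto_def vfold_vl by (induction xs arbitrary: ys) (simp, simp flip: vlist_simps(2))

lemma vrev_vl [simp]: "vrev_onto (vl xs) vnil = vl (rev xs)"
  using vrev_onto_vl[of xs "[]"] by simp

lemma computable_vrev_onto:
  assumes "computable f" "computable g"
  shows "computable (\<lambda>v. vrev_onto (f v) (g v))"
  unfolding vrev_onto_def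
  by (rule computable_vfold[where k = 1]) (intro computable_basic assms, simp add: Suc_le_eq,
      (intro computable_basic assms)+)

text \<open>The accumulator is the part of \<open>y\<close> still to be matched. A mismatch turns it
  into \<open>vfail\<close>, which is not a pair and therefore survives all further entries.\<close>

definition vlist_eq :: "'c tval \<Rightarrow> 'c tval \<Rightarrow> bool" where
  "vlist_eq x y \<longleftrightarrow> is_tok T_End
     (vfold (\<lambda>e x acc. if is_pair acc \<and> vrel (\<lambda>a b. a = b) x (vfst acc)
        then vsnd acc else vfail) vnil x y)"

lemma vlist_eq_atoms [simp]: "vlist_eq (vl (map Atom as)) (vl (map Atom bs)) \<longleftrightarrow> as = bs"
proof -
  let ?g = "\<lambda>x acc. if is_pair acc \<and> vrel (\<lambda>a b. a = b) x (vfst acc)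
        then vsnd acc else vfail"
  have fail: "fold ?g xs vfail = vfail" for xs :: "'a tval list"
    by (induction xs) simp_all
  have "is_tok T_End (fold ?g (map Atom as) (vl (map Atom bs))) \<longleftrightarrow> as = bs"
  proof (induction as arbitrary: bs)
    case Nil
    show ?case by (cases bs) simp_all
  next
    case (Cons a as)
    show ?case using Cons[of "tl bs"] by (cases bs) (simp_all add: fail)
  qed
  then show ?thesis by (simp add: vlist_eq_def vfold_vl)
qed

lemma decidable_vlist_eq:
  fixes f g :: "'c::finite token val \<Rightarrow> 'c tval"
  assumes "computable f" "computable g"
  shows "decidable (\<lambda>v. vlist_eq (f v) (g v))"
  unfolding vlist_eq_def
  by (intro computable_basic, rule computable_vfold[where k = 1],
      (intro computable_basic decidable_vrel assms)+,
      auto intro: order_trans[OF vsize_vsnd] simp: Suc_le_eq intro!: computable_basic assms)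

definition vdrop :: "'c tval \<Rightarrow> 'c tval \<Rightarrow> 'c tval" where
  "vdrop x y = vfold (\<lambda>e x acc. vsnd acc) vnil x y"

lemma vdrop_vl [simp]: "vdrop (vl xs) (vl ys) = vl (drop (length xs) ys)"
proof (induction xs arbitrary: ys)
  case (Cons x xs)
  from Cons[of "tl ys"] Cons[of "[]"] show ?case by (cases ys) (simp_all add: vdrop_def)
qed (simp add: vdrop_def)

lemma computable_vdrop:
  assumes "computable f" "computable g"
  shows "computable (\<lambda>v. vdrop (f v) (g v))"
  unfolding vdrop_def
  by (rule computable_vfold[where k = 0]) (intro computable_basic assms, simp add: vsize_vsnd,
      (intro computable_basic assms)+)

definition vtake_rev :: "'c tval \<Rightarrow> 'c tval \<Rightarrow> 'c tval" where
  "vtake_rev n x = vsnd (vfold (\<lambda>e i acc. Pair (vsnd (vfst acc)) (Pair (vfst (vfst acc)) (vsnd acc)))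
     vnil n (Pair x vnil))"

lemma vtake_rev_vl:
  assumes "length ns \<le> length xs"
  shows "vtake_rev (vl ns) (vl xs) = vl (rev (take (length ns) xs))"
proof -
  have "length ns \<le> length xs \<Longrightarrow>
      fold (\<lambda>i acc. Pair (vsnd (vfst acc)) (Pair (vfst (vfst acc)) (vsnd acc))) ns (Pair (vl xs) (vl ys))
      = Pair (vl (drop (length ns) xs)) (vl (rev (take (length ns) xs) @ ys))" for ys
  proof (induction ns arbitrary: xs ys)
    case (Cons n ns)
    from Cons.prems obtain x xs' where "xs = x # xs'" by (cases xs) auto
    with Cons.prems Cons.IH[of xs' "x # ys"] show ?case by simp
  qed simp
  from this[OF assms, of "[]"] show ?thesis by (simp add: vtake_rev_def vfold_vl)
qed

lemma computable_vtake_rev: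
  assumes "computable f" "computable g"
  shows "computable (\<lambda>v. vtake_rev (f v) (g v))"
  unfolding vtake_rev_def
proof (intro computable_basic, rule computable_vfold[where k = 2])
  fix e x acc :: "'a tval"
  show "vsize (Pair (vsnd (vfst acc)) (Pair (vfst (vfst acc)) (vsnd acc)))
      \<le> vsize acc + 2 * (vsize e + vsize x)"
    using vsize_vfst_vsnd[of "vfst acc"] vsize_vfst_vsnd[of acc] vsize_ge_1[of e] vsize_ge_1[of x]
    by simp
qed (intro computable_basic assms)+

subsection \<open>Binary numbers\<close>

fun bits :: "nat \<Rightarrow> bool list" where
  "bits n = (if n = 0 then [] else odd n # bits (n div 2))"

declare bits.simps [simp del]

lemma bits_0 [simp]: "bits 0 = []"
  by (simp add: bits.simps)

lemma bits_pos: "n > 0 \<Longrightarrow> bits n = odd n # bits (n div 2)"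
  by (subst bits.simps) simp

lemma bits_eq_Nil [simp]: "bits n = [] \<longleftrightarrow> n = 0"
  by (cases "n = 0") (simp_all add: bits_pos)

lemma last_bits: "n > 0 \<Longrightarrow> last (bits n)"
proof (induction n rule: less_induct)
  case (less n)
  show ?case
  proof (cases "n div 2 = 0")
    case True
    with less.prems have "n = 1" by simp
    then show ?thesis by (simp add: bits_pos)
  next
    case False
    with less show ?thesis by (simp add: bits_pos[OF less.prems])
  qed
qed

lemma bits_inject [simp]: "bits m = bits n \<longleftrightarrow> m = n"
proof
  show "bits m = bits n \<Longrightarrow> m = n"
  proof (induction m arbitrary: n rule: less_induct)
    case (less m)
    show ?case
    proof (cases "m = 0 \<or> n = 0")
      case True
      with less.prems show ?thesis by (metis bits_eq_Nil)
    next
      case False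
      with less.prems have *: "odd m = odd n" "bits (m div 2) = bits (n div 2)" by (simp_all add: bits_pos)
      from False have "m div 2 < m" by simp
      from less.IH[OF this *(2)] *(1) show ?thesis by (metis div_mult_mod_eq parity_cases)
    qed
  qed
qed simp

definition vnat :: "nat \<Rightarrow> 'c tval" where
  "vnat n = vl (map Atom (map T_Bit (bits n)))"

lemma vnat_0: "vnat 0 = vnil"
  by (simp add: vnat_def)

lemma not_infinite_vnat: "\<not> is_tok T_Infinity (vnat n)"
  by (cases "n = 0") (simp_all add: vnat_def bits_pos)

lemma vlist_eq_vnat [simp]: "vlist_eq (vnat m) (vnat n) \<longleftrightarrow> m = n"
  unfolding vnat_def vlist_eq_atoms by (simp add: inj_map_eq_map[of T_Bit] inj_def)

fun venat :: "enat \<Rightarrow> 'c tval" where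
  "venat (enat n) = vnat n"
| "venat \<infinity> = vfail"

text \<open>One step of subtracting 1 from the least significant bit upwards. The first component of
  the accumulator is the borrow, the second collects the output bits in reverse.\<close>

definition vpred_step :: "'c tval \<Rightarrow> 'c tval \<Rightarrow> 'c tval \<Rightarrow> 'c tval" where
  "vpred_step e x acc =
     (if is_tok (T_Bit True) (vfst acc) then
        if is_tok (T_Bit True) x
        then Pair (Atom (T_Bit False)) (Pair (Atom (T_Bit False)) (vsnd acc))
        else Pair (vfst acc) (Pair (Atom (T_Bit True)) (vsnd acc))
      else Pair (vfst acc) (Pair x (vsnd acc)))"

lemma vpred_step_simps:
  "vpred_step e (Atom (T_Bit b)) (Pair (Atom (T_Bit True)) out) =
     Pair (Atom (T_Bit (\<not> b))) (Pair (Atom (T_Bit (\<not> b))) out)"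
  "vpred_step e x (Pair (Atom (T_Bit False)) out) = Pair (Atom (T_Bit False)) (Pair x out)"
  by (simp_all add: vpred_step_def)

definition vstrip :: "'c tval \<Rightarrow> 'c tval" where
  "vstrip x = (if is_tok (T_Bit False) (vfst x) then vsnd x else x)"

definition vpred :: "'c tval \<Rightarrow> 'c tval" where
  "vpred n = vrev_onto (vstrip
     (vsnd (vfold vpred_step vnil n (Pair (Atom (T_Bit True)) vnil)))) vnil"

definition vepred :: "'c tval \<Rightarrow> 'c tval" where
  "vepred n = (if is_tok T_Infinity n then n else vpred n)"

lemma vpred_vnat:
  assumes "n > 0"
  shows "vpred (vnat n) = (vnat (n - 1) :: 'c tval)"
proof -
  let ?b = "\<lambda>bs. vl (map Atom (map T_Bit bs)) :: 'c tval"
  have copy: "fold (vpred_step vnil) (map Atom (map T_Bit bs)) (Pair (Atom (T_Bit False)) (?b out))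
      = Pair (Atom (T_Bit False)) (?b (rev bs @ out))" for bs out
  proof (induction bs arbitrary: out)
    case (Cons b bs)
    from Cons[of "b # out"] show ?case by (simp add: vpred_step_simps)
  qed simp
  have "\<exists>c bs. fold (vpred_step vnil) (map Atom (map T_Bit (bits n))) (Pair (Atom (T_Bit True)) (?b out))
      = Pair c (?b (rev bs @ out)) \<and> (bs = bits (n - 1) \<and> bs \<noteq> [] \<and> last bs \<or> bs = bits (n - 1) @ [False])"
    for out using assms
  proof (induction n arbitrary: out rule: less_induct)
    case (less n)
    show ?case
    proof (cases "odd n")
      case True
      have "n - 1 = 0 \<or> bits (n - 1) = False # bits (n div 2) \<and> n div 2 > 0"
        using True by (cases "n = 1") (auto simp: bits_pos elim!: oddE)
      then have "False # bits (n div 2) = bits (n - 1) \<and> last (False # bits (n div 2)) \<or>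
          False # bits (n div 2) = bits (n - 1) @ [False]"
        using True last_bits[of "n div 2"] by (auto elim!: oddE)
      moreover have "fold (vpred_step vnil) (map Atom (map T_Bit (bits n))) (Pair (Atom (T_Bit True)) (?b out))
          = Pair (Atom (T_Bit False)) (?b (rev (False # bits (n div 2)) @ out))"
        using True copy[of "bits (n div 2)" "False # out"] less.prems
        by (simp add: bits_pos vpred_step_simps)
      ultimately show ?thesis by blast
    next
      case False
      then have n: "n div 2 < n" "0 < n div 2" "n - 1 > 0" "odd (n - 1)" "(n - 1) div 2 = n div 2 - 1"
        using less.prems by (auto elim!: evenE)
      from less.IH[OF n(1,2), of "True # out"] obtain c bs where
        "fold (vpred_step vnil) (map Atom (map T_Bit (bits (n div 2)))) (Pair (Atom (T_Bit True)) (?b (True # out)))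
          = Pair c (?b (rev bs @ True # out))"
        "bs = bits (n div 2 - 1) \<and> bs \<noteq> [] \<and> last bs \<or> bs = bits (n div 2 - 1) @ [False]" by blast
      moreover have "bits (n - 1) = True # bits (n div 2 - 1)"
        using n bits_pos[of "n - 1"] by simp
      moreover have "bits n = False # bits (n div 2)" using False less.prems by (simp add: bits_pos)
      ultimately show ?thesis
        by (intro exI[of _ c] exI[of _ "True # bs"]) (auto simp: vpred_step_simps)
    qed
  qed
  from this[of "[]"] obtain c bs where f:
    "fold (vpred_step vnil) (map Atom (map T_Bit (bits n))) (Pair (Atom (T_Bit True)) vnil)
      = Pair c (?b (rev bs))"
    and bs: "bs = bits (n - 1) \<and> bs \<noteq> [] \<and> last bs \<or> bs = bits (n - 1) @ [False]" by auto
  have "vstrip (?b (rev bs)) = ?b (rev (bits (n - 1)))"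
  proof (cases "bs = bits (n - 1) @ [False]")
    case False
    with bs have *: "bs = bits (n - 1)" "bs \<noteq> []" "last bs" by auto
    from append_butlast_last_id[OF *(2)] *(3) have "bs = butlast bs @ [True]" by simp
    then have "rev bs = True # rev (butlast bs)" by (metis rev.simps(2) rev_rev_ident)
    then have "vfst (?b (rev bs)) = Atom (T_Bit True)" by (simp only: list.map vlist_simps vfst.simps)
    then have "vstrip (?b (rev bs)) = ?b (rev bs)" by (simp only: vstrip_def is_tok_simps) simp
    with *(1) show ?thesis by simp
  qed (simp add: vstrip_def)
  then show ?thesis unfolding vpred_def vnat_def vfold_vl f vsnd.simps by (simp add: rev_map)
qed

lemma vepred_venat: "D \<noteq> 0 \<Longrightarrow> vepred (venat D) = venat (D - 1)"
proof (cases D)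
  case (enat n)
  moreover assume "D \<noteq> 0"
  ultimately have "n > 0" by (auto simp: zero_enat_def)
  then show ?thesis by (simp add: enat vepred_def vpred_vnat one_enat_def not_infinite_vnat)
qed (simp add: vepred_def)

lemma computable_vepred: "computable f \<Longrightarrow> computable (\<lambda>v. vepred (f v))"
proof -
  have step: "computable (\<lambda>u. vpred_step (vfst u) (vfst (vsnd u)) (vsnd (vsnd u)))"
    unfolding vpred_step_def by (intro computable_basic)
  have growth: "vsize (vpred_step e x acc) \<le> vsize acc + 2 * (vsize e + vsize x)" for e x acc
    using vsize_vfst_vsnd[of acc] vsize_ge_1[of e] vsize_ge_1[of x] vsize_vsnd[of acc]
    by (auto simp: vpred_step_def)
  have strip: "computable (\<lambda>v. vstrip (f v))" if "computable f" for f
    unfolding vstrip_def by (intro computable_basic that)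
  show "computable f \<Longrightarrow> computable (\<lambda>v. vepred (f v))"
    unfolding vepred_def vpred_def
    by (intro computable_basic computable_vrev_onto strip computable_vfold[OF step growth])
qed

subsection \<open>Positions as zippers\<close>

definition letters :: "'c list \<Rightarrow> 'c tval" where
  "letters xs = vl (map Atom (map T_Letter xs))"

definition vpre :: "'c list \<Rightarrow> nat \<Rightarrow> 'c tval" where
  "vpre s p = letters (rev (take p s))"

text \<open>Both neighbours of the position are at the front of a list, so moving in either
  direction is local. The reversed prefix is also a unary notation for \<open>p\<close>, which is
  why checks and opened groups store just \<open>vpre\<close>.\<close>

definition vpos :: "'c list \<Rightarrow> nat \<Rightarrow> 'c tval" where
  "vpos s p = Pair (vpre s p) (letters (drop p s))"

lemma letters_simps [simp]: "letters [] = vnil" "letters (x # xs) = Pair (Atom (T_Letter x)) (letters xs)"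
  by (simp_all add: letters_def)

lemma vdrop_letters: "vdrop (letters xs) (letters ys) = letters (drop (length xs) ys)"
  by (simp add: letters_def drop_map)

lemma vtake_rev_letters:
  "length ns \<le> length xs \<Longrightarrow> vtake_rev (letters ns) (letters xs) = letters (rev (take (length ns) xs))"
  unfolding letters_def by (subst vtake_rev_vl) (simp_all add: rev_map take_map)

lemma vrev_letters: "vrev_onto (letters xs) vnil = letters (rev xs)"
  by (simp add: letters_def rev_map)

lemma is_pair_letters [simp]: "is_pair (letters xs) \<longleftrightarrow> xs \<noteq> []"
  by (simp add: letters_def)

lemma vsize_letters: "vsize (letters xs) = 2 * length xs + 1"
  by (induction xs) simp_all

definition vlonger :: "'c tval \<Rightarrow> 'c tval \<Rightarrow> bool" where
  "vlonger x y \<longleftrightarrow> is_pair (vdrop y x)"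

lemma vlonger_vpre: "a \<le> length s \<Longrightarrow> p \<le> length s \<Longrightarrow> vlonger (vpre s a) (vpre s p) \<longleftrightarrow> p < a"
  by (simp add: vlonger_def vpre_def vdrop_letters not_le)

lemma decidable_vlonger:
  "computable f \<Longrightarrow> computable g \<Longrightarrow> decidable (\<lambda>v. vlonger (f v) (g v))"
  unfolding vlonger_def by (intro computable_basic computable_vdrop)

definition vcapture :: "'c tval \<Rightarrow> 'c tval \<Rightarrow> 'c tval" where
  "vcapture x y = (if vlonger y x then vtake_rev (vdrop x y) y else vtake_rev (vdrop y x) x)"

lemma computable_vcapture:
  assumes "computable f" "computable g"
  shows "computable (\<lambda>v. vcapture (f v) (g v))"
  unfolding vcapture_def
  by (intro computable_basic computable_vtake_rev computable_vdrop decidable_vlonger assms)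

lemma vcapture_vpre_le:
  assumes "a \<le> p" "p \<le> length s"
  shows "vtake_rev (vdrop (vpre s a) (vpre s p)) (vpre s p) = letters (take (p - a) (drop a s))"
  using assms by (simp add: vpre_def vdrop_letters vtake_rev_letters min_def take_rev drop_take)

lemma vcapture_vpre:
  "a \<le> length s \<Longrightarrow> p \<le> length s \<Longrightarrow>
   vcapture (vpre s a) (vpre s p) = letters (take (max a p - min a p) (drop (min a p) s))"
  by (cases "a < p") (simp_all add: vcapture_def vlonger_vpre vcapture_vpre_le min_def max_def)

text \<open>The ends of the string take care of themselves: there \<open>vfst\<close> yields
  \<open>T_End\<close>, which neither \<open>char_rel\<close> nor \<open>letter_rel\<close> accepts
  as its second argument. For the same reason \<open>vfail\<close> is mapped to
  \<open>vfail\<close>.\<close>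

definition vadvance ::
    "('c token option \<Rightarrow> 'c token option \<Rightarrow> bool) \<Rightarrow> 'c tval \<Rightarrow> 'c tval \<Rightarrow> 'c tval" where
  "vadvance R x pos = (if vrel R x (vfst (vsnd pos))
     then Pair (Pair (vfst (vsnd pos)) (vfst pos)) (vsnd (vsnd pos)) else vfail)"

text \<open>Reading backwards is reading forwards in the mirrored zipper, with words reversed. The
  test for a pair lets a failure pass unchanged.\<close>

definition vswap :: "'c tval \<Rightarrow> 'c tval" where
  "vswap pos = (if is_pair pos then Pair (vsnd pos) (vfst pos) else pos)"

definition char_rel :: "'c token option \<Rightarrow> 'c token option \<Rightarrow> bool" where
  "char_rel x y \<longleftrightarrow> (\<exists>cd c. x = Some (T_Chars cd) \<and> y = Some (T_Letter c) \<and> c \<in> cd)"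

definition letter_rel :: "'c token option \<Rightarrow> 'c token option \<Rightarrow> bool" where
  "letter_rel x y \<longleftrightarrow> (\<exists>c. x = Some (T_Letter c) \<and> y = x)"

lemma letter_rel_letter [simp]: "letter_rel (Some (T_Letter c)) y \<longleftrightarrow> y = Some (T_Letter c)"
  by (auto simp: letter_rel_def)

definition vread_char :: "'c tval \<Rightarrow> 'c tval \<Rightarrow> 'c tval \<Rightarrow> 'c tval" where
  "vread_char x d pos = (if is_tok (T_Bit True) d then vadvance char_rel x pos
     else vswap (vadvance char_rel x (vswap pos)))"

definition vread_word :: "'c tval \<Rightarrow> 'c tval \<Rightarrow> 'c tval \<Rightarrow> 'c tval" where
  "vread_word w d pos = (if is_tok (T_Bit True) d then vfold (\<lambda>e. vadvance letter_rel) vnil w pos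
     else vswap (vfold (\<lambda>e. vadvance letter_rel) vnil (vrev_onto w vnil) (vswap pos)))"

lemma computable_vadvance:
  fixes f g :: "'c::finite token val \<Rightarrow> 'c tval"
  assumes "computable f" "computable g"
  shows "computable (\<lambda>v. vadvance R (f v) (g v))"
  unfolding vadvance_def by (intro computable_basic decidable_vrel assms)

lemma computable_vswap: "computable f \<Longrightarrow> computable (\<lambda>v. vswap (f v))"
  unfolding vswap_def by (intro computable_basic)

lemma vsize_vadvance: "vsize (vadvance R x pos) \<le> vsize pos + 4"
  using vsize_vfst_vsnd[of pos] vsize_vfst_vsnd[of "vsnd pos"] vsize_ge_1[of pos]
  by (simp add: vadvance_def)

lemma computable_vread_char:
  fixes f g h :: "'c::finite token val \<Rightarrow> 'c tval"
  assumes "computable f" "computable g" "computable h"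
  shows "computable (\<lambda>v. vread_char (f v) (g v) (h v))"
  unfolding vread_char_def by (intro computable_basic computable_vadvance computable_vswap assms)

lemma computable_vread_word:
  fixes f g h :: "'c::finite token val \<Rightarrow> 'c tval"
  assumes "computable f" "computable g" "computable h"
  shows "computable (\<lambda>v. vread_word (f v) (g v) (h v))"
proof -
  have "computable (\<lambda>v. vfold (\<lambda>e. vadvance letter_rel) (E v) (X v) (A v))"
    if "computable E" "computable X" "computable A" for E X A :: "'c tval \<Rightarrow> 'c tval"
  proof (rule computable_vfold[where k = 4, OF _ _ that])
    show "vsize (vadvance letter_rel x acc) \<le> vsize acc + 4 * (vsize e + vsize x)"
      for e x acc :: "'c tval"
      using vsize_vadvance[of letter_rel x acc] vsize_ge_1[of e] by simp
  qed (intro computable_basic computable_vadvance)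
  note fold = this
  show ?thesis unfolding vread_word_def
    by (intro computable_basic computable_vswap computable_vrev_onto fold assms)
qed

fun vdir :: "dir \<Rightarrow> 'c tval" where
  "vdir Forward = Atom (T_Bit True)"
| "vdir Backward = Atom (T_Bit False)"

lemma vadvance_letters:
  "vadvance R (Atom t) (Pair (letters b) (letters a)) =
     (case a of [] \<Rightarrow> if R (Some t) (Some T_End) then Pair (Pair vnil (letters b)) vnil else vfail
      | c # a' \<Rightarrow> if R (Some t) (Some (T_Letter c)) then Pair (letters (c # b)) (letters a') else vfail)"
  by (cases a) (simp_all add: vadvance_def)

lemma vread_char_vpos:
  assumes "p \<le> length s"
  shows "vread_char (Atom (T_Chars cd)) (vdir d) (vpos s p) =
    (case read_char s cd p d of None \<Rightarrow> vfail | Some p' \<Rightarrow> vpos s p')"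
proof (cases d)
  case Forward
  show ?thesis
  proof (cases "p < length s")
    case True
    then have "drop p s = s ! p # drop (Suc p) s" by (simp add: Cons_nth_drop_Suc)
    then show ?thesis using True
      by (simp add: Forward vread_char_def vpos_def vpre_def vadvance_def char_rel_def
          take_Suc_conv_app_nth)
  qed (use assms in \<open>simp add: Forward vread_char_def vpos_def vpre_def vadvance_def char_rel_def\<close>)
next
  case Backward
  show ?thesis
  proof (cases p)
    case (Suc q)
    then have "rev (take p s) = s ! q # rev (take q s)" "drop q s = s ! q # drop p s"
      using assms by (simp_all add: take_Suc_conv_app_nth Cons_nth_drop_Suc)
    then show ?thesis using Suc
      by (simp add: Backward vread_char_def vpos_def vpre_def vadvance_def char_rel_def vswap_def)
  qed (simp add: Backward vread_char_def vpos_def vpre_def vadvance_def char_rel_def vswap_def)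
qed

lemma fold_vadvance:
  "vfold (\<lambda>e. vadvance letter_rel) e (letters w) (Pair (letters b) (letters a)) =
     (if take (length w) a = w then Pair (letters (rev w @ b)) (letters (drop (length w) a)) else vfail)"
proof -
  have fail: "vfold (\<lambda>e. vadvance letter_rel) e (letters w) vfail = vfail" for w :: "'a list"
    by (induction w) (simp_all add: vadvance_def letter_rel_def)
  show ?thesis
  proof (induction w arbitrary: a b)
    case (Cons x w)
    show ?case
    proof (cases a)
      case Nil
      show ?thesis unfolding letters_simps vfold.simps vadvance_letters by (simp add: Nil fail)
    next
      case (Cons c a')
      with Cons.IH[of "c # b" a'] show ?thesis
        unfolding letters_simps vfold.simps vadvance_letters by (cases "c = x") (auto simp: fail)
    qed
  qed simp
qed

lemma vread_word_vpos:
  assumes "p \<le> length s"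
  shows "vread_word (letters w) (vdir d) (vpos s p) =
    (case read_word s w p d of None \<Rightarrow> vfail | Some p' \<Rightarrow> vpos s p')"
proof (cases d)
  case Forward
  show ?thesis
  proof (cases "take (length w) (drop p s) = w")
    case True
    then have "take (p + length w) s = take p s @ w" by (simp add: take_add)
    with True show ?thesis
      by (simp add: Forward vread_word_def vpos_def vpre_def fold_vadvance add.commute)
  qed (simp add: Forward vread_word_def vpos_def vpre_def fold_vadvance)
next
  case Backward
  have iff: "take (length w) (rev (take p s)) = rev w \<longleftrightarrow>
      length w \<le> p \<and> take (length w) (drop (p - length w) s) = w" (is "?l \<longleftrightarrow> ?r")
  proof (cases "length w \<le> p")
    case True
    then have "take (length w) (rev (take p s)) = rev (take (length w) (drop (p - length w) s))"
      using assms by (simp add: take_rev drop_take min_def)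
    with True show ?thesis by simp
  next
    case False
    then have "length (take (length w) (rev (take p s))) < length (rev w)" by simp
    with False show ?thesis by force
  qed
  have swap: "vswap (vpos s p) = Pair (letters (drop p s)) (letters (rev (take p s)))"
    by (simp add: vswap_def vpos_def vpre_def)
  show ?thesis
  proof (cases ?r)
    case True
    then have "drop (p - length w) s = w @ drop p s"
      by (metis add.commute append_take_drop_id drop_drop le_add_diff_inverse2)
    moreover have "drop (length w) (rev (take p s)) = rev (take (p - length w) s)"
      using assms by (simp add: drop_rev min_def)
    ultimately show ?thesis using True iff
      by (simp add: Backward vread_word_def swap vrev_letters fold_vadvance)
        (simp add: vswap_def vpos_def vpre_def)
  next
    case False
    with iff have "take (length w) (rev (take p s)) \<noteq> rev w" "read_word s w p d = None"
      by (simp_all add: Backward)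
    then show ?thesis
      by (simp add: Backward vread_word_def swap vrev_letters fold_vadvance) (simp add: vswap_def)
  qed
qed

subsection \<open>Group maps as association lists\<close>

text \<open>A closed group is stored as the captured word, which is all that a backreference reads.
  Its range is never represented; the word is cut out when the group is closed.\<close>

fun vgroup :: "'c list \<Rightarrow> group_state \<Rightarrow> 'c tval" where
  "vgroup s Undefined = vnil"
| "vgroup s (Opened a) = Pair (Atom T_Group) (vpre s a)"
| "vgroup s (Closed a b) = Pair (Atom T_Backref) (letters (take (b - a) (drop a s)))"

type_synonym group_list = "(nat \<times> group_state) list"

definition glookup :: "group_list \<Rightarrow> group_map" where
  "glookup gl g = (case map_of gl g of None \<Rightarrow> Undefined | Some st \<Rightarrow> st)"

text \<open>The reversal copies the effect of a fold, so that \<open>vremove\<close> corresponds to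
  it exactly and not merely up to the order of the entries.\<close>

definition gremove :: "nat \<Rightarrow> group_list \<Rightarrow> group_list" where
  "gremove g gl = rev (filter (\<lambda>x. fst x \<noteq> g) gl)"

definition vgmap :: "'c list \<Rightarrow> group_list \<Rightarrow> 'c tval" where
  "vgmap s gl = vl (map (\<lambda>(g, st). Pair (vnat g) (vgroup s st)) gl)"

definition vremove :: "'c tval \<Rightarrow> 'c tval \<Rightarrow> 'c tval" where
  "vremove key gl = vfold (\<lambda>e x acc. if vlist_eq (vfst x) e then acc else Pair x acc) key gl vnil"

definition vlookup :: "'c tval \<Rightarrow> 'c tval \<Rightarrow> 'c tval" where
  "vlookup key gl = vfold (\<lambda>e x acc. if vlist_eq (vfst x) e then vsnd x else acc) key gl vnil"

lemma vremove_vgmap: "vremove (vnat g) (vgmap s gl) = vgmap s (gremove g gl)"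
proof -
  have "fold (\<lambda>x acc. if vlist_eq (vfst x) (vnat g) then acc else Pair x acc)
      (map (\<lambda>(g, st). Pair (vnat g) (vgroup s st)) gl) (vl ys) =
    vl (rev (map (\<lambda>(g, st). Pair (vnat g) (vgroup s st)) (filter (\<lambda>x. fst x \<noteq> g) gl)) @ ys)" for ys
  proof (induction gl arbitrary: ys)
    case (Cons x gl)
    show ?case
      using Cons[of ys] Cons[of "Pair (vnat (fst x)) (vgroup s (snd x)) # ys"] by (cases x) simp
  qed simp
  from this[of "[]"] show ?thesis by (simp add: vremove_def vgmap_def gremove_def vfold_vl rev_map)
qed

text \<open>The fold keeps the last entry for a key while \<open>map_of\<close> takes the first;
  distinct keys make the two agree.\<close>

lemma vlookup_vgmap:
  assumes "distinct (map fst gl)"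
  shows "vlookup (vnat g) (vgmap s gl) = vgroup s (glookup gl g)"
proof -
  have "fold (\<lambda>x acc. if vlist_eq (vfst x) (vnat g) then vsnd x else acc)
      (map (\<lambda>(g, st). Pair (vnat g) (vgroup s st)) gl) y =
    (case map_of gl g of None \<Rightarrow> y | Some st \<Rightarrow> vgroup s st)" for y
    using assms
  proof (induction gl arbitrary: y)
    case (Cons x gl)
    have "map_of gl (fst x) = None" using Cons.prems by (simp add: map_of_eq_None_iff)
    then show ?case using Cons by (cases x) auto
  qed simp
  from this[of vnil] show ?thesis
    by (simp add: vlookup_def vgmap_def vfold_vl glookup_def split: option.split)
qed

lemma computable_vremove:
  fixes f g :: "'c::finite token val \<Rightarrow> 'c tval"
  assumes "computable f" "computable g"
  shows "computable (\<lambda>v. vremove (f v) (g v))"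
  unfolding vremove_def
  by (rule computable_vfold[where k = 1], (intro computable_basic decidable_vlist_eq)[1],
    simp add: Suc_le_eq, (intro computable_basic assms)+)

lemma computable_vlookup:
  fixes f g :: "'c::finite token val \<Rightarrow> 'c tval"
  assumes "computable f" "computable g"
  shows "computable (\<lambda>v. vlookup (f v) (g v))"
  unfolding vlookup_def
proof (rule computable_vfold[where k = 1])
  show "vsize (if vlist_eq (vfst x) e then vsnd x else acc) \<le> vsize acc + 1 * (vsize e + vsize x)"
    for e x acc :: "'c tval"
    using vsize_vsnd[of x] by simp
qed (intro computable_basic decidable_vlist_eq assms)+

lemma vsize_vremove: "vsize (vremove k g) \<le> vsize g"
proof -
  have "vsize (vfold (\<lambda>e x acc. if vlist_eq (vfst x) e then acc else Pair x acc) k g acc) + 1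
      \<le> vsize g + vsize acc" for acc
  proof (induction g arbitrary: acc)
    case (Pair x g)
    from Pair.IH(2)[of acc] Pair.IH(2)[of "Pair x acc"] show ?case by auto
  qed simp
  from this[of vnil] show ?thesis by (simp add: vremove_def)
qed

lemma gremove_keys: "fst ` set (gremove g gl) = fst ` set gl - {g}"
  by (auto simp: gremove_def)

lemma distinct_gremove: "distinct (map fst gl) \<Longrightarrow> distinct (map fst (gremove g gl))"
  by (simp add: gremove_def rev_map[symmetric] distinct_map_filter)

lemma set_gremove: "set (gremove g gl) \<subseteq> set gl"
  by (auto simp: gremove_def)

lemma glookup_gremove:
  assumes "distinct (map fst gl)"
  shows "glookup (gremove g gl) = (glookup gl)(g := Undefined)"
proof
  fix h
  have "map_of (gremove g gl) h = (if h = g then None else map_of gl h)"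
  proof (cases "h = g")
    case True
    then show ?thesis by (simp add: map_of_eq_None_iff gremove_keys)
  next
    case False
    have "map_of (gremove g gl) = map_of (filter (\<lambda>x. fst x \<noteq> g) gl)"
      using assms distinct_gremove[OF assms, of g]
      by (subst map_of_inject_set) (auto simp: gremove_def distinct_map_filter)
    moreover have "map_of (filter (\<lambda>x. fst x \<noteq> g) gl) h = map_of gl h"
      using False by (induction gl) auto
    ultimately show ?thesis using False by simp
  qed
  then show "glookup (gremove g gl) h = ((glookup gl)(g := Undefined)) h"
    by (simp add: glookup_def)
qed

lemma glookup_Cons: "glookup ((g, st) # gl) = (glookup gl)(g := st)"
  by (auto simp: glookup_def)

subsection \<open>Syntax trees\<close>

text \<open>The lower bound of a quantifier leaves no trace in the value: the parser lets only zero
  pass. The counter \<open>D\<close> stays binary and is decremented by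
  \<open>vepred\<close>.\<close>

primrec vregex :: "'c regex \<Rightarrow> 'c tval" where
  "vregex Epsilon = Pair (Atom T_Epsilon) vnil"
| "vregex (Chars cd) = Pair (Atom (T_Chars cd)) vnil"
| "vregex (Disj r1 r2) = Pair (Atom T_Disj) (Pair (vregex r1) (vregex r2))"
| "vregex (Sequence r1 r2) = Pair (Atom T_Sequence) (Pair (vregex r1) (vregex r2))"
| "vregex (Group g r) = Pair (Atom T_Group) (Pair (vnat g) (vregex r))"
| "vregex (Backref g) = Pair (Atom T_Backref) (vnat g)"
| "vregex (Quant r m D greedy) = Pair (Atom (T_Quant greedy)) (Pair (venat D) (vregex r))"
| "vregex (Look k r) = Pair (Atom (T_Look k)) (vregex r)"
| "vregex (Anchor a) = Pair (Atom (T_Anchor a)) vnil"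

lemma size_vsnd [termination_simp]: "size (vsnd y) < Suc (n + size y)"
  by (cases y) simp_all

text \<open>A traversal that ignores the syntax is enough. In the value of a regex,
  \<open>T_Group\<close> is the left component of a pair only at a capture group, since bit lists,
  counters and subtrees never equal this atom.\<close>

fun vids :: "'c tval \<Rightarrow> 'c tval list" where
  "vids (Atom a) = []"
| "vids (Pair x y) = (if is_tok T_Group x then vfst y # vids (vsnd y) else vids x @ vids y)"

lemma vids_vnat [simp]: "vids (vnat n) = []"
proof -
  have "vids (vl (map Atom (map T_Bit bs))) = []" for bs by (induction bs) simp_all
  then show ?thesis by (simp add: vnat_def)
qed

lemma is_tok_vnat: "t \<noteq> T_End \<Longrightarrow> \<not> is_tok t (vnat n)"
  by (cases "n = 0") (simp_all add: vnat_def bits_pos)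

lemma is_tok_vregex [simp]: "\<not> is_tok t (vregex r)"
  by (cases r) simp_all

lemma vids_vregex: "vids (vregex r) = map vnat (group_ids r)"
proof (induction r)
  case (Quant r m D greedy)
  then show ?case by (cases D) (simp_all add: is_tok_vnat)
qed simp_all

definition vids_step :: "'c tval \<Rightarrow> 'c tval" where
  "vids_step s =
     (if is_pair (vfst (vfst s)) then
        if is_tok T_Group (vfst (vfst (vfst s)))
        then Pair (Pair (vsnd (vsnd (vfst (vfst s)))) (vsnd (vfst s)))
               (Pair (vfst (vsnd (vfst (vfst s)))) (vsnd s))
        else Pair (Pair (vfst (vfst (vfst s))) (Pair (vsnd (vfst (vfst s))) (vsnd (vfst s)))) (vsnd s)
      else Pair (vsnd (vfst s)) (vsnd s))"

lemma vids_step_simps: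
  "vids_step (Pair (Pair (Atom a) xs) acc) = Pair xs acc"
  "is_tok T_Group x \<Longrightarrow>
     vids_step (Pair (Pair (Pair x y) xs) acc) = Pair (Pair (vsnd y) xs) (Pair (vfst y) acc)"
  "\<not> is_tok T_Group x \<Longrightarrow>
     vids_step (Pair (Pair (Pair x y) xs) acc) = Pair (Pair x (Pair y xs)) acc"
  by (simp_all add: vids_step_def)

fun vids_list :: "'c tval \<Rightarrow> 'c tval \<Rightarrow> 'c tval" where
  "vids_list (Atom a) acc = acc"
| "vids_list (Pair x xs) acc = vids_list xs (fold Pair (vids x) acc)"

lemma vsize_fold_vids: "vsize (fold Pair (vids x) acc) \<le> vsize x + vsize acc"
proof (induction x arbitrary: acc rule: vids.induct)
  case (2 x y)
  show ?case
  proof (cases "is_tok T_Group x")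
    case True
    with 2(1)[OF True, of "Pair (vfst y) acc"] vsize_vfst_vsnd[of y] vsize_ge_1[of x] show ?thesis by simp
  next
    case False
    from 2(2)[OF False, of acc] 2(3)[OF False, of "fold Pair (vids x) acc"] False show ?thesis by simp
  qed
qed simp

text \<open>The worklist replaces a tree by its two children, which does not change the total number
  of nodes, and an extracted identifier merely moves to the accumulator. Hence no intermediate state
  exceeds the size of the first.\<close>

lemma iterates_vids:
  "vsize (Pair (Pair x xs) acc) \<le> N \<Longrightarrow>
   iterates vids_step (\<lambda>s. is_pair (vfst s)) N (Pair (Pair x xs) acc) (Pair xs (fold Pair (vids x) acc))"
proof (induction x arbitrary: xs acc rule: vids.induct)
  case (1 a)
  then show ?case by - (rule iterates_step, simp_all add: vids_step_simps, rule iterates_refl, simp)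
next
  case (2 x y)
  show ?case
  proof (cases "is_tok T_Group x")
    case True
    have "vsize (Pair (Pair (vsnd y) xs) (Pair (vfst y) acc)) \<le> N"
      using 2(4) vsize_vfst_vsnd[of y] vsize_ge_1[of x] by simp
    from 2(1)[OF True this] 2(4) show ?thesis
      by - (rule iterates_step, simp_all add: vids_step_simps True)
  next
    case False
    have "vsize (Pair (Pair x (Pair y xs)) acc) \<le> N" using 2(4) by simp
    moreover have "vsize (Pair (Pair y xs) (fold Pair (vids x) acc)) \<le> N"
      using 2(4) vsize_fold_vids[of x acc] by simp
    ultimately have "iterates vids_step (\<lambda>s. is_pair (vfst s)) N (Pair (Pair x (Pair y xs)) acc)
        (Pair xs (fold Pair (vids y) (fold Pair (vids x) acc)))"
      by (rule iterates_trans[OF 2(2)[OF False] 2(3)[OF False]])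
    with 2(4) show ?thesis by - (rule iterates_step, simp_all add: vids_step_simps False)
  qed
qed

lemma iterates_vids_list:
  "vsize (Pair xs acc) \<le> N \<Longrightarrow>
   iterates vids_step (\<lambda>s. is_pair (vfst s)) N (Pair xs acc) (Pair (vend xs) (vids_list xs acc))"
proof (induction xs arbitrary: acc)
  case (Atom a)
  then show ?case unfolding vend.simps vids_list.simps by (rule iterates_refl)
next
  case (Pair x xs)
  have "vsize (Pair xs (fold Pair (vids x) acc)) \<le> N"
    using Pair.prems vsize_fold_vids[of x acc] by simp
  from iterates_trans[OF iterates_vids[OF Pair.prems] Pair.IH(2)[OF this]] show ?case by simp
qed

definition vgroup_ids :: "'c tval \<Rightarrow> 'c tval" where
  "vgroup_ids r = fold Pair (vids r) vnil"

lemma vgroup_ids_vregex: "vgroup_ids (vregex r) = vl (rev (map vnat (group_ids r)))"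
proof -
  have "fold Pair xs (vl ys) = vl (rev xs @ ys)" for xs ys :: "'a tval list"
    by (induction xs arbitrary: ys) (simp, simp flip: vlist_simps(2))
  from this[of _ "[]"] show ?thesis by (simp add: vgroup_ids_def vids_vregex)
qed

lemma not_is_pair_vend: "\<not> is_pair (vend x)"
  by (induction x) simp_all

lemma computable_vgroup_ids:
  fixes f :: "'c tval \<Rightarrow> 'c tval"
  assumes "computable f"
  shows "computable (\<lambda>v. vgroup_ids (f v))"
proof -
  have "computable_on {Pair xs acc | xs acc. True} (\<lambda>s :: 'c tval. Pair (vend (vfst s)) (vids_list (vfst s) (vsnd s)))"
  proof (rule computable_while)
    show "computable vids_step"
      unfolding vids_step_def by (intro computable_basic)
    show "computable vfst" by (rule computable_vfst_id)
  next
    fix s :: "'c tval" assume "s \<in> {Pair xs acc | xs acc. True}"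
    then obtain xs acc where s: "s = Pair xs acc" by blast
    show "iterates vids_step (\<lambda>s. is_pair (vfst s)) (poly [:0, 1:] (vsize s)) s
        (Pair (vend (vfst s)) (vids_list (vfst s) (vsnd s)))"
      unfolding s vfst.simps vsnd.simps by (rule iterates_vids_list) simp
  qed (simp add: not_is_pair_vend)
  from computable_on_comp[OF this computable_vsnd_id]
  have *: "computable_on {Pair xs acc | xs acc. True} (\<lambda>s :: 'c tval. vids_list (vfst s) (vsnd s))"
    by simp
  have "computable (\<lambda>v. Pair (Pair (f v) vnil) vnil)"
    by (intro computable_basic assms)
  from computable_on_comp[OF this *] show ?thesis by (simp add: vgroup_ids_def)
qed

definition vreset :: "'c tval \<Rightarrow> 'c tval \<Rightarrow> 'c tval" where
  "vreset r g = vfold (\<lambda>e. vremove) vnil (vgroup_ids r) g"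

definition greset :: "'c regex \<Rightarrow> group_list \<Rightarrow> group_list" where
  "greset r gl = fold gremove (rev (group_ids r)) gl"

lemma vreset_vgmap: "vreset (vregex r) (vgmap s gl) = vgmap s (greset r gl)"
proof -
  have "fold vremove (map vnat gs) (vgmap s gl) = vgmap s (fold gremove gs gl)" for gs
    by (induction gs arbitrary: gl) (simp_all add: vremove_vgmap)
  from this[of "rev (group_ids r)"] show ?thesis
    by (simp add: vreset_def vgroup_ids_vregex vfold_vl greset_def rev_map)
qed

lemma fold_gremove:
  "distinct (map fst gl) \<Longrightarrow>
   glookup (fold gremove gs gl) = (\<lambda>g. if g \<in> set gs then Undefined else glookup gl g) \<and>
   distinct (map fst (fold gremove gs gl)) \<and> set (fold gremove gs gl) \<subseteq> set gl"
proof (induction gs arbitrary: gl)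
  case (Cons g gs)
  from Cons.IH[OF distinct_gremove[OF Cons.prems]] glookup_gremove[OF Cons.prems, of g]
  have "glookup (fold gremove (g # gs) gl) = (\<lambda>h. if h \<in> set (g # gs) then Undefined else glookup gl h)"
    by (simp add: fun_eq_iff)
  with Cons.IH[OF distinct_gremove[OF Cons.prems]] set_gremove[of g gl] show ?case by auto
qed auto

lemma greset:
  assumes "distinct (map fst gl)"
  shows "glookup (greset r gl) = reset_groups r (glookup gl)" "distinct (map fst (greset r gl))"
    "set (greset r gl) \<subseteq> set gl"
  using fold_gremove[OF assms, of "rev (group_ids r)"] by (simp_all add: greset_def reset_groups_def)

lemma computable_vreset:
  fixes f g :: "'c::finite token val \<Rightarrow> 'c tval"
  assumes "computable f" "computable g"
  shows "computable (\<lambda>v. vreset (f v) (g v))"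
  unfolding vreset_def
proof (rule computable_vfold[where k = 0])
  show "vsize (vremove x acc) \<le> vsize acc + 0 * (vsize e + vsize x)" for e x acc :: "'c tval"
    using vsize_vremove[of x acc] by simp
qed (intro computable_basic computable_vremove computable_vgroup_ids assms)+

section \<open>Distinctness of the group identifiers\<close>

definition vmember :: "'c tval \<Rightarrow> 'c tval \<Rightarrow> bool" where
  "vmember x ys \<longleftrightarrow> is_tok T_Infinity
     (vfold (\<lambda>e y acc. if vlist_eq e y then vfail else acc) x ys vnil)"

definition vdistinct :: "'c tval \<Rightarrow> bool" where
  "vdistinct xs \<longleftrightarrow> \<not> is_tok T_Infinity
     (vfold (\<lambda>e x acc. if is_tok T_Infinity acc then acc
        else if vmember x acc then vfail else Pair x acc) vnil xs vnil)"

lemma vmember_vnat: "vmember (vnat g :: 'c tval) (vl (map vnat gs)) \<longleftrightarrow> g \<in> set gs"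
proof -
  have "fold (\<lambda>y acc. if vlist_eq (vnat g :: 'c tval) y then vfail else acc) (map vnat gs) acc =
      (if g \<in> set gs then vfail else acc)" for acc :: "'c tval"
    by (induction gs arbitrary: acc) auto
  then show ?thesis by (simp add: vmember_def vfold_vl)
qed

lemma vdistinct_vnat: "vdistinct (vl (map vnat gs) :: 'c tval) \<longleftrightarrow> distinct gs"
proof -
  let ?f = "fold (\<lambda>x (acc :: 'c tval). if is_tok T_Infinity acc then acc
        else if vmember x acc then vfail else Pair x acc)"
  have fail: "?f xs vfail = vfail" for xs by (induction xs) simp_all
  have "is_tok T_Infinity (?f (map vnat gs) (vl (map vnat hs))) \<longleftrightarrow> \<not> (distinct gs \<and> set gs \<inter> set hs = {})"
    for hs
  proof (induction gs arbitrary: hs)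
    case Nil
    show ?case by (cases hs) simp_all
  next
    case (Cons g gs)
    have "\<not> is_tok T_Infinity (vl (map vnat hs) :: 'c tval)" by (cases hs) simp_all
    with Cons[of "g # hs"] show ?case by (auto simp: vmember_vnat fail)
  qed
  from this[of "[]"] show ?thesis by (simp add: vdistinct_def vfold_vl)
qed

lemma decidable_vdistinct:
  fixes f :: "'c::finite token val \<Rightarrow> 'c tval"
  assumes "computable f"
  shows "decidable (\<lambda>v. vdistinct (f v))"
proof -
  have member: "decidable (\<lambda>v. vmember (f v) (g v))"
    if "computable f" "computable g" for f g :: "'c tval \<Rightarrow> 'c tval"
    unfolding vmember_def
  proof (intro computable_basic, rule computable_vfold[where k = 1])
    show "vsize (if vlist_eq e y then vfail else acc) \<le> vsize acc + 1 * (vsize e + vsize y)"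
      for e y acc :: "'c tval"
      using vsize_ge_1[of acc] by simp
  qed (intro computable_basic decidable_vlist_eq that)+
  show ?thesis unfolding vdistinct_def
  proof (intro computable_basic, rule computable_vfold[where k = 1])
    show "vsize (if is_tok T_Infinity acc then acc else if vmember x acc then vfail else Pair x acc)
        \<le> vsize acc + 1 * (vsize e + vsize x)" for e x acc :: "'c tval"
      using vsize_ge_1[of acc] vsize_ge_1[of e] by simp
  qed (intro computable_basic member assms)+
qed

section \<open>Parsing\<close>

text \<open>Read from right to left, the prefix code of a regex is a postfix program that builds its syntax
  tree on a stack.\<close>

datatype 'c item = INum nat | IInf | IReg "'c regex" | IStr "'c list"

fun vitem :: "'c item \<Rightarrow> 'c tval" where
  "vitem (INum n) = Pair (Atom (T_Bit True)) (vnat n)"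
| "vitem IInf = Pair (Atom (T_Bit False)) vfail"
| "vitem (IReg r) = Pair (Atom T_Epsilon) (vregex r)"
| "vitem (IStr s) = Pair (Atom T_Group) (letters s)"

fun item_tokens :: "'c item \<Rightarrow> 'c token list" where
  "item_tokens (INum n) = enc_nat n"
| "item_tokens IInf = [T_Infinity]"
| "item_tokens (IReg r) = enc_regex r"
| "item_tokens (IStr s) = map T_Letter s"

abbreviation "item_num x \<equiv> is_tok (T_Bit True) (vfst x)"
abbreviation "item_inf x \<equiv> is_tok (T_Bit False) (vfst x)"
abbreviation "item_reg x \<equiv> is_tok T_Epsilon (vfst x)"
abbreviation "item_str x \<equiv> is_tok T_Group (vfst x)"

fun leaf_token :: "'c token option \<Rightarrow> bool" where
  "leaf_token (Some T_Epsilon) = True"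
| "leaf_token (Some (T_Chars cd)) = True"
| "leaf_token (Some (T_Anchor a)) = True"
| "leaf_token _ = False"

text \<open>Two tests go beyond the shape of the stack. A zero bit in front of the number 0 is
  refused, since it would give a number a second notation. A quantifier requires the number 0 as its
  lower bound. Failure is absorbing, and a letter is accepted only while the string is on
  top.\<close>

definition vparse_step :: "'c tval \<Rightarrow> 'c tval \<Rightarrow> 'c tval" where
  "vparse_step t st =
     (if is_tok T_Infinity st then vfail
      else if is_tok T_End t then Pair (Pair (Atom (T_Bit True)) vnil) st
      else if is_tok T_Infinity t then Pair (Pair (Atom (T_Bit False)) vfail) st
      else if is_tok (T_Bit True) t \<or> is_tok (T_Bit False) t then
        if item_num (vfst st) \<and> \<not> (is_tok (T_Bit False) t \<and> is_tok T_End (vsnd (vfst st)))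
        then Pair (Pair (Atom (T_Bit True)) (Pair t (vsnd (vfst st)))) (vsnd st) else vfail
      else if vtest (\<lambda>h. \<exists>c. h = Some (T_Letter c)) t then
        if item_str (vfst st) then Pair (Pair (Atom T_Group) (Pair t (vsnd (vfst st)))) (vsnd st) else vfail
      else if vtest leaf_token t then Pair (Pair (Atom T_Epsilon) (Pair t vnil)) st
      else if is_tok T_Disj t \<or> is_tok T_Sequence t then
        if item_reg (vfst st) \<and> item_reg (vfst (vsnd st))
        then Pair (Pair (Atom T_Epsilon) (Pair t (Pair (vsnd (vfst st)) (vsnd (vfst (vsnd st))))))
          (vsnd (vsnd st))
        else vfail
      else if is_tok T_Group t then
        if item_num (vfst st) \<and> item_reg (vfst (vsnd st))
        then Pair (Pair (Atom T_Epsilon) (Pair t (Pair (vsnd (vfst st)) (vsnd (vfst (vsnd st))))))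
          (vsnd (vsnd st))
        else vfail
      else if is_tok T_Backref t then
        if item_num (vfst st) then Pair (Pair (Atom T_Epsilon) (Pair t (vsnd (vfst st)))) (vsnd st) else vfail
      else if vtest (\<lambda>h. \<exists>k. h = Some (T_Look k)) t then
        if item_reg (vfst st) then Pair (Pair (Atom T_Epsilon) (Pair t (vsnd (vfst st)))) (vsnd st) else vfail
      else if vtest (\<lambda>h. \<exists>b. h = Some (T_Quant b)) t then
        if item_num (vfst st) \<and> is_tok T_End (vsnd (vfst st)) \<and>
          (item_num (vfst (vsnd st)) \<or> item_inf (vfst (vsnd st))) \<and> item_reg (vfst (vsnd (vsnd st)))
        then Pair (Pair (Atom T_Epsilon)
            (Pair t (Pair (vsnd (vfst (vsnd st))) (vsnd (vfst (vsnd (vsnd st)))))))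
          (vsnd (vsnd (vsnd st)))
        else vfail
      else vfail)"

lemma vsize_If: "vsize x \<le> n \<Longrightarrow> vsize y \<le> n \<Longrightarrow> vsize (if P then x else y) \<le> n"
  by simp

lemma vsize_vparse_step: "vsize (vparse_step t st) \<le> vsize st + 9 * vsize t"
proof -
  note sizes = vsize_ge_1[of t] vsize_ge_1[of st] vsize_vfst_vsnd[of st] vsize_vfst_vsnd[of "vsnd st"]
    vsize_vfst_vsnd[of "vsnd (vsnd st)"] vsize_vsnd[of "vfst st"] vsize_vsnd[of "vfst (vsnd st)"]
    vsize_vsnd[of "vfst (vsnd (vsnd st))"] vsize_ge_1[of "vfst st"]
  show ?thesis unfolding vparse_step_def by (intro vsize_If; use sizes in simp)
qed

lemma computable_vparse_step:
  "computable f \<Longrightarrow> computable g \<Longrightarrow> computable (\<lambda>v. vparse_step (f v) (g v))"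
  unfolding vparse_step_def by (intro computable_basic)

definition vparse :: "'c token list \<Rightarrow> 'c tval \<Rightarrow> 'c tval" where
  "vparse ts st = foldr vparse_step (map Atom ts) st"

abbreviation "vstack is \<equiv> vl (map vitem is)"

abbreviation "parsed ts \<equiv> vparse ts (vstack [IStr []])"

lemma vparse_simps [simp]:
  "vparse [] st = st" "vparse (t # ts) st = vparse_step (Atom t) (vparse ts st)"
  "vparse (ts @ us) st = vparse ts (vparse us st)"
  by (simp_all add: vparse_def)

lemma vstack_not_fail [simp]: "\<not> is_tok T_Infinity (vstack is)"
  by (cases "is") simp_all

lemma item_tags:
  "item_num (vfst (vstack is)) \<longleftrightarrow> (\<exists>n is'. is = INum n # is')"
  "item_inf (vfst (vstack is)) \<longleftrightarrow> (\<exists>is'. is = IInf # is')"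
  "item_reg (vfst (vstack is)) \<longleftrightarrow> (\<exists>r is'. is = IReg r # is')"
  "item_str (vfst (vstack is)) \<longleftrightarrow> (\<exists>s is'. is = IStr s # is')"
proof -
  have *: "is = [] \<or> (\<exists>i is'. is = i # is')" by (cases "is") auto
  show "item_num (vfst (vstack is)) \<longleftrightarrow> (\<exists>n is'. is = INum n # is')"
    "item_inf (vfst (vstack is)) \<longleftrightarrow> (\<exists>is'. is = IInf # is')"
    "item_reg (vfst (vstack is)) \<longleftrightarrow> (\<exists>r is'. is = IReg r # is')"
    "item_str (vfst (vstack is)) \<longleftrightarrow> (\<exists>s is'. is = IStr s # is')"
    using * by (auto, (case_tac i; simp)+)
qed

lemma vnat_Cons: "n \<noteq> 0 \<or> b \<Longrightarrow> Pair (Atom (T_Bit b)) (vnat n) = vnat (2 * n + of_bool b)"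
  by (cases b) (simp_all add: vnat_def bits_pos)

lemma is_tok_End_vnat [simp]: "is_tok T_End (vnat n) \<longleftrightarrow> n = 0"
  by (cases "n = 0") (simp_all add: vnat_def bits_pos)

lemma enc_nat_Cons: "n \<noteq> 0 \<or> b \<Longrightarrow> enc_nat (2 * n + of_bool b) = T_Bit b # enc_nat n"
  by (cases b) (simp_all add: enc_nat_pos)

text \<open>The invariant is that writing out the items on the stack gives back the tokens read so
  far. Hence a final stack of one regex and one string shows that the input was the code of just
  this instance, and everything else can be rejected.\<close>

lemma vparse_sound:
  fixes ts :: "'c token list"
  assumes "parsed ts \<noteq> vfail"
  shows "\<exists>is. parsed ts = vstack is \<and> concat (map item_tokens is) = ts \<and>
    (\<forall>r. IReg r \<in> set is \<longrightarrow> \<not> has_lower_bounded r)"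
  using assms
proof (induction ts)
  case Nil
  show ?case by (intro exI[of _ "[IStr []]"]) auto
next
  case (Cons t ts)
  let ?ok = "\<lambda>is. vparse (t # ts) (vstack [IStr []]) = vstack is \<and> concat (map item_tokens is) = t # ts \<and>
    (\<forall>r. IReg r \<in> set is \<longrightarrow> \<not> has_lower_bounded r)"
  have "parsed ts \<noteq> vfail"
    using Cons.prems by (auto simp: vparse_step_def)
  from Cons.IH[OF this] obtain "is" where "is": "parsed ts = vstack is"
    "concat (map item_tokens is) = ts" "\<And>r. IReg r \<in> set is \<Longrightarrow> \<not> has_lower_bounded r" by blast
  have step: "vparse (t # ts) (vstack [IStr []]) = vparse_step (Atom t) (vstack is)"
    by (simp only: vparse_simps "is"(1))
  have no: "vparse_step (Atom t) (vstack is) \<noteq> vfail" using Cons.prems step by simp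
  show ?case
  proof (cases t)
    case T_Epsilon
    then have "?ok (IReg Epsilon # is)" using "is" by (auto simp: step vparse_step_def)
    then show ?thesis by blast
  next
    case (T_Chars cd)
    then have "?ok (IReg (Chars cd) # is)" using "is" by (auto simp: step vparse_step_def)
    then show ?thesis by blast
  next
    case T_Disj
    with no obtain r1 r2 is' where i: "is = IReg r1 # IReg r2 # is'"
      by (auto simp: vparse_step_def item_tags split: if_splits)
    have "?ok (IReg (Disj r1 r2) # is')" using T_Disj i "is" by (auto simp: step vparse_step_def)
    then show ?thesis by blast
  next
    case T_Sequence
    with no obtain r1 r2 is' where i: "is = IReg r1 # IReg r2 # is'"
      by (auto simp: vparse_step_def item_tags split: if_splits)
    have "?ok (IReg (Sequence r1 r2) # is')" using T_Sequence i "is" by (auto simp: step vparse_step_def)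
    then show ?thesis by blast
  next
    case T_Group
    with no obtain g r is' where i: "is = INum g # IReg r # is'"
      by (auto simp: vparse_step_def item_tags split: if_splits)
    have "?ok (IReg (Group g r) # is')" using T_Group i "is" by (auto simp: step vparse_step_def)
    then show ?thesis by blast
  next
    case T_Backref
    with no obtain g is' where i: "is = INum g # is'"
      by (auto simp: vparse_step_def item_tags split: if_splits)
    have "?ok (IReg (Backref g) # is')" using T_Backref i "is" by (auto simp: step vparse_step_def)
    then show ?thesis by blast
  next
    case (T_Quant b)
    with no obtain r is' D i where i: "is = INum 0 # i # IReg r # is'"
      "vsnd (vitem i) = venat D" "item_num (vitem i) \<or> item_inf (vitem i)" "item_tokens i = enc_enat D"
      by (auto simp: vparse_step_def item_tags split: if_splits) (metis item_tokens.simps(1,2)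
         enc_enat.simps venat.simps vitem.simps(1,2) vfst.simps(2) vsnd.simps(2) is_tok_simps(1))+
    have "?ok (IReg (Quant r 0 D b) # is')"
      using T_Quant i "is" by (auto simp: step vparse_step_def enc_nat_0 vnat_0)
    then show ?thesis by blast
  next
    case (T_Look k)
    with no obtain r is' where i: "is = IReg r # is'"
      by (auto simp: vparse_step_def item_tags split: if_splits)
    have "?ok (IReg (Look k r) # is')" using T_Look i "is" by (auto simp: step vparse_step_def)
    then show ?thesis by blast
  next
    case (T_Anchor a)
    then have "?ok (IReg (Anchor a) # is)" using "is" by (auto simp: step vparse_step_def)
    then show ?thesis by blast
  next
    case (T_Bit b)
    with no obtain n is' where i: "is = INum n # is'" "n \<noteq> 0 \<or> b"
      by (cases b) (auto simp: vparse_step_def item_tags split: if_splits)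
    have "?ok (INum (2 * n + of_bool b) # is')"
      using T_Bit i "is" vnat_Cons[where 'a = 'c, OF i(2), symmetric] enc_nat_Cons[OF i(2)]
      by (cases b) (auto simp: step vparse_step_def)
    then show ?thesis by blast
  next
    case T_End
    then have "?ok (INum 0 # is)" using "is" by (auto simp: step vparse_step_def vnat_0 enc_nat_0)
    then show ?thesis by blast
  next
    case T_Infinity
    then have "?ok (IInf # is)" using "is" by (auto simp: step vparse_step_def)
    then show ?thesis by blast
  next
    case (T_Letter c)
    with no obtain s is' where i: "is = IStr s # is'"
      by (auto simp: vparse_step_def item_tags split: if_splits)
    have "?ok (IStr (c # s) # is')" using T_Letter i "is" by (auto simp: step vparse_step_def)
    then show ?thesis by blast
  qed
qed

lemma vparse_enc_nat: "vparse (enc_nat n) (vstack is) = vstack (INum n # is)"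
proof (induction n rule: less_induct)
  case (less n)
  show ?case
  proof (cases "n = 0")
    case True
    then show ?thesis by (simp add: enc_nat_0 vparse_step_def vnat_0)
  next
    case False
    then have "vparse (enc_nat n) (vstack is) = vparse_step (Atom (T_Bit (odd n))) (vstack (INum (n div 2) # is))"
      using less by (simp add: enc_nat_pos)
    also have "\<dots> = Pair (Pair (Atom (T_Bit True)) (Pair (Atom (T_Bit (odd n))) (vnat (n div 2)))) (vstack is)"
      using False by (auto simp: vparse_step_def)
    also have "Pair (Atom (T_Bit (odd n))) (vnat (n div 2)) = vnat n"
      using False by (simp add: vnat_def bits_pos[of n])
    finally show ?thesis by simp
  qed
qed

lemma vparse_enc_enat:
  "vparse (enc_enat D) (vstack is) = Pair (Pair (Atom (T_Bit (D \<noteq> \<infinity>))) (venat D)) (vstack is)"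
  by (cases D) (simp_all add: vparse_enc_nat, simp add: vparse_step_def)

lemma vparse_enc_regex:
  "\<not> has_lower_bounded r \<Longrightarrow> vparse (enc_regex r) (vstack is) = vstack (IReg r # is)"
proof (induction r arbitrary: "is")
  case (Disj r1 r2)
  then show ?case using Disj.IH(1)[of "IReg r2 # is"] by (simp add: vparse_step_def)
next
  case (Sequence r1 r2)
  then show ?case using Sequence.IH(1)[of "IReg r2 # is"] by (simp add: vparse_step_def)
next
  case (Group g r)
  then show ?case using vparse_enc_nat[of g "IReg r # is"] by (simp add: vparse_step_def)
next
  case (Backref g)
  then show ?case using vparse_enc_nat[of g "is"] by (simp add: vparse_step_def)
next
  case (Quant r m D greedy)
  then have m: "m = 0" by simp
  have "vparse (enc_enat D) (vstack (IReg r # is)) =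
      Pair (Pair (Atom (T_Bit (D \<noteq> \<infinity>))) (venat D)) (vstack (IReg r # is))"
    by (rule vparse_enc_enat)
  with Quant show ?case
    by (cases D) (simp_all add: m enc_nat_0, simp_all add: vparse_step_def)
next
  case (Look k r)
  then show ?case by (simp add: vparse_step_def)
qed (simp_all add: vparse_step_def)

lemma vparse_letters: "vparse (map T_Letter s) (vstack [IStr []]) = vstack [IStr s]"
  by (induction s) (simp_all, simp add: vparse_step_def)

lemma vparse_enc_instance:
  "\<not> has_lower_bounded r \<Longrightarrow> vparse (enc_instance r s) (vstack [IStr []]) = vstack [IReg r, IStr s]"
  unfolding enc_instance_def vparse_simps vparse_letters by (rule vparse_enc_regex)

section \<open>The backtracking machine\<close>

text \<open>A state evaluates a configuration, fails, or succeeds with a group map, on top of a stack of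
  frames. A frame is either an alternative to be tried on failure or the continuation of a pending
  lookaround.\<close>

definition vconf :: "'c tval \<Rightarrow> 'c tval \<Rightarrow> 'c tval \<Rightarrow> 'c tval \<Rightarrow> 'c tval" where
  "vconf l pos g d = Pair l (Pair pos (Pair g d))"

definition vEval :: "'c tval \<Rightarrow> 'c tval \<Rightarrow> 'c tval" where
  "vEval c K = Pair (Atom T_Sequence) (Pair c K)"

definition vFail :: "'c tval \<Rightarrow> 'c tval" where
  "vFail K = Pair (Atom T_Disj) (Pair vnil K)"

definition vSucc :: "'c tval \<Rightarrow> 'c tval \<Rightarrow> 'c tval" where
  "vSucc g K = Pair (Atom T_Group) (Pair g K)"

definition vChoice :: "'c tval \<Rightarrow> 'c tval \<Rightarrow> 'c tval" where
  "vChoice c K = Pair (Pair (Atom T_Disj) c) K"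

definition word_token :: "'c set \<Rightarrow> 'c token option \<Rightarrow> bool" where
  "word_token W h \<longleftrightarrow> (\<exists>c\<in>W. h = Some (T_Letter c))"

definition vanchor :: "'c set \<Rightarrow> 'c tval \<Rightarrow> 'c tval \<Rightarrow> bool" where
  "vanchor W t pos \<longleftrightarrow>
     is_tok (T_Anchor Input_Start) t \<and> \<not> is_pair (vfst pos) \<or>
     is_tok (T_Anchor Input_End) t \<and> \<not> is_pair (vsnd pos) \<or>
     is_tok (T_Anchor Word_Boundary) t \<and>
       vrel (\<lambda>x y. word_token W x \<noteq> word_token W y) (vfst (vfst pos)) (vfst (vsnd pos)) \<or>
     is_tok (T_Anchor Non_Word_Boundary) t \<and>
       vrel (\<lambda>x y. word_token W x = word_token W y) (vfst (vfst pos)) (vfst (vsnd pos))"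

definition forward_look :: "'c token option \<Rightarrow> bool" where
  "forward_look h \<longleftrightarrow> (\<exists>k. h = Some (T_Look k) \<and> look_dir k = Forward)"

definition positive_look :: "'c token option \<Rightarrow> bool" where
  "positive_look h \<longleftrightarrow> (\<exists>k. h = Some (T_Look k) \<and> positive k)"

definition vact :: "'c set \<Rightarrow> 'c tval \<Rightarrow> 'c tval \<Rightarrow> 'c tval \<Rightarrow> 'c tval \<Rightarrow>
    'c tval \<Rightarrow> 'c tval \<Rightarrow> 'c tval \<Rightarrow> 'c tval" where
  "vact W t x l pos g d K =
     (if is_tok T_Epsilon t then vEval (vconf l pos g d) K
      else if is_tok T_Infinity t then
        if is_tok (T_Bit True) d \<and> vlonger (vfst pos) x \<or>
          \<not> is_tok (T_Bit True) d \<and> vlonger x (vfst pos)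
        then vEval (vconf l pos g d) K else vFail K
      else if is_tok T_End t then
        if is_tok T_Group (vfst (vlookup x g))
        then vEval (vconf l pos (Pair (Pair x (Pair (Atom T_Backref)
          (vcapture (vsnd (vlookup x g)) (vfst pos)))) (vremove x g)) d) K
        else vEval (vconf l pos g d) K
      else if vtest (\<lambda>h. \<exists>cd. h = Some (T_Chars cd)) t then
        if is_pair (vread_char t d pos) then vEval (vconf l (vread_char t d pos) g d) K else vFail K
      else if is_tok T_Disj t then
        vEval (vconf (Pair (vfst x) l) pos g d) (vChoice (vconf (Pair (vsnd x) l) pos g d) K)
      else if is_tok T_Sequence t then
        if is_tok (T_Bit True) d then vEval (vconf (Pair (vfst x) (Pair (vsnd x) l)) pos g d) K
        else vEval (vconf (Pair (vsnd x) (Pair (vfst x) l)) pos g d) K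
      else if is_tok T_Group t then
        vEval (vconf (Pair (vsnd x) (Pair (Pair (Atom T_End) (vfst x)) l)) pos
          (Pair (Pair (vfst x) (Pair (Atom T_Group) (vfst pos))) (vremove (vfst x) g)) d) K
      else if is_tok T_Backref t then
        if is_tok T_Backref (vfst (vlookup x g)) then
          if is_pair (vread_word (vsnd (vlookup x g)) d pos)
          then vEval (vconf l (vread_word (vsnd (vlookup x g)) d pos) g d) K else vFail K
        else vEval (vconf l pos g d) K
      else if is_tok (T_Quant True) t \<or> is_tok (T_Quant False) t then
        if is_tok T_End (vfst x) then vEval (vconf l pos g d) K
        else if is_tok (T_Quant True) t then
          vEval (vconf (Pair (vsnd x) (Pair (Pair (Atom T_Infinity) (vfst pos))
            (Pair (Pair t (Pair (vepred (vfst x)) (vsnd x))) l))) pos (vreset (vsnd x) g) d)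
            (vChoice (vconf l pos g d) K)
        else
          vEval (vconf l pos g d)
            (vChoice (vconf (Pair (vsnd x) (Pair (Pair (Atom T_Infinity) (vfst pos))
              (Pair (Pair t (Pair (vepred (vfst x)) (vsnd x))) l))) pos (vreset (vsnd x) g) d) K)
      else if vtest (\<lambda>h. \<exists>k. h = Some (T_Look k)) t then
        vEval (vconf (Pair x vnil) pos g
          (if vtest forward_look t then Atom (T_Bit True) else Atom (T_Bit False)))
          (Pair (Pair t (vconf l pos g d)) K)
      else if vanchor W t pos then vEval (vconf l pos g d) K else vFail K)"

text \<open>A success discards alternatives down to the next lookaround frame, since only the first
  result of the body counts. That frame holds the whole continuation: it gives back position and
  direction, and when the body of a negative lookaround fails, also the group map from before the
  body. A positive lookaround replaces that map by the one just found.\<close>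

definition vstep :: "'c set \<Rightarrow> 'c tval \<Rightarrow> 'c tval" where
  "vstep W v = (let c = vfst (vsnd v); K = vsnd (vsnd v) in
     if is_tok T_Sequence (vfst v) then
       if is_pair (vfst c)
       then vact W (vfst (vfst (vfst c))) (vsnd (vfst (vfst c))) (vsnd (vfst c)) (vfst (vsnd c))
         (vfst (vsnd (vsnd c))) (vsnd (vsnd (vsnd c))) K
       else vSucc (vfst (vsnd (vsnd c))) K
     else if is_tok T_Disj (vfst v) then
       if is_tok T_Disj (vfst (vfst K)) then vEval (vsnd (vfst K)) (vsnd K)
       else if vtest positive_look (vfst (vfst K)) then vFail (vsnd K)
       else vEval (vsnd (vfst K)) (vsnd K)
     else
       if is_tok T_Disj (vfst (vfst K)) then vSucc c (vsnd K)
       else if vtest positive_look (vfst (vfst K))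
       then vEval (vconf (vfst (vsnd (vfst K))) (vfst (vsnd (vsnd (vfst K)))) c
         (vsnd (vsnd (vsnd (vsnd (vfst K)))))) (vsnd K)
       else vFail (vsnd K))"

text \<open>This brings the loop condition into the form of a root test: an evaluating state always
  continues, and the other two kinds continue as long as a frame is left.\<close>

definition vrest :: "'c tval \<Rightarrow> 'c tval" where
  "vrest v = (if is_tok T_Sequence (vfst v) then Pair v v else vsnd (vsnd v))"

lemma computable_vrest: "computable vrest"
  unfolding vrest_def by (intro computable_basic)

lemma computable_vact:
  fixes t :: "'c::finite token val \<Rightarrow> 'c tval"
  assumes "computable t" "computable x" "computable l" "computable pos" "computable g" "computable d"
    "computable K"
  shows "computable (\<lambda>v. vact W (t v) (x v) (l v) (pos v) (g v) (d v) (K v))"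
  unfolding vact_def vconf_def vEval_def vFail_def vChoice_def vanchor_def
  by (intro computable_basic decidable_vrel decidable_vlonger computable_vlookup computable_vremove
      computable_vcapture computable_vread_char computable_vread_word computable_vepred
      computable_vreset assms)

lemma computable_vstep: "computable (vstep W :: 'c::finite token val \<Rightarrow> 'c tval)"
  unfolding vstep_def Let_def vconf_def vEval_def vFail_def vSucc_def
  by (intro computable_basic computable_vact)

section \<open>Correctness of single machine steps\<close>

fun vaction :: "'c list \<Rightarrow> 'c action \<Rightarrow> 'c tval" where
  "vaction s (Areg r) = vregex r"
| "vaction s (Aclose g) = Pair (Atom T_End) (vnat g)"
| "vaction s (Acheck k) = Pair (Atom T_Infinity) (vpre s k)"

definition config :: "'c list \<Rightarrow> 'c action list \<Rightarrow> nat \<Rightarrow> group_list \<Rightarrow> dir \<Rightarrow> 'c tval" where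
  "config s l p gl d = vconf (vl (map (vaction s) l)) (vpos s p) (vgmap s gl) (vdir d)"

lemma vstep_frames:
  "vstep W (vFail (vChoice c K)) = vEval c K"
  "vstep W (vSucc g (vChoice c K)) = vSucc g K"
  "vstep W (vFail (Pair (Pair (Atom (T_Look k)) c) K)) = (if positive k then vFail K else vEval c K)"
  "vstep W (vSucc (vgmap s gl') (Pair (Pair (Atom (T_Look k)) (config s l p gl d)) K)) =
     (if positive k then vEval (config s l p gl' d) K else vFail K)"
  by (simp_all add: vstep_def vFail_def vSucc_def vChoice_def positive_look_def config_def vconf_def)

lemma vstep_Nil: "vstep W (vEval (config s [] p gl d) K) = vSucc (vgmap s gl) K"
  by (simp add: vstep_def vEval_def config_def vconf_def)

lemma vstep_Cons:
  "vstep W (vEval (config s (a # l) p gl d) K) =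
   vact W (vfst (vaction s a)) (vsnd (vaction s a)) (vl (map (vaction s) l)) (vpos s p) (vgmap s gl)
     (vdir d) K"
  by (simp add: vstep_def vEval_def config_def vconf_def)

lemma is_tok_vdir [simp]: "is_tok (T_Bit True) (vdir d) \<longleftrightarrow> d = Forward"
  by (cases d) simp_all

lemma vfst_vpos [simp]: "vfst (vpos s p) = vpre s p"
  by (simp add: vpos_def)

lemma is_pair_vpos [simp]: "is_pair (vpos s p)"
  by (simp add: vpos_def)

lemma further_vlonger:
  "p \<le> length s \<Longrightarrow> k \<le> length s \<Longrightarrow>
   d = Forward \<and> vlonger (vpre s p) (vpre s k) \<or> d \<noteq> Forward \<and> vlonger (vpre s k) (vpre s p)
   \<longleftrightarrow> further d p k"
  by (cases d) (simp_all add: vlonger_vpre)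

lemma vanchor_vpos:
  assumes "p \<le> length s"
  shows "vanchor W (Atom (T_Anchor a)) (vpos s p) \<longleftrightarrow> anchor_holds W s a p"
proof -
  have pre: "word_token W (vhead (vfst (vpre s p))) \<longleftrightarrow> p > 0 \<and> s ! (p - 1) \<in> W"
  proof (cases p)
    case (Suc q)
    then have "rev (take p s) = s ! q # rev (take q s)" using assms by (simp add: take_Suc_conv_app_nth)
    then show ?thesis using Suc by (simp add: vpre_def word_token_def)
  qed (simp add: vpre_def word_token_def)
  have suf: "word_token W (vhead (vfst (letters (drop p s)))) \<longleftrightarrow> p < length s \<and> s ! p \<in> W"
  proof (cases "p < length s")
    case True
    then have "drop p s = s ! p # drop (Suc p) s" by (simp add: Cons_nth_drop_Suc)
    then show ?thesis using True by (simp add: word_token_def)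
  qed (use assms in \<open>simp add: word_token_def\<close>)
  have "is_pair (vpre s p) \<longleftrightarrow> p \<noteq> 0" using assms by (auto simp: vpre_def)
  moreover have "is_pair (letters (drop p s)) \<longleftrightarrow> p \<noteq> length s" using assms by auto
  moreover have "vsnd (vpos s p) = letters (drop p s)" by (simp add: vpos_def)
  ultimately show ?thesis
    by (cases a) (auto simp: vanchor_def vrel_def pre suf word_boundary_def)
qed

lemma vgmap_Cons: "Pair (Pair (vnat g) (vgroup s st)) (vgmap s gl) = vgmap s ((g, st) # gl)"
  by (simp add: vgmap_def)

text \<open>\<open>gs\<close> stands for the identifiers of the whole regex, so there is at most one
  entry per group. Opened positions must lie in the string for \<open>vpre\<close> to represent them
  faithfully; closed groups are stored as factors of the string and are short in any case.\<close>

definition groups_ok :: "'c list \<Rightarrow> nat list \<Rightarrow> group_list \<Rightarrow> bool" where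
  "groups_ok s gs gl \<longleftrightarrow> distinct (map fst gl) \<and> fst ` set gl \<subseteq> set gs \<and>
     (\<forall>g a. (g, Opened a) \<in> set gl \<longrightarrow> a \<le> length s)"

lemma groups_ok_update:
  assumes "groups_ok s gs gl" "g \<in> set gs" "\<And>a. st = Opened a \<Longrightarrow> a \<le> length s"
  shows "groups_ok s gs ((g, st) # gremove g gl)" "glookup ((g, st) # gremove g gl) = (glookup gl)(g := st)"
proof -
  show "groups_ok s gs ((g, st) # gremove g gl)"
    using assms distinct_gremove[of gl g] set_gremove[of g gl] gremove_keys[of g gl]
    unfolding groups_ok_def by (auto simp del: distinct_map)
  show "glookup ((g, st) # gremove g gl) = (glookup gl)(g := st)"
    using assms(1) by (simp add: glookup_Cons glookup_gremove groups_ok_def)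
qed

lemma groups_ok_reset:
  assumes "groups_ok s gs gl"
  shows "groups_ok s gs (greset r gl)" "glookup (greset r gl) = reset_groups r (glookup gl)"
  using assms greset[of gl r] unfolding groups_ok_def by (auto simp del: distinct_map)

lemma glookup_in: "glookup gl g = Opened a \<Longrightarrow> (g, Opened a) \<in> set gl"
  by (auto simp: glookup_def split: option.splits dest: map_of_SomeD)

lemma vstep_basic:
  "vstep W (vEval (config s (Areg Epsilon # l) p gl d) K) = vEval (config s l p gl d) K"
  "vstep W (vEval (config s (Areg (Disj r1 r2) # l) p gl d) K) =
     vEval (config s (Areg r1 # l) p gl d) (vChoice (config s (Areg r2 # l) p gl d) K)"
  "vstep W (vEval (config s (Areg (Sequence r1 r2) # l) p gl d) K) =
     (case d of Forward \<Rightarrow> vEval (config s (Areg r1 # Areg r2 # l) p gl d) K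
      | Backward \<Rightarrow> vEval (config s (Areg r2 # Areg r1 # l) p gl d) K)"
  "vstep W (vEval (config s (Areg (Group g r) # l) p gl d) K) =
     vEval (config s (Areg r # Aclose g # l) p ((g, Opened p) # gremove g gl) d) K"
  "vstep W (vEval (config s (Areg (Look k r) # l) p gl d) K) =
     vEval (config s [Areg r] p gl (look_dir k)) (Pair (Pair (Atom (T_Look k)) (config s l p gl d)) K)"
  unfolding vstep_Cons
  by (simp_all add: vact_def config_def vremove_vgmap flip: vgmap_Cons split: dir.split)
    (cases k; simp add: forward_look_def)

lemma vstep_Quant:
  assumes "D \<noteq> 0"
  shows "vstep W (vEval (config s (Areg (Quant r m D greedy) # l) p gl d) K) =
     (if greedy
      then vEval (config s (Areg r # Acheck p # Areg (Quant r m (D - 1) greedy) # l) p (greset r gl) d)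
        (vChoice (config s l p gl d) K)
      else vEval (config s l p gl d)
        (vChoice (config s (Areg r # Acheck p # Areg (Quant r m (D - 1) greedy) # l) p (greset r gl) d) K))"
proof -
  have "\<not> is_tok T_End (venat D :: 'a tval)"
    using assms by (cases D) (auto simp: zero_enat_def)
  then show ?thesis
    unfolding vstep_Cons
    by (cases greedy) (simp_all add: vact_def config_def vreset_vgmap vepred_venat assms)
qed

lemma vstep_Quant_0:
  "vstep W (vEval (config s (Areg (Quant r m 0 greedy) # l) p gl d) K) = vEval (config s l p gl d) K"
  unfolding vstep_Cons
  by (cases greedy) (simp_all add: vact_def config_def zero_enat_def vnat_0)

lemma vstep_tests:
  assumes "p \<le> length s"
  shows "k \<le> length s \<Longrightarrow> vstep W (vEval (config s (Acheck k # l) p gl d) K) =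
      (if further d p k then vEval (config s l p gl d) K else vFail K)"
    "vstep W (vEval (config s (Areg (Anchor a) # l) p gl d) K) =
      (if anchor_holds W s a p then vEval (config s l p gl d) K else vFail K)"
    "vstep W (vEval (config s (Areg (Chars cd) # l) p gl d) K) =
      (case read_char s cd p d of None \<Rightarrow> vFail K | Some p' \<Rightarrow> vEval (config s l p' gl d) K)"
proof -
  show "vstep W (vEval (config s (Acheck k # l) p gl d) K) =
      (if further d p k then vEval (config s l p gl d) K else vFail K)" if "k \<le> length s"
    unfolding vstep_Cons using further_vlonger[OF assms that, of d] by (simp add: vact_def config_def)
  show "vstep W (vEval (config s (Areg (Anchor a) # l) p gl d) K) =
      (if anchor_holds W s a p then vEval (config s l p gl d) K else vFail K)"
    unfolding vstep_Cons using vanchor_vpos[OF assms] by (simp add: vact_def config_def)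
  show "vstep W (vEval (config s (Areg (Chars cd) # l) p gl d) K) =
      (case read_char s cd p d of None \<Rightarrow> vFail K | Some p' \<Rightarrow> vEval (config s l p' gl d) K)"
    unfolding vstep_Cons using vread_char_vpos[OF assms, of cd d]
    by (simp add: vact_def config_def split: option.split)
qed

lemma vstep_Backref:
  assumes "p \<le> length s" "distinct (map fst gl)"
  shows "vstep W (vEval (config s (Areg (Backref g) # l) p gl d) K) =
      (case read_backref s (glookup gl g) p d of None \<Rightarrow> vFail K
       | Some p' \<Rightarrow> vEval (config s l p' gl d) K)"
  unfolding vstep_Cons using vlookup_vgmap[OF assms(2), of g s] vread_word_vpos[OF assms(1)]
  by (cases "glookup gl g") (simp_all add: vact_def config_def split: option.split)

lemma vstep_Aclose:
  assumes "p \<le> length s" "groups_ok s gs gl"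
  obtains gl' where "groups_ok s gs gl'" "glookup gl' = close_group g p (glookup gl)"
    "vstep W (vEval (config s (Aclose g # l) p gl d) K) = vEval (config s l p gl' d) K"
proof (cases "\<exists>a. glookup gl g = Opened a")
  case True
  then obtain a where a: "glookup gl g = Opened a" by blast
  then have in_gl: "(g, Opened a) \<in> set gl" by (rule glookup_in)
  then have le: "a \<le> length s" and mem: "g \<in> set gs"
    using assms(2) by (force simp: groups_ok_def)+
  let ?st = "Closed (min a p) (max a p)"
  have "vstep W (vEval (config s (Aclose g # l) p gl d) K) =
      vEval (config s l p ((g, ?st) # gremove g gl) d) K"
    unfolding vstep_Cons using vlookup_vgmap[of gl g s] assms(2) vcapture_vpre[OF le assms(1)]
    by (simp add: vact_def config_def a vremove_vgmap groups_ok_def flip: vgmap_Cons)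
  moreover have "glookup ((g, ?st) # gremove g gl) = close_group g p (glookup gl)"
    using groups_ok_update(2)[OF assms(2) mem, of ?st] a by simp
  ultimately show thesis using groups_ok_update(1)[OF assms(2) mem, of ?st] by (intro that) auto
next
  case False
  then have "\<not> is_tok T_Group (vfst (vgroup s (glookup gl g)))"
    by (cases "glookup gl g") simp_all
  then have "vstep W (vEval (config s (Aclose g # l) p gl d) K) = vEval (config s l p gl d) K"
    unfolding vstep_Cons using vlookup_vgmap[of gl g s] assms(2)
    by (simp add: vact_def config_def groups_ok_def)
  moreover have "glookup gl = close_group g p (glookup gl)"
    using False by (cases "glookup gl g") simp_all
  ultimately show thesis using assms(2) by (intro that)
qed

section \<open>Space bounds\<close>

fun asize :: "'c list \<Rightarrow> 'c action \<Rightarrow> nat" where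
  "asize s (Areg r) = vsize (vregex r)"
| "asize s (Aclose g) = vsize (vnat g :: 'c tval) + 2"
| "asize s (Acheck k) = 2 * length s + 3"

definition lsize :: "'c list \<Rightarrow> 'c action list \<Rightarrow> nat" where
  "lsize s l = (\<Sum>a\<leftarrow>l. Suc (asize s a))"

text \<open>\<open>peak s r\<close> bounds the size that the actions descending from \<open>r\<close> can reach before \<open>r\<close> has been
  consumed. Unfolding an iteration enlarges the list of actions but does not increase its peak.\<close>

primrec peak :: "'c list \<Rightarrow> 'c regex \<Rightarrow> nat" where
  "peak s Epsilon = 1 + vsize (vregex Epsilon :: 'c tval)"
| "peak s (Chars cd) = 1 + vsize (vregex (Chars cd))"
| "peak s (Disj r1 r2) = 1 + vsize (vregex (Disj r1 r2)) + peak s r1 + peak s r2"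
| "peak s (Sequence r1 r2) = 1 + vsize (vregex (Sequence r1 r2)) + peak s r1 + peak s r2"
| "peak s (Group g r) = 1 + vsize (vregex (Group g r)) + peak s r"
| "peak s (Backref g) = 1 + vsize (vregex (Backref g) :: 'c tval)"
| "peak s (Quant r m D greedy) =
     1 + vsize (vregex (Quant r m D greedy)) + peak s r + (2 * length s + 4)"
| "peak s (Look k r) = 1 + vsize (vregex (Look k r)) + peak s r"
| "peak s (Anchor a) = 1 + vsize (vregex (Anchor a) :: 'c tval)"

lemma peak_ge: "Suc (vsize (vregex r)) \<le> peak s r"
  by (cases r) simp_all

fun apeak :: "'c list \<Rightarrow> 'c action \<Rightarrow> nat" where
  "apeak s (Areg r) = peak s r"
| "apeak s a = Suc (asize s a)"

text \<open>Only the first action is being expanded while those behind it wait at their present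
  size. The size that can be reached is therefore a maximum over the suffixes and not a sum of
  peaks.\<close>

primrec lpeak :: "'c list \<Rightarrow> 'c action list \<Rightarrow> nat" where
  "lpeak s [] = 0"
| "lpeak s (a # l) = max (apeak s a + lsize s l) (lpeak s l)"

lemma lsize_simps [simp]: "lsize s [] = 0" "lsize s (a # l) = Suc (asize s a + lsize s l)"
  by (simp_all add: lsize_def)

lemma apeak_ge: "Suc (asize s a) \<le> apeak s a"
  by (cases a) (simp_all add: peak_ge)

lemma lsize_le_lpeak: "lsize s l \<le> lpeak s l"
  using apeak_ge[of s "hd l"] by (cases l) (simp_all add: le_max_iff_disj)

lemma vsize_vnat: "vsize (vnat n) = 2 * length (bits n) + 1"
proof -
  have "vsize (vl (map Atom (map T_Bit bs))) = 2 * length bs + 1" for bs by (induction bs) simp_all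
  then show ?thesis by (simp add: vnat_def)
qed

lemma length_bits_mono: "m \<le> n \<Longrightarrow> length (bits m) \<le> length (bits n)"
proof (induction n arbitrary: m rule: less_induct)
  case (less n)
  show ?case
  proof (cases "m = 0 \<or> n = 0")
    case False
    then have "length (bits (m div 2)) \<le> length (bits (n div 2))"
      using less by (intro less.IH) (auto intro: div_le_mono)
    then show ?thesis using False by (simp add: bits_pos)
  qed (use less.prems in auto)
qed

lemma vsize_venat_pred: "vsize (venat (D - 1)) \<le> vsize (venat D)"
  using length_bits_mono[of "n - 1" n for n]
  by (cases D) (simp_all add: one_enat_def vsize_vnat)

lemma vsize_vpre: "vsize (vpre s p) \<le> 2 * length s + 1"
  by (simp add: vpre_def vsize_letters)

lemma vsize_actions: "vsize (vl (map (vaction s) l)) \<le> lsize s l + 1"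
proof (induction l)
  case (Cons a l)
  have "vsize (vaction s a) \<le> asize s a" using vsize_vpre[of s] by (cases a) simp_all
  with Cons show ?case by simp
qed simp

text \<open>The last inequality explains the summand \<open>2 * length s + 4\<close> in
  \<open>peak\<close>: the body is expanded in front of a check, which costs just this much, and of
  the next copy of the quantifier, which is not larger than the present one because its counter has
  decreased.\<close>

lemma lpeak_steps:
  "lpeak s l \<le> lpeak s (a # l)"
  "lpeak s (Areg r1 # l) \<le> lpeak s (Areg (Disj r1 r2) # l)"
  "lpeak s (Areg r2 # l) \<le> lpeak s (Areg (Disj r1 r2) # l)"
  "lpeak s (Areg r1 # Areg r2 # l) \<le> lpeak s (Areg (Sequence r1 r2) # l)"
  "lpeak s (Areg r2 # Areg r1 # l) \<le> lpeak s (Areg (Sequence r1 r2) # l)"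
  "lpeak s (Areg r # Aclose g # l) \<le> lpeak s (Areg (Group g r) # l)"
  "lpeak s [Areg r] \<le> lpeak s (Areg (Look k r) # l)"
  "lpeak s (Areg r # Acheck p # Areg (Quant r m (D - 1) greedy) # l)
     \<le> lpeak s (Areg (Quant r m D greedy) # l)"
  using peak_ge[of r1 s] peak_ge[of r2 s] vsize_venat_pred[of D, where 'a = 'a]
  by (auto simp: le_max_iff_disj)

text \<open>\<open>peak\<close> adds up, over all nodes, the size of the subtree there and at most
  one check. Keeping \<open>X\<close> fixed for all subtrees makes each node contribute at most the
  same factor.\<close>

lemma peak_bound:
  "vsize (vregex r) \<le> X \<Longrightarrow> peak s r \<le> vsize (vregex r) * (X + 2 * length s + 6)"
proof (induction r)
  case (Disj r1 r2)
  then have "peak s r1 \<le> vsize (vregex r1) * (X + 2 * length s + 6)"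
    "peak s r2 \<le> vsize (vregex r2) * (X + 2 * length s + 6)" by simp_all
  with Disj.prems show ?case by (simp add: algebra_simps)
next
  case (Sequence r1 r2)
  then have "peak s r1 \<le> vsize (vregex r1) * (X + 2 * length s + 6)"
    "peak s r2 \<le> vsize (vregex r2) * (X + 2 * length s + 6)" by simp_all
  with Sequence.prems show ?case by (simp add: algebra_simps)
next
  case (Group g r)
  then have "peak s r \<le> vsize (vregex r) * (X + 2 * length s + 6)" by simp
  with Group.prems show ?case by (simp add: algebra_simps)
next
  case (Quant r m D greedy)
  then have "peak s r \<le> vsize (vregex r) * (X + 2 * length s + 6)" by simp
  with Quant.prems show ?case by (simp add: algebra_simps)
next
  case (Look k r)
  then have "peak s r \<le> vsize (vregex r) * (X + 2 * length s + 6)" by simp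
  with Look.prems show ?case by (simp add: algebra_simps)
qed (simp_all add: algebra_simps)

text \<open>The weight of the actions that can still be executed without progress: nothing behind a check
  of the current position.\<close>

fun weight :: "dir \<Rightarrow> nat \<Rightarrow> 'c action list \<Rightarrow> nat" where
  "weight d p [] = 0"
| "weight d p (Areg r # l) = vsize (vregex r) + weight d p l"
| "weight d p (Aclose g # l) = Suc (weight d p l)"
| "weight d p (Acheck k # l) = (if further d p k then Suc (weight d p l) else 1)"

lemma weight_le_lsize: "weight d p l \<le> lsize s l"
  by (induction d p l rule: weight.induct) auto

section \<open>Length of a branch and height of the stack\<close>

primrec look_depth :: "'c regex \<Rightarrow> nat" where
  "look_depth Epsilon = 0"
| "look_depth (Chars cd) = 0"
| "look_depth (Disj r1 r2) = max (look_depth r1) (look_depth r2)"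
| "look_depth (Sequence r1 r2) = max (look_depth r1) (look_depth r2)"
| "look_depth (Group g r) = look_depth r"
| "look_depth (Backref g) = 0"
| "look_depth (Quant r m D greedy) = look_depth r"
| "look_depth (Look k r) = Suc (look_depth r)"
| "look_depth (Anchor a) = 0"

text \<open>\<open>C\<close> bounds the peak of the list of actions. Each branch of the backtracking tree has at most
  \<open>budget s C N l p d\<close> nodes when lookarounds are nested at most \<open>N\<close> deep.\<close>

definition budget :: "'c list \<Rightarrow> nat \<Rightarrow> nat \<Rightarrow> 'c action list \<Rightarrow> nat \<Rightarrow> dir \<Rightarrow> nat" where
  "budget s C N l p d =
     N * ((C + 1) * (length s + 1)) + weight d p l + (C + 1) * ahead d (length s) p"

definition groups_size :: "'c list \<Rightarrow> nat list \<Rightarrow> nat" where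
  "groups_size s gs = (\<Sum>g\<leftarrow>gs. vsize (vnat g :: 'c tval) + 2 * length s + 5) + 1"

definition frame_size :: "'c list \<Rightarrow> nat list \<Rightarrow> nat \<Rightarrow> nat" where
  "frame_size s gs C = C + 2 * length s + groups_size s gs + 20"

text \<open>Each step lowers the budget and pushes at most one frame, so at most as many frames as
  the budget lie above \<open>K\<close> at any time. The additional one pays for the current
  configuration.\<close>

definition bound :: "'c list \<Rightarrow> nat list \<Rightarrow> nat \<Rightarrow> nat \<Rightarrow> 'c action list \<Rightarrow> nat \<Rightarrow> dir \<Rightarrow> 'c tval \<Rightarrow> nat"
  where "bound s gs C N l p d K = vsize K + (budget s C N l p d + 1) * frame_size s gs C"

fun action_ok :: "'c list \<Rightarrow> nat list \<Rightarrow> nat \<Rightarrow> 'c action \<Rightarrow> bool" where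
  "action_ok s gs N (Areg r) \<longleftrightarrow>
     \<not> has_lower_bounded r \<and> set (group_ids r) \<subseteq> set gs \<and> look_depth r \<le> N"
| "action_ok s gs N (Aclose g) \<longleftrightarrow> True"
| "action_ok s gs N (Acheck k) \<longleftrightarrow> k \<le> length s"

definition valid :: "'c list \<Rightarrow> nat list \<Rightarrow> nat \<Rightarrow> nat \<Rightarrow> 'c action list \<Rightarrow> nat \<Rightarrow> group_list \<Rightarrow> bool" where
  "valid s gs C N l p gl \<longleftrightarrow>
     p \<le> length s \<and> lpeak s l \<le> C \<and> list_all (action_ok s gs N) l \<and> groups_ok s gs gl"

lemma vsize_vgroup: "(\<And>a. st = Opened a \<Longrightarrow> a \<le> length s) \<Longrightarrow> vsize (vgroup s st) \<le> 2 * length s + 3"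
  using vsize_vpre[of s] by (cases st) (simp_all add: vsize_letters)

lemma vsize_vgmap:
  assumes "groups_ok s gs gl"
  shows "vsize (vgmap s gl) \<le> groups_size s gs"
proof -
  let ?f = "\<lambda>g. vsize (vnat g :: 'a tval) + 2 * length s + 5"
  have "vsize (vgmap s gl) \<le> (\<Sum>g\<leftarrow>map fst gl. ?f g) + 1"
  proof (induction gl)
    case (Cons x gl)
    obtain g st where "x = (g, st)" by (cases x)
    then show ?case using Cons vsize_vgroup[of st s]
      by (cases st) (auto simp: vgmap_def vsize_letters vpre_def)
  qed (simp add: vgmap_def)
  also have "(\<Sum>g\<leftarrow>map fst gl. ?f g) = sum ?f (fst ` set gl)"
    using assms by (subst sum_list_distinct_conv_sum_set) (simp_all add: groups_ok_def)
  also have "\<dots> \<le> sum ?f (set gs)"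
    using assms by (intro sum_mono2) (auto simp: groups_ok_def)
  also have "\<dots> \<le> (\<Sum>g\<leftarrow>gs. ?f g)"
  proof (induction gs)
    case (Cons g gs)
    then show ?case by (cases "g \<in> set gs") (simp_all add: insert_absorb)
  qed simp
  finally show ?thesis by (simp add: groups_size_def)
qed

lemma vsize_config:
  assumes "valid s gs C N l p gl"
  shows "vsize (config s l p gl d) + 10 \<le> frame_size s gs C"
proof -
  have "vsize (vl (map (vaction s) l)) \<le> C + 1"
    using vsize_actions[of s l] lsize_le_lpeak[of s l] assms by (simp add: valid_def)
  moreover have "vsize (vgmap s gl) \<le> groups_size s gs"
    using assms by (intro vsize_vgmap) (simp add: valid_def)
  moreover have "vsize (vpos s p) \<le> 2 * length s + 3"
    using assms by (auto simp: vpos_def vpre_def vsize_letters valid_def)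
  moreover have "vsize (vdir d :: 'a tval) = 1" by (cases d) simp_all
  ultimately show ?thesis by (simp add: config_def vconf_def frame_size_def)
qed

lemma budget_less: "weight d p l < weight d p l' \<Longrightarrow> budget s C N l p d < budget s C N l' p d"
  by (simp add: budget_def)

text \<open>A move can reopen checks and thereby raise the weight, but never above \<open>C\<close>,
  the bound on the size of the list; each position is worth \<open>C + 1\<close> and pays for this.
  The first case is a backreference to an empty word, which leaves the position unchanged and only
  drops its own weight.\<close>

lemma budget_progress:
  assumes "p \<le> length s" "p' \<le> length s" "ahead d (length s) p' \<le> ahead d (length s) p"
    and "weight d p l < weight d p l'" "lsize s l \<le> C"
  shows "budget s C N l p' d < budget s C N l' p d"
proof (cases "p' = p")
  case True
  then show ?thesis using budget_less[OF assms(4)] by simp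
next
  case False
  then have "ahead d (length s) p' + 1 \<le> ahead d (length s) p"
    using assms(1-3) by (cases d) auto
  then have "(C + 1) * (ahead d (length s) p' + 1) \<le> (C + 1) * ahead d (length s) p"
    by (rule mult_le_mono2)
  moreover have "weight d p' l \<le> C" using weight_le_lsize[of d p' l s] assms(5) by simp
  moreover have "weight d p l' > 0" using assms(4) by simp
  ultimately show ?thesis unfolding budget_def by (simp add: algebra_simps)
qed

text \<open>The body starts with weight at most \<open>C\<close> and up to
  \<open>(C + 1) * length s\<close> for its positions, whatever its direction. Together this is less
  than the \<open>(C + 1) * (length s + 1)\<close> reserved for one level of nesting.\<close>

lemma budget_look:
  assumes "lsize s l \<le> C" "p \<le> length s" "weight d p l' > 0"
  shows "budget s C N l p d' < budget s C (Suc N) l' p d"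
proof -
  have "weight d' p l \<le> C" using weight_le_lsize[of d' p l s] assms(1) by simp
  moreover have "(C + 1) * ahead d' (length s) p \<le> (C + 1) * length s"
    using assms(2) by (intro mult_le_mono2) (cases d'; simp)
  ultimately show ?thesis using assms(3) unfolding budget_def by (simp add: algebra_simps)
qed

lemma bound_child:
  assumes "budget s C N' l' p' d' < budget s C N l p d" "vsize K' \<le> vsize K + frame_size s gs C"
  shows "bound s gs C N' l' p' d' K' \<le> bound s gs C N l p d K"
proof -
  have "(budget s C N' l' p' d' + 1) * frame_size s gs C \<le> budget s C N l p d * frame_size s gs C"
    using assms(1) by (intro mult_le_mono1) simp
  with assms(2) show ?thesis by (simp add: bound_def)
qed

lemma vsize_vEval:
  assumes "valid s gs C N l p gl"
  shows "vsize (vEval (config s l p gl d) K) \<le> bound s gs C N l p d K"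
    "4 + vsize K \<le> bound s gs C N l p d K"
    "groups_ok s gs gl' \<Longrightarrow> vsize (vSucc (vgmap s gl') K) \<le> bound s gs C N l p d K"
proof -
  have le: "frame_size s gs C + vsize K \<le> bound s gs C N l p d K" by (simp add: bound_def)
  show "vsize (vEval (config s l p gl d) K) \<le> bound s gs C N l p d K"
    using vsize_config[OF assms, of d] le by (simp add: vEval_def)
  show "4 + vsize K \<le> bound s gs C N l p d K" using le by (simp add: frame_size_def)
  show "vsize (vSucc (vgmap s gl') K) \<le> bound s gs C N l p d K" if "groups_ok s gs gl'"
    using vsize_vgmap[OF that] le by (simp add: vSucc_def frame_size_def)
qed

section \<open>Simulation\<close>

abbreviation "live v \<equiv> is_pair (vrest v)"

abbreviation "runs W \<equiv> iterates (vstep W) live"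

lemma live_simps [simp]:
  "live (vEval c K)" "live (vFail K) \<longleftrightarrow> is_pair K" "live (vSucc g K) \<longleftrightarrow> is_pair K"
  by (simp_all add: vrest_def vEval_def vFail_def vSucc_def)

text \<open>Just two facts about a result list are ever observed, by lookarounds as well as by the
  final answer: whether it is empty, and the group map of its first entry. The position of that
  entry is dropped. The stack \<open>K\<close> must come back untouched.\<close>

definition delivers :: "'c set \<Rightarrow> 'c list \<Rightarrow> nat list \<Rightarrow> nat \<Rightarrow> 'c tval \<Rightarrow> (nat \<times> group_map) list \<Rightarrow>
    'c tval \<Rightarrow> bool" where
  "delivers W s gs B v R K \<longleftrightarrow>
     (if R = [] then runs W B v (vFail K)
      else \<exists>gl. groups_ok s gs gl \<and> glookup gl = snd (hd R) \<and>
        runs W B v (vSucc (vgmap s gl) K))"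

lemma iterates_vsize_end: "iterates f P N u v \<Longrightarrow> vsize v \<le> N"
  by (induction rule: iterates.induct) auto

lemma delivers_step:
  assumes "live v" "vsize v \<le> B" "delivers W s gs B' (vstep W v) R K" "B' \<le> B"
  shows "delivers W s gs B v R K"
  using assms unfolding delivers_def
  by (auto intro: iterates_step iterates_mono split: if_splits)

lemma delivers_choice:
  assumes "delivers W s gs B v R1 (vChoice c K)" "delivers W s gs B (vEval c K) R2 K"
  shows "delivers W s gs B v (R1 @ R2) K"
proof (cases "R1 = []")
  case True
  with assms(1) have 1: "runs W B v (vFail (vChoice c K))" by (simp add: delivers_def)
  have "runs W B (vFail (vChoice c K)) w" if "runs W B (vEval c K) w" for w
    using iterates_vsize_end[OF 1] that by - (rule iterates_step, simp_all add: vstep_frames, simp add: vChoice_def)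
  with 1 assms(2) True show ?thesis
    unfolding delivers_def by (auto intro: iterates_trans split: if_splits)
next
  case False
  with assms(1) obtain gl where gl: "groups_ok s gs gl" "glookup gl = snd (hd R1)"
    and 1: "runs W B v (vSucc (vgmap s gl) (vChoice c K))" by (auto simp: delivers_def)
  have "vsize (vSucc (vgmap s gl) K) \<le> B"
    using iterates_vsize_end[OF 1] by (simp add: vSucc_def vChoice_def)
  then have "runs W B (vSucc (vgmap s gl) K) (vSucc (vgmap s gl) K)"
    by (rule iterates_refl)
  then have "runs W B (vSucc (vgmap s gl) (vChoice c K)) (vSucc (vgmap s gl) K)"
    using iterates_vsize_end[OF 1] by - (rule iterates_step, simp_all add: vstep_frames, simp add: vChoice_def)
  with 1 gl False show ?thesis unfolding delivers_def by (auto intro: iterates_trans)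
qed

lemma delivers_look:
  assumes 1: "delivers W s gs B v M (Pair (Pair (Atom (T_Look k)) (config s l p gl d)) K)"
    and pos: "\<And>gl'. positive k \<Longrightarrow> M \<noteq> [] \<Longrightarrow> groups_ok s gs gl' \<Longrightarrow> glookup gl' = snd (hd M) \<Longrightarrow>
      delivers W s gs B (vEval (config s l p gl' d) K) R K"
    and neg: "\<not> positive k \<Longrightarrow> M = [] \<Longrightarrow> delivers W s gs B (vEval (config s l p gl d) K) R K"
    and fail: "positive k \<longleftrightarrow> M = [] \<Longrightarrow> R = []"
  shows "delivers W s gs B v R K"
proof -
  let ?F = "Pair (Pair (Atom (T_Look k)) (config s l p gl d)) K"
  have prefix: "delivers W s gs B v R K"
    if "runs W B v w" "delivers W s gs B w R K" for w
    using that unfolding delivers_def by (auto intro: iterates_trans split: if_splits)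
  have failing: "delivers W s gs B (vFail K) [] K" if "vsize w \<le> B" "vsize (vFail K) \<le> vsize w" for w
    using that by (simp add: delivers_def iterates_refl)
  show ?thesis
  proof (cases "M = []")
    case True
    with 1 have it: "runs W B v (vFail ?F)" by (simp add: delivers_def)
    have B: "vsize (vFail ?F) \<le> B" by (rule iterates_vsize_end[OF it])
    have "delivers W s gs B (vFail K) [] K" by (rule failing[OF B]) (simp add: vFail_def)
    then have "delivers W s gs B (vstep W (vFail ?F)) R K"
      using neg fail True by (auto simp: vstep_frames)
    from delivers_step[OF _ B this] show ?thesis by (intro prefix[OF it]) simp
  next
    case False
    with 1 obtain gl' where gl': "groups_ok s gs gl'" "glookup gl' = snd (hd M)"
      and it: "runs W B v (vSucc (vgmap s gl') ?F)" by (auto simp: delivers_def)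
    have B: "vsize (vSucc (vgmap s gl') ?F) \<le> B" by (rule iterates_vsize_end[OF it])
    have "delivers W s gs B (vFail K) [] K" by (rule failing[OF B]) (simp add: vFail_def vSucc_def)
    then have "delivers W s gs B (vstep W (vSucc (vgmap s gl') ?F)) R K"
      using pos[OF _ False gl'] fail False by (auto simp: vstep_frames)
    from delivers_step[OF _ B this] show ?thesis by (intro prefix[OF it]) simp
  qed
qed

lemma delivers_mono: "delivers W s gs B v R K \<Longrightarrow> B \<le> B' \<Longrightarrow> delivers W s gs B' v R K"
  unfolding delivers_def by (auto intro: iterates_mono split: if_splits)

lemma delivers_fail:
  assumes "valid s gs C N l p gl" "vstep W (vEval (config s l p gl d) K) = vFail K"
  shows "delivers W s gs (bound s gs C N l p d K) (vEval (config s l p gl d) K) [] K"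
proof (rule delivers_step[OF _ vsize_vEval(1)[OF assms(1)] _ order_refl])
  show "delivers W s gs (bound s gs C N l p d K) (vstep W (vEval (config s l p gl d) K)) [] K"
    using vsize_vEval(2)[OF assms(1), of K d] unfolding assms(2) delivers_def
    by simp (rule iterates_refl, simp add: vFail_def)
qed simp

lemma delivers_next:
  assumes "valid s gs C N l p gl" "vstep W (vEval (config s l p gl d) K) = vEval (config s l' p' gl' d) K"
    and "budget s C N l' p' d < budget s C N l p d"
    and "delivers W s gs (bound s gs C N l' p' d K) (vEval (config s l' p' gl' d) K) R K"
  shows "delivers W s gs (bound s gs C N l p d K) (vEval (config s l p gl d) K) R K"
proof (rule delivers_step[OF _ vsize_vEval(1)[OF assms(1)]])
  show "bound s gs C N l' p' d K \<le> bound s gs C N l p d K"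
    by (rule bound_child[OF assms(3)]) simp
qed (simp_all only: live_simps assms(2,4))

text \<open>Hypothesis \<open>1\<close> is stated for every stack because the first branch runs
  above the frame of its alternative. The drop of the budget pays for this frame.\<close>

lemma delivers_branch:
  assumes v: "valid s gs C N l p gl"
    "vstep W (vEval (config s l p gl d) K) = vEval (config s l1 p gl1 d) (vChoice (config s l2 p gl2 d) K)"
    and b: "budget s C N l1 p d < budget s C N l p d" "budget s C N l2 p d < budget s C N l p d"
    and valid2: "valid s gs C N l2 p gl2"
    and 1: "\<And>K. delivers W s gs (bound s gs C N l1 p d K) (vEval (config s l1 p gl1 d) K) R1 K"
    and 2: "delivers W s gs (bound s gs C N l2 p d K) (vEval (config s l2 p gl2 d) K) R2 K"
  shows "delivers W s gs (bound s gs C N l p d K) (vEval (config s l p gl d) K) (R1 @ R2) K"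
proof (rule delivers_step[OF _ vsize_vEval(1)[OF v(1)] _ order_refl], simp, unfold v(2))
  let ?K = "vChoice (config s l2 p gl2 d) K"
  have "vsize ?K \<le> vsize K + frame_size s gs C"
    using vsize_config[OF valid2, of d] by (simp add: vChoice_def)
  from delivers_mono[OF 1 bound_child[OF b(1) this]] delivers_mono[OF 2 bound_child[OF b(2), of K K]]
  show "delivers W s gs (bound s gs C N l p d K) (vEval (config s l1 p gl1 d) ?K) (R1 @ R2) K"
    by (intro delivers_choice) simp_all
qed

lemma read_bound:
  assumes "max (length s) p' \<le> max (length s) p \<and>
    ahead d (max (length s) p') p' \<le> ahead d (max (length s) p) p" "p \<le> length s"
  shows "p' \<le> length s" "ahead d (length s) p' \<le> ahead d (length s) p"
proof -
  have max: "max (length s) p = length s" using assms(2) by simp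
  then show "p' \<le> length s" using assms(1) by simp
  then have "max (length s) p' = length s" by simp
  with assms(1) max show "ahead d (length s) p' \<le> ahead d (length s) p" by simp
qed

text \<open>Induction along the recursion of \<open>results\<close>. The stack and the list
  representing \<open>\<gamma>\<close> vary, as branches run on different stacks and the list is
  reordered by updates; the nesting bound \<open>N\<close> varies because a lookaround body has one
  level less. As the bound is part of the claim, correctness, termination and space follow from one
  induction.\<close>

lemma simulation:
  "valid s gs C N l p gl \<Longrightarrow> \<gamma> = glookup gl \<Longrightarrow>
   delivers W s gs (bound s gs C N l p d K) (vEval (config s l p gl d) K) (results W s l p \<gamma> d) K"
proof (induction W s l p \<gamma> d arbitrary: N gl K rule: results.induct)
  case (1 W s p \<gamma> d)
  have gl: "groups_ok s gs gl" using 1 by (simp add: valid_def)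
  show ?case
  proof (rule delivers_step[OF _ vsize_vEval(1)[OF 1(1)] _ order_refl])
    show "delivers W s gs (bound s gs C N [] p d K) (vstep W (vEval (config s [] p gl d) K))
        (results W s [] p \<gamma> d) K"
      using gl vsize_vEval(3)[OF 1(1) gl] 1(2)
      by (auto simp: vstep_Nil delivers_def intro: iterates_refl)
  qed simp
next
  case (2 W s k l p \<gamma> d)
  have p: "p \<le> length s" "k \<le> length s" and v: "valid s gs C N l p gl"
    using 2(2) lpeak_steps(1)[of s l "Acheck k"] by (auto simp: valid_def)
  show ?case
  proof (cases "further d p k")
    case True
    with delivers_next[OF 2(2), of W d K l p gl] 2(1)[OF True v 2(3)] show ?thesis
      by (simp add: vstep_tests(1)[OF p] budget_less)
  next
    case False
    with delivers_fail[OF 2(2), of W d K] show ?thesis by (simp add: vstep_tests(1)[OF p])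
  qed
next
  case (3 W s g l p \<gamma> d)
  have p: "p \<le> length s" and gl: "groups_ok s gs gl" using 3(2) by (auto simp: valid_def)
  obtain gl' where gl': "groups_ok s gs gl'" "glookup gl' = close_group g p (glookup gl)"
    and st: "vstep W (vEval (config s (Aclose g # l) p gl d) K) = vEval (config s l p gl' d) K"
    by (rule vstep_Aclose[OF p gl])
  have "valid s gs C N l p gl'"
    using 3(2) gl'(1) lpeak_steps(1)[of s l "Aclose g"] by (auto simp: valid_def)
  from delivers_next[OF 3(2) st _ 3(1)[OF this]] gl'(2) 3(3) show ?case by (simp add: budget_less)
next
  case (4 W s l p \<gamma> d)
  have v: "valid s gs C N l p gl"
    using 4(2) lpeak_steps(1)[of s l "Areg Epsilon"] by (auto simp: valid_def)
  from delivers_next[OF 4(2) vstep_basic(1) _ 4(1)[OF v 4(3)]] show ?case by (simp add: budget_less)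
next
  case (5 W s cd l p \<gamma> d)
  have p: "p \<le> length s" using 5(2) by (simp add: valid_def)
  show ?case
  proof (cases "read_char s cd p d")
    case None
    with delivers_fail[OF 5(2), of W d K] show ?thesis by (simp add: vstep_tests(3)[OF p])
  next
    case (Some p')
    note b = read_bound[OF read_char_bound[OF Some] p]
    have v: "valid s gs C N l p' gl"
      using 5(2) b lpeak_steps(1)[of s l "Areg (Chars cd)"] by (auto simp: valid_def)
    have "budget s C N l p' d < budget s C N (Areg (Chars cd) # l) p d"
      using v p b lsize_le_lpeak[of s l] by (intro budget_progress) (auto simp: valid_def)
    with delivers_next[OF 5(2), of W d K l p' gl] 5(1)[OF Some v 5(3)] Some show ?thesis
      by (simp add: vstep_tests(3)[OF p])
  qed
next
  case (6 W s r1 r2 l p \<gamma> d)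
  have v: "valid s gs C N (Areg r1 # l) p gl" "valid s gs C N (Areg r2 # l) p gl"
    using 6(3) lpeak_steps(2)[of s r1 l r2] lpeak_steps(3)[of s r2 l r1] by (auto simp: valid_def)
  show ?case
    unfolding results.simps
    by (rule delivers_branch[OF 6(3) vstep_basic(2) _ _ v(2) 6(1)[OF v(1) 6(4)] 6(2)[OF v(2) 6(4)]])
      (simp_all add: budget_less)
next
  case (7 W s r1 r2 l p \<gamma> d)
  have v: "valid s gs C N (Areg r1 # Areg r2 # l) p gl" "valid s gs C N (Areg r2 # Areg r1 # l) p gl"
    using 7(3) lpeak_steps(4)[of s r1 r2 l] lpeak_steps(5)[of s r2 r1 l] by (auto simp: valid_def)
  show ?case
  proof (cases d)
    case Forward
    with delivers_next[OF 7(3), of W d K "Areg r1 # Areg r2 # l" p gl] 7(1)[OF Forward v(1) 7(4)]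
    show ?thesis by (simp add: vstep_basic(3) budget_less)
  next
    case Backward
    with delivers_next[OF 7(3), of W d K "Areg r2 # Areg r1 # l" p gl] 7(2)[OF Backward v(2) 7(4)]
    show ?thesis by (simp add: vstep_basic(3) budget_less)
  qed
next
  case (8 W s r m D greedy l p \<gamma> d)
  then show ?case by (simp add: valid_def)
next
  case (9 W s r D greedy l p \<gamma> d)
  let ?Q = "\<lambda>D. Areg (Quant r 0 D greedy)" and ?\<gamma> = "reset_groups r \<gamma>"
  let ?l = "Areg r # Acheck p # ?Q (D - 1) # l" and ?gl = "greset r gl"
  have p: "p \<le> length s" and gl: "groups_ok s gs gl" using 9(4) by (auto simp: valid_def)
  have v: "valid s gs C N l p gl"
    using 9(4) lpeak_steps(1)[of s l "?Q D"] by (auto simp: valid_def)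
  note glr = groups_ok_reset[OF gl, of r]
  have vI: "valid s gs C N ?l p ?gl"
    using 9(4) lpeak_steps(8)[of s r p 0 D greedy l] glr by (auto simp: valid_def)
  have bS: "budget s C N l p d < budget s C N (?Q D # l) p d" by (simp add: budget_less)
  \<comment> \<open>The new check fails at the current position and hides the next copy of the
    quantifier and all of \<open>l\<close> from the weight. What remains is the body and the check,
    which together weigh less than the quantifier did.\<close>
  have "\<not> further d p p" by (cases d) simp_all
  then have bI: "budget s C N ?l p d < budget s C N (?Q D # l) p d"
    by (intro budget_less) simp
  show ?case
  proof (cases "D = 0")
    case True
    with delivers_next[OF 9(4), of W d K l p gl] 9(1)[OF True v 9(5)] bS show ?thesis
      by (simp add: vstep_Quant_0)
  next
    case D: False
    have res: "results W s (?Q D # l) p \<gamma> d = (if greedy then results W s ?l p ?\<gamma> d @ results W s l p \<gamma> d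
        else results W s l p \<gamma> d @ results W s ?l p ?\<gamma> d)"
      using D by (simp add: Let_def)
    have I: "delivers W s gs (bound s gs C N ?l p d K) (vEval (config s ?l p ?gl d) K)
        (results W s ?l p ?\<gamma> d) K" for K
      by (rule 9(2)[OF D vI]) (simp add: glr(2) 9(5))
    have S: "delivers W s gs (bound s gs C N l p d K) (vEval (config s l p gl d) K)
        (results W s l p \<gamma> d) K" for K
      by (rule 9(3)[OF D refl v 9(5)])
    show ?thesis
    proof (cases greedy)
      case True
      show ?thesis unfolding res
        using delivers_branch[OF 9(4) _ bI bS v I S] True D by (simp add: vstep_Quant)
    next
      case False
      show ?thesis unfolding res
        using delivers_branch[OF 9(4) _ bS bI vI S I] False D by (simp add: vstep_Quant)
    qed
  qed
next
  case (10 W s g r l p \<gamma> d)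
  have p: "p \<le> length s" and gl: "groups_ok s gs gl" and g: "g \<in> set gs" using 10(2) by (auto simp: valid_def)
  let ?gl = "(g, Opened p) # gremove g gl"
  note gl' = groups_ok_update[OF gl g, of "Opened p"]
  have v: "valid s gs C N (Areg r # Aclose g # l) p ?gl"
    using 10(2) gl'(1) p lpeak_steps(6)[of s r g l] by (auto simp: valid_def)
  have b: "budget s C N (Areg r # Aclose g # l) p d < budget s C N (Areg (Group g r) # l) p d"
    by (intro budget_less) simp
  have "\<gamma>(g := Opened p) = glookup ?gl" unfolding 10(3) using p by (intro gl'(2)[symmetric]) simp
  from delivers_next[OF 10(2) vstep_basic(4) b 10(1)[OF v this]] show ?case by (simp add: fun_upd_def)
next
  case (11 W s k r l p \<gamma> d)
  have p: "p \<le> length s" and gl: "groups_ok s gs gl" using 11(4) by (auto simp: valid_def)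
  let ?M = "results W s [Areg r] p \<gamma> (look_dir k)" and ?R = "results W s (Areg (Look k r) # l) p \<gamma> d"
  let ?B = "bound s gs C N (Areg (Look k r) # l) p d K"
  let ?K = "Pair (Pair (Atom (T_Look k)) (config s l p gl d)) K"
  \<comment> \<open>The lookaround at the head has depth at least one, so subtracting 1 loses
    nothing.\<close>
  have N: "N = Suc (N - 1)" using 11(4) by (auto simp: valid_def)
  have v: "valid s gs C N l p gl'" if "groups_ok s gs gl'" for gl'
    using 11(4) that lpeak_steps(1)[of s l "Areg (Look k r)"] by (auto simp: valid_def)
  have vM: "valid s gs C (N - 1) [Areg r] p gl"
    using 11(4) lpeak_steps(7)[of s r k l] by (auto simp: valid_def)
  have b: "budget s C N l p d < budget s C N (Areg (Look k r) # l) p d" by (simp add: budget_less)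
  have "lsize s [Areg r] \<le> C" using vM lsize_le_lpeak[of s "[Areg r]"] by (simp add: valid_def)
  then have bM: "budget s C (N - 1) [Areg r] p (look_dir k) < budget s C N (Areg (Look k r) # l) p d"
    using p by (subst (2) N) (intro budget_look, simp_all)
  have "vsize ?K \<le> vsize K + frame_size s gs C"
    using vsize_config[OF v[OF gl], of d] by simp
  from delivers_mono[OF 11(1)[OF vM 11(5), of ?K] bound_child[OF bM this]]
  have 1: "delivers W s gs ?B (vEval (config s [Areg r] p gl (look_dir k)) ?K) ?M ?K" .
  have "delivers W s gs ?B (vEval (config s [Areg r] p gl (look_dir k)) ?K) ?R K"
  proof (rule delivers_look[OF 1])
    fix gl' assume *: "positive k" "?M \<noteq> []" "groups_ok s gs gl'" "glookup gl' = snd (hd ?M)"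
    then obtain p' M where M: "?M = (p', glookup gl') # M" by (cases ?M) auto
    have "delivers W s gs (bound s gs C N l p d K) (vEval (config s l p gl' d) K)
        (results W s l p (glookup gl') d) K"
      using 11(2)[OF refl *(1) M refl v[OF *(3)] refl] by simp
    from delivers_mono[OF this bound_child[OF b]] M *(1)
    show "delivers W s gs ?B (vEval (config s l p gl' d) K) ?R K" by simp
  next
    assume *: "\<not> positive k" "?M = []"
    have "delivers W s gs (bound s gs C N l p d K) (vEval (config s l p gl d) K)
        (results W s l p \<gamma> d) K"
      using 11(3)[OF refl *(1) *(2) v[OF gl] 11(5)] .
    from delivers_mono[OF this bound_child[OF b]] *
    show "delivers W s gs ?B (vEval (config s l p gl d) K) ?R K" by simp
  next
    assume "positive k \<longleftrightarrow> ?M = []"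
    then show "?R = []" by auto
  qed
  then show ?case
    by - (rule delivers_step[OF _ vsize_vEval(1)[OF 11(4)] _ order_refl], simp_all only: live_simps vstep_basic(5))
next
  case (12 W s a l p \<gamma> d)
  have p: "p \<le> length s" and v: "valid s gs C N l p gl"
    using 12(2) lpeak_steps(1)[of s l "Areg (Anchor a)"] by (auto simp: valid_def)
  show ?case
  proof (cases "anchor_holds W s a p")
    case True
    with delivers_next[OF 12(2), of W d K l p gl] 12(1)[OF True v 12(3)] show ?thesis
      by (simp add: vstep_tests(2)[OF p] budget_less)
  next
    case False
    with delivers_fail[OF 12(2), of W d K] show ?thesis by (simp add: vstep_tests(2)[OF p])
  qed
next
  case (13 W s g l p \<gamma> d)
  have p: "p \<le> length s" and gl: "distinct (map fst gl)" using 13(2) by (auto simp: valid_def groups_ok_def)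
  show ?case
  proof (cases "read_backref s (\<gamma> g) p d")
    case None
    with delivers_fail[OF 13(2), of W d K] 13(3) show ?thesis by (simp add: vstep_Backref[OF p gl])
  next
    case (Some p')
    note b = read_bound[OF read_backref_bound[OF Some] p]
    have v: "valid s gs C N l p' gl"
      using 13(2) b lpeak_steps(1)[of s l "Areg (Backref g)"] by (auto simp: valid_def)
    have "budget s C N l p' d < budget s C N (Areg (Backref g) # l) p d"
      using v p b lsize_le_lpeak[of s l] by (intro budget_progress) (auto simp: valid_def)
    with delivers_next[OF 13(2), of W d K l p' gl] 13(1)[OF Some v 13(3)] Some 13(3) show ?thesis
      by (simp add: vstep_Backref[OF p gl])
  qed
qed

section \<open>Deciding the matching problem\<close>

text \<open>A match may start anywhere, so the regex is searched behind a lazy star of arbitrary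
  characters.\<close>

abbreviation skip_chars :: "'c regex" where "skip_chars \<equiv> Quant (Chars UNIV) 0 \<infinity> False"

text \<open>Every iteration consumes a character, so its check succeeds, and a lazy star lists the
  results from \<open>p\<close> before those from \<open>p + 1\<close>. It contains no groups, so
  each attempt starts from the same \<open>\<gamma>\<close>.\<close>

lemma results_skip_chars:
  "p \<le> length s \<Longrightarrow> results W s (Areg skip_chars # l) p \<gamma> Forward = [] \<longleftrightarrow>
     (\<forall>k. p \<le> k \<and> k \<le> length s \<longrightarrow> results W s l k \<gamma> Forward = [])"
proof (induction "length s - p" arbitrary: p)
  case 0
  then have p: "p = length s" by simp
  then have "(\<forall>k. p \<le> k \<and> k \<le> length s \<longrightarrow> results W s l k \<gamma> Forward = []) \<longleftrightarrow>
      results W s l p \<gamma> Forward = []" by (auto dest: order_antisym)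
  then show ?case by (simp add: Let_def p)
next
  case (Suc n)
  then have p: "p < length s" by simp
  have "results W s (Areg skip_chars # l) p \<gamma> Forward =
      results W s l p \<gamma> Forward @ results W s (Areg skip_chars # l) (Suc p) \<gamma> Forward"
    using p by (subst results.simps) (simp add: Let_def reset_groups_def)
  moreover have "results W s (Areg skip_chars # l) (Suc p) \<gamma> Forward = [] \<longleftrightarrow>
      (\<forall>k. Suc p \<le> k \<and> k \<le> length s \<longrightarrow> results W s l k \<gamma> Forward = [])"
    using Suc p by (intro Suc(1)) auto
  moreover have "(\<forall>k. p \<le> k \<and> k \<le> length s \<longrightarrow> Q k) \<longleftrightarrow> Q p \<and> (\<forall>k. Suc p \<le> k \<and> k \<le> length s \<longrightarrow> Q k)"
    for Q using p by (metis Suc_leD Suc_leI le_neq_implies_less order_refl)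
  ultimately show ?case by (simp only: append_is_Nil_conv)
qed

lemma has_match_search:
  "has_match W r s \<longleftrightarrow> results W s [Areg (Sequence skip_chars r)] 0 (\<lambda>_. Undefined) Forward \<noteq> []"
proof -
  have "results W s [Areg (Sequence skip_chars r)] 0 (\<lambda>_. Undefined) Forward =
      results W s [Areg skip_chars, Areg r] 0 (\<lambda>_. Undefined) Forward"
    by (simp only: results.simps(7) dir.case)
  then show ?thesis
    using results_skip_chars[of 0 s W "[Areg r]" "\<lambda>_. Undefined"]
    unfolding has_match_def by (metis le0)
qed

definition vparse_input :: "'c tval \<Rightarrow> 'c tval" where
  "vparse_input v = vfold (\<lambda>e. vparse_step) vnil (vrev_onto v vnil) (vstack [IStr []])"

lemma vparse_input: "vparse_input (vl (map Atom ts)) = parsed ts"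
  by (simp add: vparse_input_def vfold_vl vparse_def foldr_conv_fold)

lemma computable_vparse_input: "computable vparse_input"
  unfolding vparse_input_def
proof (rule computable_vfold[where k = 9])
  show "vsize (vparse_step x acc) \<le> vsize acc + 9 * (vsize e + vsize x)" for e x acc :: "'a tval"
    using vsize_vparse_step[of x acc] by simp
  show "computable (\<lambda>v. vstack [IStr []] :: 'a tval)"
    unfolding list.map vitem.simps letters_simps vlist_simps by (intro computable_basic)
qed (intro computable_basic computable_vparse_step computable_vrev_onto)+

text \<open>Every input that is not the code of an admissible instance is sent to
  \<open>vFail vnil\<close>, which is already final. Otherwise the tree built here is the value of
  \<open>Sequence skip_chars r\<close>, with \<open>vfail\<close> as the code of the unbounded
  counter.\<close>

definition vstart :: "'c tval \<Rightarrow> 'c tval" where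
  "vstart st =
     (if item_reg (vfst st) \<and> item_str (vfst (vsnd st)) \<and> is_tok T_End (vsnd (vsnd st)) \<and>
         vdistinct (vgroup_ids (vsnd (vfst st)))
      then vEval (vconf
        (Pair (Pair (Atom T_Sequence) (Pair (Pair (Atom (T_Quant False))
          (Pair vfail (Pair (Atom (T_Chars UNIV)) vnil))) (vsnd (vfst st)))) vnil)
        (Pair vnil (vsnd (vfst (vsnd st)))) vnil (Atom (T_Bit True))) vnil
      else vFail vnil)"

lemma computable_vstart: "computable (vstart :: 'c::finite token val \<Rightarrow> _)"
  unfolding vstart_def vEval_def vconf_def vFail_def
  by (intro computable_basic decidable_vdistinct computable_vgroup_ids)

lemma vstart_instance:
  assumes "\<not> has_lower_bounded r" "js_regex r"
  shows "vstart (vparse (enc_instance r s) (vstack [IStr []])) =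
    vEval (config s [Areg (Sequence skip_chars r)] 0 [] Forward) vnil"
proof -
  have "vdistinct (vgroup_ids (vregex r))"
    using assms(2) vdistinct_vnat[of "rev (group_ids r)"]
    by (simp add: vgroup_ids_vregex js_regex_def rev_map)
  then show ?thesis
    using vparse_enc_instance[OF assms(1), of s]
    by (simp add: vstart_def config_def vpos_def vpre_def vgmap_def)
qed

lemma vstart_fail:
  fixes ts :: "'c token list"
  assumes "\<And>r s. \<not> has_lower_bounded r \<Longrightarrow> js_regex r \<Longrightarrow> ts \<noteq> enc_instance r s"
  shows "vstart (parsed ts) = vFail vnil"
proof (rule ccontr)
  let ?st = "parsed ts"
  assume "vstart ?st \<noteq> vFail vnil"
  then have st: "item_reg (vfst ?st)" "item_str (vfst (vsnd ?st))" "is_tok T_End (vsnd (vsnd ?st))"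
    "vdistinct (vgroup_ids (vsnd (vfst ?st)))" by (auto simp: vstart_def split: if_splits)
  then have "?st \<noteq> vfail" by auto
  from vparse_sound[OF this] obtain "is" where "is": "?st = vstack is"
    "concat (map item_tokens is) = ts" "\<And>r. IReg r \<in> set is \<Longrightarrow> \<not> has_lower_bounded r" by blast
  note st = st[unfolded "is"(1)]
  from st(1) obtain r is' where 1: "is = IReg r # is'" by (auto simp: item_tags)
  from st(2) obtain s is'' where 2: "is' = IStr s # is''" by (auto simp: item_tags 1)
  from st(3) have 3: "is'' = []" by (cases is'') (simp_all add: 1 2)
  from st(4) have "js_regex r"
    using vdistinct_vnat[of "rev (group_ids r)", where 'c = 'c]
    by (simp add: 1 vgroup_ids_vregex js_regex_def rev_map)
  moreover have "\<not> has_lower_bounded r" by (rule "is"(3)) (simp add: 1)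
  moreover have "ts = enc_instance r s" using "is"(2) by (simp add: 1 2 3 enc_instance_def)
  ultimately show False using assms by blast
qed

section \<open>The polynomial space bound\<close>

lemma group_ids_size:
  "(\<Sum>g\<leftarrow>group_ids r. vsize (vnat g :: 'c tval)) + length (group_ids r) \<le> vsize (vregex r :: 'c tval)"
  by (induction r) simp_all

lemma groups_size_bound:
  "groups_size s (group_ids r) \<le> vsize (vregex r :: 'c tval) * (2 * length (s :: 'c list) + 6) + 1"
proof -
  have eq: "(\<Sum>g\<leftarrow>gs. vsize (vnat g :: 'c tval) + 2 * length s + 5) =
      (\<Sum>g\<leftarrow>gs. vsize (vnat g :: 'c tval)) + length gs * (2 * length s + 5)" for gs
    by (induction gs) (simp_all add: algebra_simps)
  have "length (group_ids r) * (2 * length s + 5) \<le> vsize (vregex r :: 'c tval) * (2 * length s + 5)"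
    using group_ids_size[of r] by (intro mult_le_mono1) simp
  then show ?thesis
    using group_ids_size[of r] unfolding groups_size_def eq by (simp add: algebra_simps)
qed

lemma look_depth_le: "look_depth r \<le> vsize (vregex r)"
  by (induction r) simp_all

text \<open>The value \<open>V * (3 * V + 6)\<close> is what \<open>peak_bound\<close> gives when
  the syntax tree and the string both have size at most \<open>V\<close>.\<close>

definition peak_poly :: "nat poly" where "peak_poly = [:0, 6, 3:]"

definition frame_poly :: "nat poly" where "frame_poly = peak_poly + [:20, 2:] + [:1, 6, 2:]"

definition budget_poly :: "nat poly" where
  "budget_poly = [:0, 1:] * ((peak_poly + 1) * [:1, 1:]) + [:0, 1:] + (peak_poly + 1) * [:0, 1:]"

text \<open>The constant of the first summand is the size of the empty stack \<open>vnil\<close>.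
  Its linear term makes the polynomial at least the size of the start state itself, which settles
  the rejected inputs whose run has no steps.\<close>

definition space_poly :: "nat poly" where
  "space_poly = [:1, 1:] + (budget_poly + 1) * frame_poly"

lemma bound_poly:
  fixes r :: "'c regex" and s :: "'c list"
  assumes "vsize (vregex r) \<le> V" "length s \<le> V"
  shows "bound s (group_ids r) (peak s r) (look_depth r) [Areg r] 0 Forward vnil \<le> poly space_poly V"
proof -
  let ?C = "peak s r"
  have "?C \<le> vsize (vregex r) * (vsize (vregex r) + 2 * length s + 6)" by (rule peak_bound) simp
  also have "\<dots> \<le> V * (V + 2 * V + 6)"
    using assms by (intro mult_le_mono add_mono) simp_all
  also have "\<dots> = poly peak_poly V" by (simp add: peak_poly_def algebra_simps)
  finally have C: "?C \<le> poly peak_poly V" .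
  have "groups_size s (group_ids r) \<le> vsize (vregex r) * (2 * length s + 6) + 1"
    by (rule groups_size_bound)
  also have "\<dots> \<le> V * (2 * V + 6) + 1"
    using assms by (intro add_mono mult_le_mono) simp_all
  finally have F: "frame_size s (group_ids r) ?C \<le> poly frame_poly V"
    using C assms(2) by (simp add: frame_size_def frame_poly_def algebra_simps)
  have "look_depth r \<le> V" using look_depth_le[of r] assms(1) by simp
  then have "budget s ?C (look_depth r) [Areg r] 0 Forward
      \<le> V * ((poly peak_poly V + 1) * (V + 1)) + V + (poly peak_poly V + 1) * V"
    unfolding budget_def using assms C
    by (intro add_mono mult_le_mono) simp_all
  also have "\<dots> = poly budget_poly V" by (simp add: budget_poly_def algebra_simps)
  finally have "(budget s ?C (look_depth r) [Areg r] 0 Forward + 1) * frame_size s (group_ids r) ?C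
      \<le> (poly budget_poly V + 1) * poly frame_poly V"
    using F by (intro mult_le_mono) simp_all
  then show ?thesis by (simp add: bound_def space_poly_def)
qed

section \<open>The outcome of a run\<close>

lemma iterates_deterministic:
  "iterates f P N u v \<Longrightarrow> \<not> P v \<Longrightarrow> iterates f P N' u w \<Longrightarrow> \<not> P w \<Longrightarrow> v = w"
proof (induction rule: iterates.induct)
  case (iterates_refl u)
  from iterates_refl(3,2) show ?case by (cases rule: iterates.cases) auto
next
  case (iterates_step u v)
  from iterates_step(6) show ?case
    by (cases rule: iterates.cases) (use iterates_step in auto)
qed

text \<open>From an arbitrary value the loop may diverge, so the final state is selected by choice.
  Determinism makes it unique, and the start states produced by \<open>vstart\<close> from parsed
  inputs are shown to have one; this is the reason for working with
  \<open>computable_on\<close>.\<close>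

definition vrun :: "'c set \<Rightarrow> 'c tval \<Rightarrow> 'c tval" where
  "vrun W v = (SOME w. (\<exists>N. runs W N v w) \<and> \<not> live w)"

lemma vrun_eqI: "runs W N v w \<Longrightarrow> \<not> live w \<Longrightarrow> vrun W v = w"
  unfolding vrun_def by (rule some_equality) (auto dest: iterates_deterministic)

lemma run_vstart:
  fixes ts :: "'c token list"
  obtains w where
    "runs W (poly space_poly (vsize (vstart (parsed ts))))
      (vstart (parsed ts)) w"
    "\<not> live w"
    "is_tok T_Group (vfst w) \<longleftrightarrow> ts \<in> JSREGTEST W {r. js_regex r \<and> \<not> has_lower_bounded r}"
proof (cases "\<exists>r s. \<not> has_lower_bounded r \<and> js_regex r \<and> ts = enc_instance r s")
  case True
  then obtain r s where r: "\<not> has_lower_bounded r" "js_regex r" and ts: "ts = enc_instance r s" by blast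
  let ?r = "Sequence skip_chars r"
  let ?v = "vEval (config s [Areg ?r] 0 [] Forward) vnil"
  have "valid s (group_ids ?r) (peak s ?r) (look_depth ?r) [Areg ?r] 0 []"
    using r(1) by (simp add: valid_def groups_ok_def)
  moreover have "glookup [] = (\<lambda>_. Undefined)" by (simp add: glookup_def fun_eq_iff)
  ultimately have "delivers W s (group_ids ?r)
      (bound s (group_ids ?r) (peak s ?r) (look_depth ?r) [Areg ?r] 0 Forward vnil) ?v
      (results W s [Areg ?r] 0 (\<lambda>_. Undefined) Forward) vnil"
    by (intro simulation) simp_all
  \<comment> \<open>The start state contains the syntax tree and the string, so its own size can
    play the role of \<open>V\<close>.\<close>
  moreover have "bound s (group_ids ?r) (peak s ?r) (look_depth ?r) [Areg ?r] 0 Forward vnil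
      \<le> poly space_poly (vsize ?v)"
    by (rule bound_poly) (simp_all add: vEval_def config_def vconf_def vpos_def vsize_letters)
  ultimately have run: "delivers W s (group_ids ?r) (poly space_poly (vsize ?v)) ?v
      (results W s [Areg ?r] 0 (\<lambda>_. Undefined) Forward) vnil" by (rule delivers_mono)
  have mem: "ts \<in> JSREGTEST W {r. js_regex r \<and> \<not> has_lower_bounded r} \<longleftrightarrow> has_match W r s"
    using r by (auto simp: JSREGTEST_def ts enc_instance_inject)
  note result = that[unfolded ts vstart_instance[OF r]]
  show thesis
  proof (cases "has_match W r s")
    case True
    then obtain gl where "runs W (poly space_poly (vsize ?v)) ?v (vSucc (vgmap s gl) vnil)"
      using run by (auto simp: delivers_def has_match_search simp del: results.simps)
    then show thesis by (rule result) (use mem True ts in \<open>simp_all, simp_all add: vSucc_def\<close>)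
  next
    case False
    then have "runs W (poly space_poly (vsize ?v)) ?v (vFail vnil)"
      using run by (auto simp: delivers_def has_match_search simp del: results.simps)
    then show thesis by (rule result) (use mem False ts in \<open>simp_all, simp_all add: vFail_def\<close>)
  qed
next
  case False
  then have st: "vstart (parsed ts) = vFail vnil" by (intro vstart_fail) blast
  have "ts \<notin> JSREGTEST W {r. js_regex r \<and> \<not> has_lower_bounded r}"
    using False by (auto simp: JSREGTEST_def)
  moreover have "runs W (poly space_poly (vsize (vFail vnil :: 'c tval)))
      (vFail vnil) (vFail vnil)"
    by (rule iterates_refl) (simp add: space_poly_def)
  ultimately show thesis
    by (intro that[of "vFail vnil", unfolded st]) (simp_all, simp add: vFail_def)
qed

theorem theorem14:
  fixes W :: "'c::finite set"
  shows "JSREGTEST W {r :: 'c regex. js_regex r \<and> \<not> has_lower_bounded r} \<in> PSPACE"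
proof (rule PSPACE_computable[where z = T_End and P = "\<lambda>h. h = Some T_Group"
    and h = "\<lambda>v. vfst (vrun W (vstart (vparse_input v)))"])
  let ?D = "range (\<lambda>ts. vl (map Atom ts)) :: 'c tval set"
  let ?E = "range (\<lambda>ts. vstart (parsed ts)) :: 'c tval set"
  have "computable_on ?E (vrun W)"
  proof (rule computable_while[OF computable_vstep computable_vrest, where P = "\<lambda>h. h = None"])
    fix v assume "v \<in> ?E"
    then obtain ts where v: "v = vstart (parsed ts)" by blast
    obtain w where w: "runs W (poly space_poly (vsize v)) v w" "\<not> live w"
      using run_vstart[of W ts] unfolding v by blast
    then show "runs W (poly space_poly (vsize v)) v (vrun W v)"
      "\<not> live (vrun W v)" using vrun_eqI[OF w] by simp_all
  qed
  note run = this
  have start: "computable_on ?D (\<lambda>v. vstart (vparse_input v))"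
    by (rule computable_on_comp[where E = UNIV, OF _ computable_vstart])
      (simp_all add: computable_on_subset[OF computable_vparse_input])
  have "computable_on ?D (\<lambda>v. vrun W (vstart (vparse_input v)))"
  proof (rule computable_on_comp[OF start run])
    fix v assume "v \<in> ?D"
    then obtain ts where "v = vl (map Atom ts)" by blast
    then have "vstart (vparse_input v) = vstart (parsed ts)"
      by (simp only: vparse_input)
    then show "vstart (vparse_input v) \<in> ?E" by (rule range_eqI)
  qed
  then show "computable_on ?D (\<lambda>v. vfst (vrun W (vstart (vparse_input v))))"
    by (rule computable_on_comp[OF _ computable_vfst_id]) simp
next
  fix ts :: "'c token list"
  obtain w where w: "runs W (poly space_poly (vsize (vstart (parsed ts))))
      (vstart (parsed ts)) w" "\<not> live w"
    "is_tok T_Group (vfst w) \<longleftrightarrow> ts \<in> JSREGTEST W {r. js_regex r \<and> \<not> has_lower_bounded r}"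
    using run_vstart[of W ts] by blast
  show "ts \<in> JSREGTEST W {r. js_regex r \<and> \<not> has_lower_bounded r} \<longleftrightarrow>
      is_tok T_Group (vfst (vrun W (vstart (vparse_input (vl (map Atom ts))))))"
    unfolding vparse_input vrun_eqI[OF w(1,2)] using w(3) by simp
qed

end
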